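(* Let $(\hat\pi_k)$ be a sequence of probability measures on $\mathbb{N}_0$ with $\sum_{j\ge0}j\hat\pi_k(j)=1$ for all $k$, and let $(h_k)$, $(\tau_k)$ be positive sequences converging to zero. Let $$\breve\mu_k=\frac1{\tau_k}\sum_{j\ge2}(j-1)\hat\pi_k(j)\,\delta_{jh_k},\qquad \nu^{h_k}_n=\frac1{h_k}\sum_{j\ge1}\mathbb{P}\{X_{n,k}=j\}\,\delta_{jh_k},$$ where $(X_{n,k})_{n\ge0}$ is the Galton-Watson process with family-size distribution $\hat\pi_k$ and $X_{0,k}=1$. Suppose $(\breve\mu_k)$ Lévy-converges to a finite measure $\kappa$ on $[0,\infty]$, with associated Lévy triple $(\alpha_0,\alpha_\infty,\mu)$ given by $d\kappa=\alpha_0\,d\delta_0+\alpha_\infty\,d\delta_\infty+(x\wedge1)\,d\mu(x)$; let $$\Psi(q)=\tfrac12\alpha_0q^2+\alpha_\infty q+\int_{(0,\infty)}\frac{e^{-qx}-1+qx}{x}\,d\mu(x),$$ let $\varphi$ be the solution of $\partial_t\varphi(q,t)=-\Psi(\varphi(q,t))$, $\varphi(q,0)=q$, and let $\beta_0(t)\ge0$ and the measures $\nu_t$ on $(0,\infty)$, with $\int(x\wedge1)\,d\nu_t<\infty$, be determined by $$\varphi(q,t)=\beta_0(t)q+\int_{(0,\infty)}(1-e^{-qx})\,d\nu_t(x).$$ (a) For every $t\ge0$, as $k\to\infty$ and whenever $n\tau_k\to t$ (with $n=n_k$), $$(x\wedge1)\,d\nu^{h_k}_n(x)\to\beta_0(t)\,d\delta_0(x)+(x\wedge1)\,d\nu_t(x)\quad\text{weak-}\star\text{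 on }[0,\infty].\qquad( * )$$ Conversely, without assuming Lévy-convergence of $(\breve\mu_k)$, if the convergence $( * )$ holds (for every $t\ge0$, whenever $n\tau_k\to t$) for some $\beta_0(t)\ge 0$ and some measures $\nu_t$ on $(0,\infty)$ with $\int(x\wedge1)\,d\nu_t<\infty$, then $(\breve\mu_k)$ Lévy-converges to some finite measure $\kappa$ on $[0,\infty]$. (b) $\beta_0(t)=0$ for all $t>0$ if and only if $\Psi'(\infty)=\infty$, or equivalently $\alpha_0>0$ or $\int_{(0,\infty)}d\mu(x)=\infty$. In case $\Psi'(\infty)<\infty$, then $\beta_0(t)=\exp(-\Psi'(\infty)t)$. (c) For $t>0$, $\varphi(\infty,t)=\langle1,\nu_t\rangle<\infty$ if and only if Grey's condition $\int_{[1,\infty)}\frac{du}{\Psi(u)}<\infty$ holds. In this case, the limiting family of finite measures $(\nu_t)$ is a weak solution of the generalized damped Smoluchowski equation: for all $f\in C([0,\infty])$ and $t>0$, $$\partial_t\langle f,\nu_t\rangle=-\Psi'(0^+)\langle f,\nu_t\rangle+\sum_{k\ge2}R_kI_k(\nu_t,f),$$ where, with $\rho_t=\langle1,\nu_t\rangle$, $$R_k=\frac{(-\rho_t)^k\Psi^{(k)}(\rho_t)}{k!},\qquad I_k(\nu,f)=\int_{(0,\infty)^k}\Big(f(x_1+\dots+x_k)-\sum_{i=1}^kf(x_i)\Big)\prod_{i=1}^k\frac{d\nu(x_i)}{\langle1,\nu\rangle}.$$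
   Context: $\mathbb{N}_0=\{0,1,2,\dots\}$; $\delta_x$ is the Dirac mass at $x$; $x\wedge 1=\min(x,1)$; $\langle f,\nu\rangle=\int_{(0,\infty)}f\,d\nu$; $\Psi'(\infty)=\lim_{q\to\infty}\Psi'(q)$ and $\varphi(\infty,t)=\lim_{q\to\infty}\varphi(q,t)$. For each $t\ge 0$ the function $\varphi(\cdot,t)$ is a Bernstein function and admits the stated representation with unique $\beta_0(t)$, $\nu_t$. Lévy-convergence: $(\breve\mu_k)$ Lévy-converges to a finite measure $\kappa$ on $[0,\infty]$ if $(x\wedge1)\,d\breve\mu_k(x)\to d\kappa(x)$ weak-$\star$ on $[0,\infty]$, i.e. when tested against every $g\in C([0,\infty])$. A Lévy triple is $(\alpha_0,\alpha_\infty,\mu)$ with $\alpha_0,\alpha_\infty\ge 0$ and $\mu$ a nonnegative measure on $(0,\infty)$ with $\int_{(0,\infty)}(x\wedge 1)\,d\mu(x)<\infty$. *)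

theory Defs
  imports "HOL-Probability.Probability"
begin

section \<open>Measures on the half-line and their compactification\<close>

text \<open>
  A measure on \<open>(0,\<infinity>)\<close> is a \<^typ>\<open>real measure\<close> whose space is \<^term>\<open>{0<..} :: real set\<close>, with the
  Borel sets of that subspace.  The compact interval \<open>[0,\<infinity>]\<close> is the type \<^typ>\<open>ennreal\<close>, so that
  \<open>C([0,\<infinity>])\<close> consists of the functions \<open>g :: ennreal \<Rightarrow> real\<close> that are continuous on \<^term>\<open>UNIV\<close>, and
  \<^const>\<open>ennreal\<close> is the embedding of \<open>(0,\<infinity>)\<close>.
\<close>

definition pos_borel :: "real measure" where
  "pos_borel = restrict_space borel {0<..}"

definition levy_measure :: "real measure \<Rightarrow> bool" where
  "levy_measure \<mu> \<longleftrightarrow> sets \<mu> = sets pos_borel \<and> (\<integral>\<^sup>+x. ennreal (min x 1) \<partial>\<mu>) < \<infinity>"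

definition levy_triple :: "real \<Rightarrow> real \<Rightarrow> real measure \<Rightarrow> bool" where
  "levy_triple a0 ainf \<mu> \<longleftrightarrow> 0 \<le> a0 \<and> 0 \<le> ainf \<and> levy_measure \<mu>"

text \<open>The measure \<open>(x \<and> 1) d\<mu>(x)\<close>, transported to \<open>[0,\<infinity>]\<close>.\<close>

definition min1_measure :: "real measure \<Rightarrow> ennreal measure" where
  "min1_measure \<mu> = distr (density \<mu> (\<lambda>x. ennreal (min x 1))) borel ennreal"

text \<open>The measure \<open>a\<^sub>0 d\<delta>\<^sub>0 + a\<^sub>\<infinity> d\<delta>\<^sub>\<infinity> + (x \<and> 1) d\<mu>(x)\<close> on \<open>[0,\<infinity>]\<close>.\<close>

definition kappa_measure :: "real \<Rightarrow> real \<Rightarrow> real measure \<Rightarrow> ennreal measure" where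
  "kappa_measure a0 ainf \<mu> = measure_of UNIV (sets borel)
     (\<lambda>A. ennreal a0 * indicator A 0 + ennreal ainf * indicator A \<infinity> + emeasure (min1_measure \<mu>) A)"

lemma sets_kappa_measure [simp]: "sets (kappa_measure a0 ainf \<mu>) = sets borel"
  by (simp add: kappa_measure_def sets.sigma_sets_eq[of borel, simplified])

lemma emeasure_kappa_measure:
  assumes "A \<in> sets borel"
  shows "emeasure (kappa_measure a0 ainf \<mu>) A =
    ennreal a0 * indicator A 0 + ennreal ainf * indicator A \<infinity> + emeasure (min1_measure \<mu>) A"
proof (rule emeasure_measure_of[OF kappa_measure_def])
  let ?m = "\<lambda>A. ennreal a0 * indicator A 0 + ennreal ainf * indicator A \<infinity> + emeasure (min1_measure \<mu>) A"
  show "positive (sets (kappa_measure a0 ainf \<mu>)) ?m"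
    by (simp add: positive_def)
  show "countably_additive (sets (kappa_measure a0 ainf \<mu>)) ?m"
  proof (rule countably_additiveI)
    fix B :: "nat \<Rightarrow> ennreal set"
    assume B: "range B \<subseteq> sets (kappa_measure a0 ainf \<mu>)" "disjoint_family B"
    have "range B \<subseteq> sets (min1_measure \<mu>)"
      using B(1) by (simp add: min1_measure_def)
    then have "(\<Sum>i. emeasure (min1_measure \<mu>) (B i)) = emeasure (min1_measure \<mu>) (\<Union>i. B i)"
      using B(2) by (rule suminf_emeasure)
    moreover have "(\<Sum>i. ?m (B i)) = ennreal a0 * (\<Sum>i. indicator (B i) 0)
        + ennreal ainf * (\<Sum>i. indicator (B i) \<infinity>) + (\<Sum>i. emeasure (min1_measure \<mu>) (B i))"
      by (simp add: suminf_add[symmetric])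
    ultimately show "(\<Sum>i. ?m (B i)) = ?m (\<Union>i. B i)"
      by (simp add: suminf_indicator[OF B(2)])
  qed
qed (use assms in auto)

definition weak_star_conv :: "(nat \<Rightarrow> ennreal measure) \<Rightarrow> ennreal measure \<Rightarrow> bool" where
  "weak_star_conv N K \<longleftrightarrow>
     (\<forall>g :: ennreal \<Rightarrow> real. continuous_on UNIV g \<longrightarrow>
        (\<lambda>k. \<integral>y. g y \<partial>N k) \<longlonglongrightarrow> (\<integral>y. g y \<partial>K))"

definition levy_converges :: "(nat \<Rightarrow> real measure) \<Rightarrow> ennreal measure \<Rightarrow> bool" where
  "levy_converges \<mu>s \<kappa> \<longleftrightarrow>
     finite_measure \<kappa> \<and> sets \<kappa> = sets borel \<and> weak_star_conv (\<lambda>k. min1_measure (\<mu>s k)) \<kappa>"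

text \<open>The measure \<open>\<Sum>\<^sub>j\<^sub>\<in>\<^sub>J w\<^sub>j \<delta>\<^sub>x\<^sub>j\<close> on \<open>(0,\<infinity>)\<close>, as the image of a weighted counting measure.\<close>

definition point_masses :: "nat set \<Rightarrow> (nat \<Rightarrow> real) \<Rightarrow> (nat \<Rightarrow> real) \<Rightarrow> real measure" where
  "point_masses J w x = distr (density (count_space J) (\<lambda>j. ennreal (w j))) pos_borel x"


section \<open>Galton-Watson processes\<close>

text \<open>\<open>\<xi> n i\<close> is the number of children of the \<open>i\<close>-th individual of generation \<open>n\<close>.\<close>

definition iid_family_sizes :: "'w measure \<Rightarrow> nat pmf \<Rightarrow> (nat \<Rightarrow> nat \<Rightarrow> 'w \<Rightarrow> nat) \<Rightarrow> bool" where
  "iid_family_sizes M p \<xi> \<longleftrightarrow>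
     prob_space M \<and>
     prob_space.indep_vars M (\<lambda>_. count_space UNIV) (\<lambda>(n, i). \<xi> n i) UNIV \<and>
     (\<forall>n i. distr M (count_space UNIV) (\<xi> n i) = measure_pmf p)"

primrec galton_watson :: "(nat \<Rightarrow> nat \<Rightarrow> 'w \<Rightarrow> nat) \<Rightarrow> nat \<Rightarrow> 'w \<Rightarrow> nat" where
  "galton_watson \<xi> 0 \<omega> = 1"
| "galton_watson \<xi> (Suc n) \<omega> = (\<Sum>i<galton_watson \<xi> n \<omega>. \<xi> n i \<omega>)"

definition rescaled_family_measure :: "nat pmf \<Rightarrow> real \<Rightarrow> real \<Rightarrow> real measure" where
  "rescaled_family_measure p h \<tau> =
     point_masses {2..} (\<lambda>j. 1 / \<tau> * ((real j - 1) * pmf p j)) (\<lambda>j. real j * h)"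

definition rescaled_population_measure ::
  "'w measure \<Rightarrow> (nat \<Rightarrow> nat \<Rightarrow> 'w \<Rightarrow> nat) \<Rightarrow> real \<Rightarrow> nat \<Rightarrow> real measure" where
  "rescaled_population_measure M \<xi> h n =
     point_masses {1..} (\<lambda>j. 1 / h * \<P>(\<omega> in M. galton_watson \<xi> n \<omega> = j)) (\<lambda>j. real j * h)"


section \<open>Branching mechanism and its flow\<close>

definition branching_mechanism :: "real \<Rightarrow> real \<Rightarrow> real measure \<Rightarrow> real \<Rightarrow> real" where
  "branching_mechanism a0 ainf \<mu> q =
     1 / 2 * a0 * q\<^sup>2 + ainf * q + (\<integral>x. (exp (- q * x) - 1 + q * x) / x \<partial>\<mu>)"

text \<open>Nonnegativity says that \<open>\<phi>\<close> takes its values in the domain \<open>[0,\<infinity>)\<close> of \<open>\<Psi>\<close>.\<close>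

definition branching_flow :: "(real \<Rightarrow> real) \<Rightarrow> (real \<Rightarrow> real \<Rightarrow> real) \<Rightarrow> bool" where
  "branching_flow \<Psi> \<phi> \<longleftrightarrow>
     (\<forall>q>0. \<phi> q 0 = q \<and>
        (\<forall>t\<ge>0. 0 \<le> \<phi> q t \<and>
           ((\<lambda>s. \<phi> q s) has_real_derivative - \<Psi> (\<phi> q t)) (at t within {0..})))"

definition bernstein_representation :: "(real \<Rightarrow> real) \<Rightarrow> real \<Rightarrow> real measure \<Rightarrow> bool" where
  "bernstein_representation F b \<nu> \<longleftrightarrow> 0 \<le> b \<and> levy_measure \<nu> \<and>
     (\<forall>q>0. F q = b * q + (\<integral>x. (1 - exp (- q * x)) \<partial>\<nu>))"

text \<open>The integrand is taken in \<^typ>\<open>ennreal\<close>, where \<open>1 / 0 = \<infinity>\<close>; hence the condition fails for \<open>\<Psi> = 0\<close>.\<close>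

definition grey_condition :: "(real \<Rightarrow> real) \<Rightarrow> bool" where
  "grey_condition \<Psi> \<longleftrightarrow> (\<integral>\<^sup>+u\<in>{1..}. (1 / ennreal (\<Psi> u)) \<partial>lborel) < \<infinity>"


section \<open>The generalized damped Smoluchowski equation\<close>

definition pairing :: "(ennreal \<Rightarrow> real) \<Rightarrow> real measure \<Rightarrow> real" where
  "pairing f \<nu> = (\<integral>x. f (ennreal x) \<partial>\<nu>)"

definition coag_rate :: "(real \<Rightarrow> real) \<Rightarrow> nat \<Rightarrow> real \<Rightarrow> real" where
  "coag_rate \<Psi> k \<rho> = (- \<rho>) ^ k * (deriv ^^ k) \<Psi> \<rho> / fact k"

definition coag_integral :: "nat \<Rightarrow> real measure \<Rightarrow> (ennreal \<Rightarrow> real) \<Rightarrow> real" where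
  "coag_integral k \<nu> f =
     (\<integral>x. (f (ennreal (\<Sum>i\<in>{1..k}. x i)) - (\<Sum>i\<in>{1..k}. f (ennreal (x i))))
        \<partial>(\<Pi>\<^sub>M i\<in>{1..k}. scale_measure (ennreal (1 / pairing (\<lambda>_. 1) \<nu>)) \<nu>))"

text \<open>The sum over \<open>k \<ge> 2\<close> is written as a series over \<open>j = k - 2\<close>; \<open>D\<close> is \<open>\<Psi>'(0\<^sup>+)\<close>.\<close>

definition smoluchowski_weak_solution :: "(real \<Rightarrow> real) \<Rightarrow> (real \<Rightarrow> real measure) \<Rightarrow> bool" where
  "smoluchowski_weak_solution \<Psi> \<nu> \<longleftrightarrow>
     (\<exists>D. (deriv \<Psi> \<longlongrightarrow> D) (at_right 0) \<and>
       (\<forall>f :: ennreal \<Rightarrow> real. \<forall>t>0. continuous_on UNIV f \<longrightarrow>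
          (let \<rho> = pairing (\<lambda>_. 1) (\<nu> t);
               r = (\<lambda>j. coag_rate \<Psi> (j + 2) \<rho> * coag_integral (j + 2) (\<nu> t) f)
           in summable r \<and>
              ((\<lambda>s. pairing f (\<nu> s)) has_real_derivative (- D * pairing f (\<nu> t) + (\<Sum>j. r j))) (at t))))"

end

theory Submission
  imports Defs
begin

text \<open>
  Everything is read off from Laplace exponents.  If \<open>G\<close> is the generating function of the family-size
  distribution, the exponent of the rescaled population is
  \<open>\<phi>\<^sub>n(q) = \<integral>(1 - e\<^sup>-\<^sup>q\<^sup>x) d\<nu>\<^sub>n\<^sup>h(x) = (1 - G\<^sup>n(e\<^sup>-\<^sup>q\<^sup>h)) / h\<close>, because the generating function of the \<open>n\<close>-th generation is
  the \<open>n\<close>-th iterate of \<open>G\<close>.  Hence \<open>\<phi>\<^sub>n\<^sub>+\<^sub>1 = \<phi>\<^sub>n - \<tau> \<Psi>\<^sub>k(\<phi>\<^sub>n)\<close> with \<open>\<Psi>\<^sub>k(s) = (G(1 - h s) - 1 + h s) / (h \<tau>)\<close>: the process is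
  an Euler scheme with step \<open>\<tau>\<close> for the equation \<open>\<partial>\<^sub>t\<phi> = - \<Psi>\<^sub>k(\<phi>)\<close>.  Since the mean family size is one,
  \<open>\<Psi>\<^sub>k(s)\<close> is an integral against the rescaled family measure whose kernel is, uniformly in the point \<open>j h\<close>, close to
  the function that integrates to \<open>\<Psi>(s)\<close> (\<open>discrete_kernel_close_to_branching_test\<close>).

  Weak-star convergence on \<open>[0,\<infinity>]\<close> is tested on two explicit families, for the populations on
  \<open>(1 - e\<^sup>-\<^sup>q\<^sup>x) / (x \<and> 1)\<close> and for the family measures on \<open>(e\<^sup>-\<^sup>s\<^sup>x - 1 + s x) / (x (x \<and> 1))\<close>.  First differences of the former
  and second differences of the latter, over integer parameters, are a fixed weight times powers of \<open>e\<^sup>-\<^sup>x\<close>, so that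
  Weierstrass' theorem on \<open>[0,1]\<close> shows that they determine limits (\<open>weak_star_conv_by_bernstein_tests\<close>,
  \<open>weak_star_conv_by_branching_tests\<close>).

  If the family measures converge, then \<open>\<Psi>\<^sub>k \<rightarrow> \<Psi>\<close> pointwise, hence uniformly on compact intervals because the
  functions are monotone, and a discrete Gronwall estimate gives \<open>\<phi>\<^sub>n(q) \<rightarrow> \<phi>(q,t)\<close> (\<open>dflow_tendsto\<close>).  Conversely, if the
  populations converge, then \<open>\<Psi>\<^sub>k(s)\<close> must stay bounded, for otherwise the flow would jump at time \<open>0\<close>
  (\<open>mechanism_bounded\<close>).  Then the family measures have bounded mass, the \<open>\<Psi>\<^sub>k\<close> are uniformly Lipschitz, and the difference
  quotients \<open>(q - \<phi>(q,t)) / t\<close> identify the limit of \<open>\<Psi>\<^sub>k(q)\<close> up to an error \<open>O(t)\<close>.  So \<open>\<Psi>\<^sub>k(q)\<close> converges, and Helly's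
  theorem supplies the limiting measure.

  The drift \<open>\<beta>\<^sub>0(t)\<close> is the asymptotic slope of \<open>\<phi>(\<cdot>,t)\<close>.  Since \<open>\<Psi>\<close> is convex with \<open>\<Psi>(0) = 0\<close>, the ratio \<open>\<Psi>(y) / y\<close>
  increases to \<open>\<Psi>'(\<infinity>)\<close>, and comparison with linear equations yields \<open>\<beta>\<^sub>0(t) = exp (- \<Psi>'(\<infinity>) t)\<close>, read as \<open>0\<close> if
  \<open>\<Psi>'(\<infinity>) = \<infinity>\<close>.  Separation of variables, \<open>t = \<integral> du / \<Psi>(u)\<close> over \<open>[\<phi>(q,t), q]\<close>, shows that \<open>\<phi>(\<cdot>,t)\<close> is bounded exactly under
  Grey's condition (\<open>flow_bounded_iff_grey\<close>).

  In that case \<open>\<langle>e\<^sup>-\<^sup>q\<^sup>x,\<nu>\<^sub>t\<rangle> = \<rho>\<^sub>t - \<phi>(q,t)\<close>, with derivative \<open>\<Psi>(\<phi>(q,t)) - \<Psi>(\<rho>\<^sub>t)\<close>.  On the other side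
  \<open>I\<^sub>k(\<nu>\<^sub>t,e\<^sup>-\<^sup>q\<^sup>x) = \<theta>\<^sup>k - k \<theta>\<close> with \<open>\<theta> = 1 - \<phi>(q,t) / \<rho>\<^sub>t\<close>, so that the coagulation sum is the Taylor expansion of
  \<open>\<Psi>(\<rho>\<^sub>t - \<theta> \<rho>\<^sub>t)\<close> about \<open>\<rho>\<^sub>t\<close>, which converges absolutely, and the two sides agree.  Both sides are continuous in the
  test function, locally uniformly in \<open>t\<close>, and polynomials in \<open>e\<^sup>-\<^sup>x\<close> are dense (\<open>pairing_deriv\<close>).
\<close>

section \<open>The compactified half-line\<close>

text \<open>Test functions on \<open>[0,\<infinity>]\<close> are given by a formula on \<open>(0,\<infinity>)\<close> together with its limits at the two ends,
  since the formulas are of the form \<open>0 / 0\<close> or \<open>\<infinity> / \<infinity>\<close> there.\<close>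

definition extend_continuously :: "(real \<Rightarrow> real) \<Rightarrow> real \<Rightarrow> real \<Rightarrow> ennreal \<Rightarrow> real" where
  "extend_continuously F a b x =
     (if x = 0 then a else if x = \<infinity> then b else F (enn2real x))"

lemma extend_continuously_simps [simp]:
  "extend_continuously F a b 0 = a"
  "extend_continuously F a b \<infinity> = b"
  "extend_continuously F a b \<top> = b"
  "0 < x \<Longrightarrow> extend_continuously F a b (ennreal x) = F x"
  by (auto simp: extend_continuously_def infinity_ennreal_def)

lemma filterlim_enn2real_at_infinity: "filterlim enn2real at_top (at (\<infinity>::ennreal))"
  unfolding filterlim_at_top
proof
  fix Z :: real
  have "\<forall>\<^sub>F x in at (\<infinity>::ennreal). ennreal Z < x \<and> x \<noteq> \<infinity>"
  proof (rule eventually_conj)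
    have "\<forall>\<^sub>F x in nhds (\<infinity>::ennreal). ennreal Z < x"
      by (rule order_tendstoD(1)[OF filterlim_ident]) (simp add: infinity_ennreal_def less_top)
    then show "\<forall>\<^sub>F x in at (\<infinity>::ennreal). ennreal Z < x"
      by (simp add: eventually_at_filter eventually_mono)
    show "\<forall>\<^sub>F x in at (\<infinity>::ennreal). x \<noteq> \<infinity>"
      by (simp add: eventually_at_filter)
  qed
  then show "\<forall>\<^sub>F x in at (\<infinity>::ennreal). Z \<le> enn2real x"
  proof eventually_elim
    case (elim x)
    then obtain r where "x = ennreal r" "0 \<le> r" by (cases x) auto
    with elim show ?case by (auto simp: ennreal_less_iff)
       (metis ennreal_less_iff ennreal_neg less_eq_real_def linorder_not_le not_less_zero)
  qed
qed

lemma filterlim_enn2real_at_0: "filterlim enn2real (at_right 0) (at (0::ennreal))"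
  unfolding filterlim_at
proof
  have "\<forall>\<^sub>F x in nhds (0::ennreal). x < \<infinity>"
    by (rule order_tendstoD(2)[OF filterlim_ident]) simp
  then show "\<forall>\<^sub>F x in at (0::ennreal). enn2real x \<in> {0<..} \<and> enn2real x \<noteq> 0"
    unfolding eventually_at_filter
    by eventually_elim (auto simp: enn2real_positive_iff zero_less_iff_neq_zero enn2real_eq_0_iff infinity_ennreal_def less_top)
  have "(enn2real \<longlongrightarrow> enn2real 0) (at (0::ennreal))"
    by (rule tendsto_enn2real) (auto simp: tendsto_ident_at)
  then show "(enn2real \<longlongrightarrow> 0) (at (0::ennreal))" by simp
qed

lemma continuous_extend_continuously:
  assumes F: "continuous_on {0<..} F" and a: "(F \<longlongrightarrow> a) (at_right 0)" and b: "(F \<longlongrightarrow> b) at_top"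
  shows "continuous_on UNIV (extend_continuously F a b)"
  unfolding continuous_on_def
proof safe
  fix x :: ennreal
  let ?G = "extend_continuously F a b"
  consider "x = 0" | "x = \<infinity>" | r where "x = ennreal r" "0 < r"
    by (cases x) (auto simp: infinity_ennreal_def less_eq_real_def)
  then show "(?G \<longlongrightarrow> ?G x) (at x)"
  proof cases
    case 1
    have "((\<lambda>x. F (enn2real x)) \<longlongrightarrow> a) (at (0::ennreal))"
      by (rule filterlim_compose[OF a filterlim_enn2real_at_0])
    moreover have "\<forall>\<^sub>F x in at (0::ennreal). F (enn2real x) = ?G x"
    proof -
      have "\<forall>\<^sub>F x in nhds (0::ennreal). x < \<infinity>"
        by (rule order_tendstoD(2)[OF filterlim_ident]) simp
      then show ?thesis unfolding eventually_at_filter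
        by eventually_elim (auto simp: extend_continuously_def)
    qed
    ultimately show ?thesis unfolding 1 by (simp add: tendsto_cong)
  next
    case 2
    have "((\<lambda>x. F (enn2real x)) \<longlongrightarrow> b) (at (\<infinity>::ennreal))"
      by (rule filterlim_compose[OF b filterlim_enn2real_at_infinity])
    moreover have "\<forall>\<^sub>F x in at (\<infinity>::ennreal). F (enn2real x) = ?G x"
    proof -
      have "\<forall>\<^sub>F x in nhds (\<infinity>::ennreal). 0 < x"
        by (rule order_tendstoD(1)[OF filterlim_ident]) simp
      then show ?thesis unfolding eventually_at_filter
        by eventually_elim (auto simp: extend_continuously_def)
    qed
    ultimately show ?thesis unfolding 2 by (simp add: tendsto_cong)
  next
    case (3 r)
    have "(enn2real \<longlongrightarrow> enn2real x) (at x)"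
      unfolding 3(1) using 3 by (intro tendsto_enn2real) (auto simp: tendsto_ident_at)
    then have lim: "(enn2real \<longlongrightarrow> r) (at x)" using 3 by simp
    have "isCont F r" using F 3(2) by (simp add: continuous_on_eq_continuous_at)
    from isCont_tendsto_compose[OF this lim]
    have "((\<lambda>x. F (enn2real x)) \<longlongrightarrow> F r) (at x)" .
    moreover have "\<forall>\<^sub>F y in at x. F (enn2real y) = ?G y"
    proof -
      have "\<forall>\<^sub>F y in nhds x. 0 < y \<and> y < \<infinity>"
        by (intro eventually_conj order_tendstoD(1)[OF filterlim_ident]
            order_tendstoD(2)[OF filterlim_ident]) (use 3 in auto)
      then show ?thesis unfolding eventually_at_filter
        by eventually_elim (auto simp: extend_continuously_def)
    qed
    ultimately have "(?G \<longlongrightarrow> F r) (at x)" by (simp add: tendsto_cong)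
    then show ?thesis using 3 by simp
  qed
qed

lemma compact_ennreal: "compact (UNIV :: ennreal set)"
  by (rule compact_UNIV)

lemma continuous_ennreal_bounded:
  fixes g :: "ennreal \<Rightarrow> real"
  assumes "continuous_on UNIV g"
  obtains B where "0 < B" "\<And>x. \<bar>g x\<bar> \<le> B"
proof -
  have "compact (range g)" using compact_ennreal assms by (rule compact_continuous_image[rotated])
  then have "bounded (range g)" by (rule compact_imp_bounded)
  then obtain B where "0 < B" "\<forall>x\<in>range g. norm x \<le> B" using bounded_pos by blast
  then show thesis using that by auto
qed

lemma borel_measurable_continuous_ennreal [measurable_dest]:
  fixes g :: "ennreal \<Rightarrow> real"
  assumes "continuous_on UNIV g"
  shows "g \<in> borel_measurable borel"
  using assms by (rule borel_measurable_continuous_onI)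

text \<open>The homeomorphism \<open>x \<mapsto> e\<^sup>-\<^sup>x\<close> of \<open>[0,\<infinity>]\<close> with \<open>[0,1]\<close>, and its inverse,
  which is extended continuously to the whole line.\<close>

definition exp_neg :: "ennreal \<Rightarrow> real" where
  "exp_neg = extend_continuously (\<lambda>x. exp (- x)) 1 0"

definition neg_ln :: "real \<Rightarrow> ennreal" where
  "neg_ln y = (if y \<le> 0 then \<infinity> else ennreal (- ln y))"

lemma continuous_exp_neg: "continuous_on UNIV exp_neg"
  unfolding exp_neg_def
proof (rule continuous_extend_continuously)
  show "continuous_on {0<..} (\<lambda>x::real. exp (- x))" by (intro continuous_intros)
  have "((\<lambda>x::real. exp (- x)) \<longlongrightarrow> exp (- 0)) (at_right 0)" by (intro tendsto_intros)
  then show "((\<lambda>x::real. exp (- x)) \<longlongrightarrow> 1) (at_right 0)" by simp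
  show "((\<lambda>x::real. exp (- x)) \<longlongrightarrow> 0) at_top"
    by (intro filterlim_compose[OF exp_at_bot] filterlim_uminus_at_bot_at_top)
qed

lemma exp_neg_simps [simp]:
  "exp_neg 0 = 1" "exp_neg \<infinity> = 0" "exp_neg \<top> = 0" "0 \<le> x \<Longrightarrow> exp_neg (ennreal x) = exp (- x)"
  by (auto simp: exp_neg_def less_eq_real_def)

lemma exp_neg_bounds: "0 \<le> exp_neg x" "exp_neg x \<le> 1"
  by (cases x; simp)+

lemma neg_ln_exp_neg [simp]: "neg_ln (exp_neg x) = x"
  by (cases x) (auto simp: neg_ln_def infinity_ennreal_def)

lemma isCont_neg_ln: "isCont neg_ln y"
proof -
  consider "y < 0" | "y > 0" | "y = 0" by linarith
  then show ?thesis
  proof cases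
    case 1
    have "\<forall>\<^sub>F z in nhds y. \<infinity> = neg_ln z"
      using eventually_nhds_in_open[of "{..<0}" y] 1
      by (auto elim!: eventually_mono simp: neg_ln_def)
    then show ?thesis using isCont_cong[of "\<lambda>_. \<infinity>" neg_ln y] by simp
  next
    case 2
    have "\<forall>\<^sub>F z in nhds y. ennreal (- ln z) = neg_ln z"
      using eventually_nhds_in_open[of "{0<..}" y] 2
      by (auto elim!: eventually_mono simp: neg_ln_def)
    moreover have "isCont (\<lambda>z. ennreal (- ln z)) y"
      unfolding isCont_def using 2 by (intro tendsto_ennrealI tendsto_intros) auto
    ultimately show ?thesis using isCont_cong[of "\<lambda>z. ennreal (- ln z)" neg_ln y] by simp
  next
    case 3
    have "(neg_ln \<longlongrightarrow> \<top>) (at 0)"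
    proof (rule order_tendstoI)
      fix a :: ennreal assume "a < \<top>"
      then obtain r where r: "a = ennreal r" "0 \<le> r" by (cases a) auto
      have "a < neg_ln z" if "z < exp (- r)" for z
      proof (cases "z \<le> 0")
        case True then show ?thesis using \<open>a < \<top>\<close> by (simp add: neg_ln_def infinity_ennreal_def)
      next
        case False
        then have "ln z < - r" using that by (metis ln_exp ln_less_cancel_iff exp_gt_zero linorder_not_le)
        then show ?thesis using False r by (simp add: neg_ln_def ennreal_less_iff)
      qed
      moreover have "\<forall>\<^sub>F z in at 0. z < exp (- r)"
        by (rule order_tendstoD(2)[OF tendsto_ident_at]) simp
      ultimately show "\<forall>\<^sub>F z in at 0. a < neg_ln z" by (auto elim: eventually_mono)
    qed (auto simp: top.not_eq_extremum[symmetric])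
    then show ?thesis unfolding 3 isCont_def by (simp add: neg_ln_def infinity_ennreal_def)
  qed
qed

text \<open>Weierstrass' theorem, read through the homeomorphism with \<open>[0,1]\<close>.\<close>

lemma polynomial_approximation_exp_neg:
  fixes g :: "ennreal \<Rightarrow> real"
  assumes g: "continuous_on UNIV g" and "0 < e"
  obtains a :: "nat \<Rightarrow> real" and n where "\<And>x. \<bar>g x - (\<Sum>i\<le>n. a i * exp_neg x ^ i)\<bar> < e"
proof -
  have "continuous_on {0..1} (\<lambda>y. g (neg_ln y))"
  proof (rule continuous_on_compose2[OF g])
    show "continuous_on {0..1} neg_ln"
      using isCont_neg_ln by (simp add: continuous_at_imp_continuous_on)
  qed auto
  then obtain p where p: "real_polynomial_function p" "\<And>y. y \<in> {0..1} \<Longrightarrow> \<bar>g (neg_ln y) - p y\<bar> < e"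
    using Stone_Weierstrass_real_polynomial_function[of "{0..1::real}" "\<lambda>y. g (neg_ln y)" e] \<open>0 < e\<close>
    by blast
  from p(1) obtain a n where "p = (\<lambda>x. \<Sum>i\<le>n. a i * x^i)"
    by (auto simp: real_polynomial_function_iff_sum)
  with p(2)[of "exp_neg _"] exp_neg_bounds show thesis
    by (intro that[of a n]) auto
qed

lemma continuous_ennreal_pos_bound:
  fixes g :: "ennreal \<Rightarrow> real"
  assumes g: "continuous_on UNIV g" and "\<And>x. 0 < g x"
  obtains c where "0 < c" "\<And>x. c \<le> g x"
proof -
  obtain x where "\<forall>y\<in>UNIV. g x \<le> g y"
    using continuous_attains_inf[OF compact_ennreal _ g] by blast
  then show thesis using that[of "g x"] assms(2) by blast
qed

section \<open>Integration against Levy measures\<close>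

lemma space_pos_borel: "space pos_borel = {0<..}"
  by (simp add: pos_borel_def space_restrict_space)

lemma space_eq_of_sets_pos_borel: "sets \<nu> = sets pos_borel \<Longrightarrow> space \<nu> = {0<..}"
  using sets_eq_imp_space_eq space_pos_borel by blast

lemma measurable_pos_borel:
  assumes "sets \<nu> = sets pos_borel" "f \<in> borel \<rightarrow>\<^sub>M N"
  shows "f \<in> \<nu> \<rightarrow>\<^sub>M N"
proof -
  have "f \<in> pos_borel \<rightarrow>\<^sub>M N"
    unfolding pos_borel_def using assms(2) by (rule measurable_restrict_space1)
  then show ?thesis by (simp add: measurable_cong_sets[OF assms(1) refl])
qed

lemma sets_min1_measure [simp]: "sets (min1_measure \<nu>) = sets borel"
  by (simp add: min1_measure_def)

lemma space_min1_measure [simp]: "space (min1_measure \<nu>) = UNIV"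
  by (simp add: min1_measure_def)

lemma nn_integral_min1_measure:
  assumes \<nu>: "sets \<nu> = sets pos_borel" and f: "f \<in> borel_measurable borel"
  shows "(\<integral>\<^sup>+y. f y \<partial>min1_measure \<nu>) = (\<integral>\<^sup>+x. ennreal (min x 1) * f (ennreal x) \<partial>\<nu>)"
proof -
  have m: "(\<lambda>x. ennreal (min x 1)) \<in> borel_measurable \<nu>" "ennreal \<in> borel_measurable \<nu>"
    by (intro measurable_pos_borel[OF \<nu>]; measurable)+
  then have "ennreal \<in> borel_measurable (density \<nu> (\<lambda>x. ennreal (min x 1)))" by simp
  then have "(\<integral>\<^sup>+y. f y \<partial>min1_measure \<nu>) = (\<integral>\<^sup>+x. f (ennreal x) \<partial>density \<nu> (\<lambda>x. ennreal (min x 1)))"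
    unfolding min1_measure_def using f by (subst nn_integral_distr) simp_all
  also have "\<dots> = (\<integral>\<^sup>+x. ennreal (min x 1) * f (ennreal x) \<partial>\<nu>)"
    using m f by (intro nn_integral_density measurable_compose[OF m(2) f])
  finally show ?thesis .
qed

lemma integral_min1_measure:
  fixes g :: "ennreal \<Rightarrow> real"
  assumes \<nu>: "sets \<nu> = sets pos_borel" and g: "g \<in> borel_measurable borel"
  shows "(\<integral>y. g y \<partial>min1_measure \<nu>) = (\<integral>x. min x 1 * g (ennreal x) \<partial>\<nu>)"
proof -
  have m: "(\<lambda>x::real. min x 1) \<in> borel_measurable \<nu>" "ennreal \<in> borel_measurable \<nu>"
    by (intro measurable_pos_borel[OF \<nu>]; measurable)+
  then have "ennreal \<in> borel_measurable (density \<nu> (\<lambda>x. ennreal (min x 1)))" by simp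
  then have "(\<integral>y. g y \<partial>min1_measure \<nu>) = (\<integral>x. g (ennreal x) \<partial>density \<nu> (\<lambda>x. ennreal (min x 1)))"
    unfolding min1_measure_def using g by (subst integral_distr) simp_all
  also have "\<dots> = (\<integral>x. min x 1 * g (ennreal x) \<partial>\<nu>)"
    using m measurable_compose[OF m(2) g]
    by (subst integral_density) (auto simp: space_eq_of_sets_pos_borel[OF \<nu>])
  finally show ?thesis .
qed

lemma finite_min1_measure: "levy_measure \<nu> \<Longrightarrow> finite_measure (min1_measure \<nu>)"
proof (rule finite_measureI)
  assume "levy_measure \<nu>"
  then show "emeasure (min1_measure \<nu>) (space (min1_measure \<nu>)) \<noteq> \<infinity>"
    using nn_integral_min1_measure[of \<nu> "\<lambda>_. 1"] by (auto simp: levy_measure_def)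
qed

lemma levy_measure_sets: "levy_measure \<nu> \<Longrightarrow> sets \<nu> = sets pos_borel"
  by (simp add: levy_measure_def)

lemma levy_measure_space: "levy_measure \<nu> \<Longrightarrow> space \<nu> = {0<..}"
  by (simp add: levy_measure_def space_eq_of_sets_pos_borel)

text \<open>Every integrand below is controlled by a multiple of \<open>x \<and> 1\<close>, which is what a Levy measure integrates.\<close>

lemma levy_integrable:
  fixes f :: "real \<Rightarrow> real"
  assumes \<nu>: "levy_measure \<nu>" and f: "f \<in> borel_measurable borel"
    and le: "\<And>x. 0 < x \<Longrightarrow> \<bar>f x\<bar> \<le> C * min x 1"
  shows "integrable \<nu> f"
proof (rule integrableI_bounded)
  note s = levy_measure_sets[OF \<nu>]
  show "f \<in> borel_measurable \<nu>" using measurable_pos_borel[OF s f] .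
  have "(\<integral>\<^sup>+x. norm (f x) \<partial>\<nu>) \<le> (\<integral>\<^sup>+x. ennreal \<bar>C\<bar> * ennreal (min x 1) \<partial>\<nu>)"
  proof (rule nn_integral_mono)
    fix x assume "x \<in> space \<nu>"
    then have x: "0 < x" using levy_measure_space[OF \<nu>] by simp
    then have "\<bar>f x\<bar> \<le> \<bar>C\<bar> * min x 1"
    proof -
      have "C * min x 1 \<le> \<bar>C\<bar> * min x 1" using x by (intro mult_right_mono) auto
      then show ?thesis using le[OF x] by linarith
    qed
    then show "ennreal (norm (f x)) \<le> ennreal \<bar>C\<bar> * ennreal (min x 1)"
      using x by (subst ennreal_mult[symmetric]) (auto intro: ennreal_leI)
  qed
  also have "\<dots> = ennreal \<bar>C\<bar> * (\<integral>\<^sup>+x. ennreal (min x 1) \<partial>\<nu>)"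
    by (intro nn_integral_cmult measurable_pos_borel[OF s]) measurable
  also have "\<dots> < \<infinity>" using \<nu> by (simp add: levy_measure_def ennreal_mult_less_top)
  finally show "(\<integral>\<^sup>+x. norm (f x) \<partial>\<nu>) < \<infinity>" .
qed

lemma integrable_continuous_finite_measure:
  fixes g :: "ennreal \<Rightarrow> real"
  assumes "finite_measure N" "sets N = sets borel" "continuous_on UNIV g"
  shows "integrable N g"
proof -
  obtain B where "\<And>x. \<bar>g x\<bar> \<le> B" using continuous_ennreal_bounded[OF assms(3)] by blast
  moreover have "g \<in> borel_measurable N"
    using borel_measurable_continuous_ennreal[OF assms(3)] assms(2)
    by (simp cong: measurable_cong_sets)
  ultimately show ?thesis
    by (intro finite_measure.integrable_const_bound[OF assms(1), of _ B]) auto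
qed

lemma nn_integral_kappa_measure:
  assumes "f \<in> borel_measurable borel"
  shows "(\<integral>\<^sup>+y. f y \<partial>kappa_measure a0 ainf \<mu>)
    = ennreal a0 * f 0 + ennreal ainf * f \<infinity> + (\<integral>\<^sup>+y. f y \<partial>min1_measure \<mu>)"
  using assms
proof (induct rule: borel_measurable_induct)
  case (cong f g)
  then have "f = g" by auto
  with cong show ?case by simp
next
  case (set A)
  then show ?case by (simp add: emeasure_kappa_measure)
next
  case (mult u v)
  have 1: "(\<integral>\<^sup>+y. v * u y \<partial>kappa_measure a0 ainf \<mu>) = v * (\<integral>\<^sup>+y. u y \<partial>kappa_measure a0 ainf \<mu>)"
    using mult by (intro nn_integral_cmult) (simp cong: measurable_cong_sets)
  have 2: "(\<integral>\<^sup>+y. v * u y \<partial>min1_measure \<mu>) = v * (\<integral>\<^sup>+y. u y \<partial>min1_measure \<mu>)"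
    using mult by (intro nn_integral_cmult) (simp cong: measurable_cong_sets)
  show ?case unfolding 1 2 mult by (simp add: distrib_left mult_ac)
next
  case (add u v)
  have 1: "(\<integral>\<^sup>+y. v y + u y \<partial>kappa_measure a0 ainf \<mu>)
     = (\<integral>\<^sup>+y. v y \<partial>kappa_measure a0 ainf \<mu>) + (\<integral>\<^sup>+y. u y \<partial>kappa_measure a0 ainf \<mu>)"
    using add by (intro nn_integral_add) (simp_all cong: measurable_cong_sets)
  have 2: "(\<integral>\<^sup>+y. v y + u y \<partial>min1_measure \<mu>)
     = (\<integral>\<^sup>+y. v y \<partial>min1_measure \<mu>) + (\<integral>\<^sup>+y. u y \<partial>min1_measure \<mu>)"
    using add by (intro nn_integral_add) (simp_all cong: measurable_cong_sets)
  show ?case unfolding 1 2 add by (simp add: distrib_left add_ac)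
next
  case (seq U)
  have U: "U i \<in> borel_measurable borel" for i using seq by simp
  have 1: "(\<integral>\<^sup>+y. (SUP i. U i y) \<partial>kappa_measure a0 ainf \<mu>)
     = (SUP i. \<integral>\<^sup>+y. U i y \<partial>kappa_measure a0 ainf \<mu>)"
    using U seq by (intro nn_integral_monotone_convergence_SUP) (simp_all cong: measurable_cong_sets)
  have 2: "(\<integral>\<^sup>+y. (SUP i. U i y) \<partial>min1_measure \<mu>) = (SUP i. \<integral>\<^sup>+y. U i y \<partial>min1_measure \<mu>)"
    using U seq by (intro nn_integral_monotone_convergence_SUP) (simp_all cong: measurable_cong_sets)
  have inc: "incseq (\<lambda>i. a * U i y)" for a y
    using seq by (auto simp: incseq_def le_fun_def intro!: mult_left_mono)
  have "incseq (\<lambda>i. \<integral>\<^sup>+y. U i y \<partial>min1_measure \<mu>)"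
    using seq by (auto simp: incseq_def le_fun_def intro!: nn_integral_mono)
  then have 3: "(SUP i. ennreal a0 * U i 0 + ennreal ainf * U i \<infinity> + (\<integral>\<^sup>+y. U i y \<partial>min1_measure \<mu>))
    = (SUP i. ennreal a0 * U i 0) + (SUP i. ennreal ainf * U i \<infinity>) + (SUP i. \<integral>\<^sup>+y. U i y \<partial>min1_measure \<mu>)"
  proof -
    assume M: "incseq (\<lambda>i. \<integral>\<^sup>+y. U i y \<partial>min1_measure \<mu>)"
    have s: "(SUP i. ennreal a0 * U i 0 + ennreal ainf * U i \<infinity>) = (SUP i. ennreal a0 * U i 0) + (SUP i. ennreal ainf * U i \<infinity>)"
      by (rule ennreal_SUP_add[OF inc inc])
    have "incseq (\<lambda>i. ennreal a0 * U i 0 + ennreal ainf * U i \<infinity>)"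
      using inc unfolding incseq_def by (meson add_mono)
    from ennreal_SUP_add[OF this M] show ?thesis unfolding s .
  qed
  have u: "(SUP i. U i) = (\<lambda>y. SUP i. U i y)" by (auto simp: fun_eq_iff image_comp)
  have 4: "(\<integral>\<^sup>+y. U i y \<partial>kappa_measure a0 ainf \<mu>)
    = ennreal a0 * U i 0 + ennreal ainf * U i \<infinity> + (\<integral>\<^sup>+y. U i y \<partial>min1_measure \<mu>)" for i
    using seq by blast
  show ?case unfolding u 1 2 4 3 SUP_mult_left_ennreal ..
qed

lemma finite_kappa_measure:
  assumes "levy_measure \<mu>"
  shows "finite_measure (kappa_measure a0 ainf \<mu>)"
proof
  interpret m: finite_measure "min1_measure \<mu>" by (rule finite_min1_measure[OF assms])
  have [simp]: "space (kappa_measure a0 ainf \<mu>) = UNIV"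
    using sets_eq_imp_space_eq[OF sets_kappa_measure[of a0 ainf \<mu>]] by simp
  show "emeasure (kappa_measure a0 ainf \<mu>) (space (kappa_measure a0 ainf \<mu>)) \<noteq> \<infinity>"
    using m.emeasure_finite[of UNIV] by (simp add: emeasure_kappa_measure)
qed

lemma integral_kappa_measure:
  assumes \<mu>: "levy_measure \<mu>" and a: "0 \<le> a0" "0 \<le> ainf" and g: "continuous_on UNIV g"
  shows "(\<integral>y. g y \<partial>kappa_measure a0 ainf \<mu>)
    = a0 * g 0 + ainf * g \<infinity> + (\<integral>x. min x 1 * g (ennreal x) \<partial>\<mu>)"
proof -
  note [measurable] = borel_measurable_continuous_ennreal[OF g]
  have ik: "integrable (kappa_measure a0 ainf \<mu>) g"
    using integrable_continuous_finite_measure[OF finite_kappa_measure[OF \<mu>] _ g] by simp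
  have im: "integrable (min1_measure \<mu>) g"
    using integrable_continuous_finite_measure[OF finite_min1_measure[OF \<mu>] _ g] by simp
  have fin: "(\<integral>\<^sup>+y. ennreal (g y) \<partial>min1_measure \<mu>) < \<infinity>" "(\<integral>\<^sup>+y. ennreal (- g y) \<partial>min1_measure \<mu>) < \<infinity>"
    using im by (auto simp: real_integrable_def less_top)
  have e: "enn2real (ennreal a0 * ennreal u + ennreal ainf * ennreal v + w) = a0 * max 0 u + ainf * max 0 v + enn2real w"
    if "w < \<infinity>" for u v w
  proof -
    obtain r where r: "w = ennreal r" "0 \<le> r" using \<open>w < \<infinity>\<close> by (cases w) auto
    have p: "ennreal b * ennreal z = ennreal (b * max 0 z)" if "0 \<le> b" for b z
      using that by (cases "0 \<le> z") (simp_all add: ennreal_mult' ennreal_neg max_def)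
    have "ennreal a0 * ennreal u + ennreal ainf * ennreal v + w
        = ennreal (a0 * max 0 u + ainf * max 0 v + r)"
      unfolding p[OF a(1)] p[OF a(2)] r(1) using r(2) a by simp
    moreover have "0 \<le> a0 * max 0 u + ainf * max 0 v + r" using r(2) a by simp
    ultimately show ?thesis using r by simp
  qed
  have m: "c * z = c * max 0 z - c * max 0 (- z)" for c z :: real
    by (simp add: max_def)
  have "(\<integral>y. g y \<partial>kappa_measure a0 ainf \<mu>) = a0 * g 0 + ainf * g \<infinity> + (\<integral>y. g y \<partial>min1_measure \<mu>)"
  proof -
    have n: "(\<integral>\<^sup>+y. ennreal (f y) \<partial>kappa_measure a0 ainf \<mu>) = ennreal a0 * ennreal (f 0) + ennreal ainf * ennreal (f \<infinity>)
        + (\<integral>\<^sup>+y. ennreal (f y) \<partial>min1_measure \<mu>)" if [measurable]: "f \<in> borel_measurable borel" for f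
      by (rule nn_integral_kappa_measure) measurable
    have g': "g \<in> borel_measurable borel" "(\<lambda>y. - g y) \<in> borel_measurable borel" by measurable
    show ?thesis
      unfolding real_lebesgue_integral_def[OF ik] real_lebesgue_integral_def[OF im]
        n[OF g'(1)] n[OF g'(2)] e[OF fin(1)] e[OF fin(2)]
      using m[of a0 "g 0"] m[of ainf "g \<infinity>"] by linarith
  qed
  then show ?thesis
    using \<mu> by (simp add: integral_min1_measure levy_measure_sets)
qed

section \<open>Two families of test functions that determine weak-star limits\<close>

text \<open>Convergence passes to uniform limits of test functions as soon as the total masses are bounded; the
  positive test function \<open>u\<close>, which is bounded below on the compact space, provides this bound.\<close>

lemma weak_star_conv_by_approximation:
  fixes u :: "ennreal \<Rightarrow> real"
  assumes N: "\<And>k. finite_measure (N k)" "\<And>k. sets (N k) = sets borel"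
    and K: "finite_measure K" "sets K = sets borel"
    and u: "continuous_on UNIV u" "\<And>x. 0 < u x" "(\<lambda>k. \<integral>y. u y \<partial>N k) \<longlonglongrightarrow> (\<integral>y. u y \<partial>K)"
    and approx: "\<And>(g :: ennreal \<Rightarrow> real) e. continuous_on UNIV g \<Longrightarrow> 0 < e \<Longrightarrow>
      \<exists>g'. continuous_on UNIV g' \<and> (\<forall>x. \<bar>g x - g' x\<bar> \<le> e)
         \<and> (\<lambda>k. \<integral>y. g' y \<partial>N k) \<longlonglongrightarrow> (\<integral>y. g' y \<partial>K)"
  shows "weak_star_conv N K"
  unfolding weak_star_conv_def
proof (intro allI impI)
  fix g :: "ennreal \<Rightarrow> real" assume g: "continuous_on UNIV g"
  note int = integrable_continuous_finite_measure
  obtain c where c: "0 < c" "\<And>x. c \<le> u x" using continuous_ennreal_pos_bound[OF u(1,2)] by blast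
  define C where "C = (\<integral>y. u y \<partial>K) + 1"
  \<comment> \<open>dominating \<open>e\<close> by \<open>(e / c) u\<close> turns masses into integrals of \<open>u\<close>, which converge\<close>
  have diff: "\<bar>(\<integral>y. f y \<partial>L) - (\<integral>y. f' y \<partial>L)\<bar> \<le> e * ((\<integral>y. u y \<partial>L) / c)"
    if "finite_measure L" "sets L = sets borel" "continuous_on UNIV f" "continuous_on UNIV f'"
      "\<And>x. \<bar>f x - f' x\<bar> \<le> e" "0 < e" for L f f' e
  proof -
    have "\<bar>(\<integral>y. f y \<partial>L) - (\<integral>y. f' y \<partial>L)\<bar> = \<bar>\<integral>y. f y - f' y \<partial>L\<bar>"
      using Bochner_Integration.integral_diff[OF int[OF that(1,2,3)] int[OF that(1,2,4)]] by simp
    also have "\<dots> \<le> (\<integral>y. \<bar>f y - f' y\<bar> \<partial>L)" by (rule integral_abs_bound)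
    also have "\<dots> \<le> (\<integral>y. e / c * u y \<partial>L)"
    proof (rule integral_mono)
      show "integrable L (\<lambda>y. \<bar>f y - f' y\<bar>)"
        by (rule int[OF that(1,2)]) (intro continuous_intros that)
      show "integrable L (\<lambda>y. e / c * u y)"
        by (rule int[OF that(1,2)]) (intro continuous_intros u)
      fix x
      have "e * c \<le> e * u x" using c that by simp
      then have "e \<le> e / c * u x" using c by (simp add: field_simps)
      then show "\<bar>f x - f' x\<bar> \<le> e / c * u x" using that(5)[of x] by simp
    qed
    finally show ?thesis using c(1) by simp
  qed
  have C0: "0 \<le> (\<integral>y. u y \<partial>K)" using u(2) by (intro integral_nonneg_AE) (auto intro: less_imp_le)
  then have "0 < C" unfolding C_def by linarith
  have evC: "\<forall>\<^sub>F k in sequentially. (\<integral>y. u y \<partial>N k) < C"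
    using order_tendstoD(2)[OF u(3), of C] by (simp add: C_def)
  show "(\<lambda>k. \<integral>y. g y \<partial>N k) \<longlonglongrightarrow> (\<integral>y. g y \<partial>K)"
  proof (rule tendstoI)
    fix e :: real assume "0 < e"
    define d where "d = e * c / (4 * C)"
    have "0 < d" using \<open>0 < e\<close> \<open>0 < c\<close> \<open>0 < C\<close> by (simp add: d_def)
    obtain g' where g': "continuous_on UNIV g'" "\<And>x. \<bar>g x - g' x\<bar> \<le> d"
        "(\<lambda>k. \<integral>y. g' y \<partial>N k) \<longlonglongrightarrow> (\<integral>y. g' y \<partial>K)"
      using approx[OF g \<open>0 < d\<close>] by blast
    have dC: "d * (z / c) \<le> e / 4" if "z \<le> C" for z
    proof -
      have "d * (z / c) = e / 4 * (z / C)" using \<open>0 < c\<close> \<open>0 < C\<close> by (simp add: d_def)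
      also have "\<dots> \<le> e / 4 * 1" using that \<open>0 < e\<close> \<open>0 < C\<close> by (intro mult_left_mono) auto
      finally show ?thesis by simp
    qed
    have K': "\<bar>(\<integral>y. g y \<partial>K) - (\<integral>y. g' y \<partial>K)\<bar> \<le> e / 4"
      by (rule order_trans[OF diff[OF K g g'(1,2) \<open>0 < d\<close>] dC]) (simp add: C_def)
    have "\<forall>\<^sub>F k in sequentially. \<bar>(\<integral>y. g' y \<partial>N k) - (\<integral>y. g' y \<partial>K)\<bar> < e / 4"
      using tendstoD[OF g'(3), of "e / 4"] \<open>0 < e\<close> by (simp add: dist_real_def)
    with evC show "\<forall>\<^sub>F k in sequentially. dist (\<integral>y. g y \<partial>N k) (\<integral>y. g y \<partial>K) < e"
    proof eventually_elim
      case (elim k)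
      have "\<bar>(\<integral>y. g y \<partial>N k) - (\<integral>y. g' y \<partial>N k)\<bar> \<le> e / 4"
        by (rule order_trans[OF diff[OF N g g'(1,2) \<open>0 < d\<close>] dC]) (use elim in simp)
      with K' elim show ?case using \<open>0 < e\<close> unfolding dist_real_def by linarith
    qed
  qed
qed

subsection \<open>Elementary bounds for the exponential\<close>

lemma exp_minus_le_quadratic:
  fixes v :: real assumes "0 \<le> v" shows "exp (- v) - 1 + v \<le> v\<^sup>2 / 2"
proof -
  have "(\<lambda>v. v\<^sup>2 / 2 - (exp (- v) - 1 + v)) 0 \<le> (\<lambda>v::real. v\<^sup>2 / 2 - (exp (- v) - 1 + v)) v"
  proof (rule DERIV_nonneg_imp_nondecreasing[OF assms])
    fix x :: real assume "0 \<le> x"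
    show "\<exists>y. ((\<lambda>v. v\<^sup>2 / 2 - (exp (- v) - 1 + v)) has_real_derivative y) (at x) \<and> 0 \<le> y"
      using exp_ge_add_one_self[of "- x"]
      by (intro exI[of _ "x - (- exp (- x) + 1)"] conjI) (auto intro!: derivative_eq_intros)
  qed
  then show ?thesis by simp
qed

lemma exp_minus_ge_cubic:
  fixes v :: real assumes "0 \<le> v" shows "v\<^sup>2 / 2 - v ^ 3 / 6 \<le> exp (- v) - 1 + v"
proof -
  have "(\<lambda>v. exp (- v) - 1 + v - v\<^sup>2 / 2 + v ^ 3 / 6) 0 \<le> (\<lambda>v::real. exp (- v) - 1 + v - v\<^sup>2 / 2 + v ^ 3 / 6) v"
  proof (rule DERIV_nonneg_imp_nondecreasing[OF assms])
    fix x :: real assume "0 \<le> x"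
    then show "\<exists>y. ((\<lambda>v. exp (- v) - 1 + v - v\<^sup>2 / 2 + v ^ 3 / 6) has_real_derivative y) (at x) \<and> 0 \<le> y"
      using exp_minus_le_quadratic[of x]
      by (intro exI[of _ "- exp (- x) + 1 - x + x\<^sup>2 / 2"] conjI)
         (auto intro!: derivative_eq_intros simp: power2_eq_square)
  qed
  then show ?thesis by simp
qed

lemma exp_minus_nonneg: "0 \<le> exp (- v) - 1 + (v::real)"
  using exp_ge_add_one_self[of "- v"] by simp

lemma one_minus_exp_bounds:
  fixes v :: real assumes "0 \<le> v"
  shows "0 \<le> 1 - exp (- v)" "1 - exp (- v) \<le> v" "1 - exp (- v) \<le> 1" "v - v\<^sup>2 / 2 \<le> 1 - exp (- v)"
  using assms exp_ge_add_one_self[of "- v"] exp_minus_le_quadratic[OF assms] by auto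

subsection \<open>Bernstein test functions\<close>

text \<open>Integrating this function against \<open>\<beta> \<delta>\<^sub>0 + (x \<and> 1) d\<nu>(x)\<close> gives the Bernstein function
  \<open>\<beta> q + \<integral>(1 - e\<^sup>-\<^sup>q\<^sup>x) d\<nu>(x)\<close>.\<close>

definition bernstein_test :: "real \<Rightarrow> ennreal \<Rightarrow> real" where
  "bernstein_test q = extend_continuously (\<lambda>x. (1 - exp (- q * x)) / min x 1) q (if q = 0 then 0 else 1)"

lemma bernstein_test_simps [simp]:
  "bernstein_test q 0 = q"
  "0 < q \<Longrightarrow> bernstein_test q \<infinity> = 1"
  "0 < q \<Longrightarrow> bernstein_test q \<top> = 1"
  by (auto simp: bernstein_test_def)

lemma bernstein_test_0 [simp]: "bernstein_test 0 x = 0"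
  by (simp add: bernstein_test_def extend_continuously_def)

lemma min1_bernstein_test: "0 < x \<Longrightarrow> min x 1 * bernstein_test q (ennreal x) = 1 - exp (- q * x)"
  by (simp add: bernstein_test_def)

lemma exp_neg_linear_at_top:
  fixes q :: real assumes "0 < q" shows "((\<lambda>x. exp (- q * x)) \<longlongrightarrow> 0) at_top"
proof -
  have "filterlim (\<lambda>x. - q * x) at_bot at_top"
    using assms by (simp add: filterlim_uminus_at_bot filterlim_tendsto_pos_mult_at_top[OF tendsto_const _ filterlim_ident])
  then show ?thesis by (rule filterlim_compose[OF exp_at_bot])
qed

lemma continuous_bernstein_test:
  assumes "0 \<le> q" shows "continuous_on UNIV (bernstein_test q)"
proof (cases "q = 0")
  case False
  with assms have q: "0 < q" by simp
  show ?thesis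
    unfolding bernstein_test_def
  proof (rule continuous_extend_continuously)
    show "continuous_on {0<..} (\<lambda>x. (1 - exp (- q * x)) / min x 1)"
      by (intro continuous_intros) auto
    have small: "\<forall>\<^sub>F x::real in at_right 0. 0 < x \<and> x < 1"
      using eventually_at_right_less[of 0] eventually_at_right[of 0 1 "\<lambda>x. x < 1"]
      by (metis (mono_tags, lifting) eventually_conj eventually_mono zero_less_one)
    show "((\<lambda>x. (1 - exp (- q * x)) / min x 1) \<longlongrightarrow> q) (at_right 0)"
    proof (rule tendsto_sandwich)
      show "\<forall>\<^sub>F x in at_right 0. q - q\<^sup>2 * x / 2 \<le> (1 - exp (- q * x)) / min x 1"
        using small
      proof eventually_elim
        case (elim x)
        have "(q - q\<^sup>2 * x / 2) * x \<le> 1 - exp (- q * x)"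
          using one_minus_exp_bounds(4)[of "q * x"] q elim by (simp add: algebra_simps power2_eq_square)
        then show ?case using elim by (simp add: pos_le_divide_eq min_absorb1 less_imp_le)
      qed
      show "\<forall>\<^sub>F x in at_right 0. (1 - exp (- q * x)) / min x 1 \<le> q"
        using small
      proof eventually_elim
        case (elim x)
        then show ?case using one_minus_exp_bounds(2)[of "q * x"] q by (simp add: field_simps min_absorb1)
      qed
      have "((\<lambda>x. q - q\<^sup>2 * x / 2) \<longlongrightarrow> q - q\<^sup>2 * 0 / 2) (at_right 0)" by (intro tendsto_intros) auto
      then show "((\<lambda>x. q - q\<^sup>2 * x / 2) \<longlongrightarrow> q) (at_right 0)" by simp
    qed simp
    have "((\<lambda>x. 1 - exp (- q * x)) \<longlongrightarrow> 1 - 0) at_top"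
      by (intro tendsto_intros exp_neg_linear_at_top q)
    moreover have "\<forall>\<^sub>F x in at_top. 1 - exp (- q * x) = (1 - exp (- q * x)) / min x 1"
      using eventually_ge_at_top[of "1::real"] by eventually_elim simp
    ultimately show "((\<lambda>x. (1 - exp (- q * x)) / min x 1) \<longlongrightarrow> (if q = 0 then 0 else 1)) at_top"
      using q by (simp add: tendsto_cong)
  qed
qed simp

lemma bernstein_test_pos: "0 < q \<Longrightarrow> 0 < bernstein_test q x"
  by (cases x) (auto simp: less_eq_real_def bernstein_test_def)

lemma bernstein_test_difference:
  "bernstein_test 1 x * exp_neg x ^ i = bernstein_test (real (Suc i)) x - bernstein_test (real i) x"
proof -
  consider "x = 0" | "x = \<infinity>" | r where "x = ennreal r" "0 < r"
    by (cases x) (auto simp: infinity_ennreal_def less_eq_real_def)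
  then show ?thesis
  proof cases
    case 2 then show ?thesis by (cases i) (auto simp: bernstein_test_def)
  next
    case (3 r)
    have "(1 - exp (- r)) * exp (- r) ^ i = (1 - exp (- real (Suc i) * r)) - (1 - exp (- real i * r))"
      by (simp add: exp_of_nat_mult[symmetric] algebra_simps mult_exp_exp)
    then show ?thesis using 3 by (simp add: bernstein_test_def diff_divide_distrib[symmetric])
  qed auto
qed

text \<open>The products of \<open>bernstein_test 1\<close> with the powers of \<open>e\<^sup>-\<^sup>x\<close> are differences of Bernstein test
  functions, so by Weierstrass' theorem the linear span of the latter is dense in \<open>C([0,\<infinity>])\<close>.\<close>

lemma weak_star_conv_by_bernstein_tests:
  assumes N: "\<And>k. finite_measure (N k)" "\<And>k. sets (N k) = sets borel"
    and K: "finite_measure K" "sets K = sets borel"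
    and lim: "\<And>q. 0 < q \<Longrightarrow> (\<lambda>k. \<integral>y. bernstein_test q y \<partial>N k) \<longlonglongrightarrow> (\<integral>y. bernstein_test q y \<partial>K)"
  shows "weak_star_conv N K"
proof (rule weak_star_conv_by_approximation[OF N K])
  show "continuous_on UNIV (bernstein_test 1)" by (rule continuous_bernstein_test) simp
  show "0 < bernstein_test 1 x" for x by (rule bernstein_test_pos) simp
  show "(\<lambda>k. \<integral>y. bernstein_test 1 y \<partial>N k) \<longlonglongrightarrow> (\<integral>y. bernstein_test 1 y \<partial>K)" by (rule lim) simp
  fix g :: "ennreal \<Rightarrow> real" and e :: real assume g: "continuous_on UNIV g" and "0 < e"
  let ?b = "bernstein_test"
  have cb: "continuous_on UNIV (?b (real i))" for i by (rule continuous_bernstein_test) simp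
  have cb1: "continuous_on UNIV (?b 1)" by (rule continuous_bernstein_test) simp
  obtain B where B: "0 < B" "\<And>x. \<bar>?b 1 x\<bar> \<le> B"
    using continuous_ennreal_bounded[OF cb1] by blast
  have b1: "0 < ?b 1 x" for x by (rule bernstein_test_pos) simp
  have "continuous_on UNIV (\<lambda>x. g x / ?b 1 x)"
    using b1 by (intro continuous_intros g cb1) (metis less_irrefl)
  then obtain a n where a: "\<And>x. \<bar>g x / ?b 1 x - (\<Sum>i\<le>n. a i * exp_neg x ^ i)\<bar> < e / B"
    using polynomial_approximation_exp_neg[of "\<lambda>x. g x / ?b 1 x" "e / B"] \<open>0 < e\<close> B(1) by auto
  define g' where "g' = (\<lambda>x. \<Sum>i\<le>n. a i * (?b (real (Suc i)) x - ?b (real i) x))"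
  have g'_eq: "g' x = ?b 1 x * (\<Sum>i\<le>n. a i * exp_neg x ^ i)" for x
    unfolding g'_def sum_distrib_left bernstein_test_difference[symmetric] by (simp add: mult_ac)
  have int: "integrable L (?b (real i))" if "finite_measure L" "sets L = sets borel" for L i
    by (rule integrable_continuous_finite_measure[OF that cb])
  have I: "(\<integral>y. g' y \<partial>L) = (\<Sum>i\<le>n. a i * ((\<integral>y. ?b (real (Suc i)) y \<partial>L) - (\<integral>y. ?b (real i) y \<partial>L)))"
    if "finite_measure L" "sets L = sets borel" for L
    unfolding g'_def using int[OF that] by (simp del: of_nat_Suc)
  have lim': "(\<lambda>k. \<integral>y. ?b (real i) y \<partial>N k) \<longlonglongrightarrow> (\<integral>y. ?b (real i) y \<partial>K)" for i
    by (cases "i = 0") (auto intro: lim)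
  show "\<exists>g'. continuous_on UNIV g' \<and> (\<forall>x. \<bar>g x - g' x\<bar> \<le> e)
         \<and> (\<lambda>k. \<integral>y. g' y \<partial>N k) \<longlonglongrightarrow> (\<integral>y. g' y \<partial>K)"
  proof (intro exI[of _ g'] conjI allI)
    show "continuous_on UNIV g'" unfolding g'_def by (intro continuous_intros cb)
    fix x
    have "g x - g' x = ?b 1 x * (g x / ?b 1 x - (\<Sum>i\<le>n. a i * exp_neg x ^ i))"
      unfolding g'_eq using b1[of x] by (simp add: right_diff_distrib)
    then have "\<bar>g x - g' x\<bar> = ?b 1 x * \<bar>g x / ?b 1 x - (\<Sum>i\<le>n. a i * exp_neg x ^ i)\<bar>"
      using b1[of x] by (simp add: abs_mult)
    also have "\<dots> \<le> B * (e / B)" using a[of x] B(2)[of x] b1[of x] B(1)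
      by (intro mult_mono) auto
    finally show "\<bar>g x - g' x\<bar> \<le> e" using B(1) by simp
  next
    show "(\<lambda>k. \<integral>y. g' y \<partial>N k) \<longlonglongrightarrow> (\<integral>y. g' y \<partial>K)"
      unfolding I[OF K] I[OF N] by (intro tendsto_intros lim')
  qed
qed

subsection \<open>Branching test functions\<close>

text \<open>Integrating this function against \<open>\<alpha>\<^sub>0 \<delta>\<^sub>0 + \<alpha>\<^sub>\<infinity> \<delta>\<^sub>\<infinity> + (x \<and> 1) d\<mu>(x)\<close> gives \<open>\<Psi>(s)\<close>.\<close>

definition branching_test :: "real \<Rightarrow> ennreal \<Rightarrow> real" where
  "branching_test s = extend_continuously (\<lambda>x. (exp (- s * x) - 1 + s * x) / (x * min x 1)) (s\<^sup>2 / 2) s"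

lemma branching_test_simps [simp]:
  "branching_test s 0 = s\<^sup>2 / 2" "branching_test s \<infinity> = s" "branching_test s \<top> = s"
  by (auto simp: branching_test_def)

lemma branching_test_0 [simp]: "branching_test 0 x = 0"
  by (simp add: branching_test_def extend_continuously_def)

lemma branching_test_pos_real:
  "0 < x \<Longrightarrow> branching_test s (ennreal x) = (exp (- s * x) - 1 + s * x) / (x * min x 1)"
  by (simp add: branching_test_def)

lemma min1_branching_test:
  "0 < x \<Longrightarrow> min x 1 * branching_test s (ennreal x) = (exp (- s * x) - 1 + s * x) / x"
  by (simp add: branching_test_def)

lemma continuous_branching_test:
  assumes "0 \<le> s" shows "continuous_on UNIV (branching_test s)"
  unfolding branching_test_def
proof (rule continuous_extend_continuously)
  show "continuous_on {0<..} (\<lambda>x. (exp (- s * x) - 1 + s * x) / (x * min x 1))"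
    by (intro continuous_intros) auto
  have small: "\<forall>\<^sub>F x::real in at_right 0. 0 < x \<and> x < 1"
    using eventually_at_right_less[of 0] eventually_at_right[of 0 1 "\<lambda>x. x < 1"]
    by (metis (mono_tags, lifting) eventually_conj eventually_mono zero_less_one)
  show "((\<lambda>x. (exp (- s * x) - 1 + s * x) / (x * min x 1)) \<longlongrightarrow> s\<^sup>2 / 2) (at_right 0)"
  proof (rule tendsto_sandwich)
    show "\<forall>\<^sub>F x in at_right 0. s\<^sup>2 / 2 - s ^ 3 * x / 6 \<le> (exp (- s * x) - 1 + s * x) / (x * min x 1)"
      using small
    proof eventually_elim
      case (elim x)
      have "(s\<^sup>2 / 2 - s ^ 3 * x / 6) * (x * x) \<le> exp (- s * x) - 1 + s * x"
        using exp_minus_ge_cubic[of "s * x"] assms elim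
        by (simp add: algebra_simps power2_eq_square power3_eq_cube)
      then show ?case using elim by (simp add: pos_le_divide_eq min_absorb1 less_imp_le)
    qed
    show "\<forall>\<^sub>F x in at_right 0. (exp (- s * x) - 1 + s * x) / (x * min x 1) \<le> s\<^sup>2 / 2"
      using small
    proof eventually_elim
      case (elim x)
      then show ?case using exp_minus_le_quadratic[of "s * x"] assms
        by (simp add: pos_divide_le_eq min_absorb1 less_imp_le power2_eq_square algebra_simps)
    qed
    have "((\<lambda>x. s\<^sup>2 / 2 - s ^ 3 * x / 6) \<longlongrightarrow> s\<^sup>2 / 2 - s ^ 3 * 0 / 6) (at_right 0)" by (intro tendsto_intros) auto
    then show "((\<lambda>x. s\<^sup>2 / 2 - s ^ 3 * x / 6) \<longlongrightarrow> s\<^sup>2 / 2) (at_right 0)" by simp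
  qed simp
  show "((\<lambda>x. (exp (- s * x) - 1 + s * x) / (x * min x 1)) \<longlongrightarrow> s) at_top"
  proof (rule tendsto_sandwich)
    show "\<forall>\<^sub>F x in at_top. s - 1 / x \<le> (exp (- s * x) - 1 + s * x) / (x * min x 1)"
      using eventually_ge_at_top[of "1::real"] by eventually_elim (simp add: field_simps)
    show "\<forall>\<^sub>F x in at_top. (exp (- s * x) - 1 + s * x) / (x * min x 1) \<le> s"
      using eventually_ge_at_top[of "1::real"]
      by eventually_elim (use assms in \<open>simp add: field_simps\<close>)
    have "((\<lambda>x::real. s - 1 / x) \<longlongrightarrow> s - 0) at_top"
      by (intro tendsto_intros tendsto_divide_0[OF tendsto_const] filterlim_at_top_imp_at_infinity filterlim_ident)
    then show "((\<lambda>x::real. s - 1 / x) \<longlongrightarrow> s) at_top" by simp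
  qed simp
qed

lemma exp_minus_pos:
  fixes v :: real assumes "v \<noteq> 0" shows "0 < exp (- v) - 1 + v"
proof -
  have eq: "exp (- v) - 1 + v = (exp (- (v / 2)) - 1)\<^sup>2 + 2 * (exp (- (v / 2)) - 1 + v / 2)"
    by (simp add: power2_eq_square algebra_simps mult_exp_exp)
  have "0 < (exp (- (v / 2)) - 1)\<^sup>2" using assms by simp
  moreover have "0 \<le> 2 * (exp (- (v / 2)) - 1 + v / 2)" using exp_minus_nonneg[of "v / 2"] by simp
  ultimately show ?thesis unfolding eq by (rule add_pos_nonneg)
qed

lemma branching_test_pos: "0 < s \<Longrightarrow> 0 < branching_test s x"
  by (cases x) (auto simp: less_eq_real_def branching_test_def exp_minus_pos intro!: divide_pos_pos)

section \<open>Generating functions of Galton-Watson processes\<close>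

definition pgf :: "nat pmf \<Rightarrow> real \<Rightarrow> real" where
  "pgf p z = (\<Sum>j. pmf p j * z ^ j)"

lemma pmf_nat_sums_1: "pmf (p :: nat pmf) sums 1"
  using sums_integral_count_space_nat[OF integrable_pmf[of UNIV p]]
  by (simp add: integral_pmf measure_pmf.prob_space[simplified])

lemma pgf_sums:
  assumes "0 \<le> z" "z \<le> 1"
  shows "(\<lambda>j. pmf p j * z ^ j) sums pgf p z"
proof -
  have "summable (\<lambda>j. pmf p j * z ^ j)"
  proof (rule summable_comparison_test'[OF sums_summable[OF pmf_nat_sums_1[of p]]])
    show "norm (pmf p j * z ^ j) \<le> pmf p j" for j
      using assms mult_left_mono[OF power_le_one[OF assms, of j] pmf_nonneg[of p j]] by (simp add: abs_mult)
  qed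
  then show ?thesis unfolding pgf_def by (rule summable_sums)
qed

lemma pgf_bounds:
  assumes "0 \<le> z" "z \<le> 1"
  shows "0 \<le> pgf p z" "pgf p z \<le> 1"
proof -
  show "0 \<le> pgf p z"
    by (rule sums_le[OF _ sums_zero pgf_sums[OF assms, of p]]) (simp add: assms)
  show "pgf p z \<le> 1"
    by (rule sums_le[OF _ pgf_sums[OF assms, of p] pmf_nat_sums_1[of p]])
       (simp add: assms mult_left_le power_le_one)
qed

lemma iterated_pgf_bounds:
  assumes "0 \<le> z" "z \<le> 1"
  shows "0 \<le> (pgf p ^^ n) z \<and> (pgf p ^^ n) z \<le> 1"
  by (induction n) (use assms pgf_bounds in auto)

lemma expectation_power_pmf:
  assumes "prob_space M" "X \<in> M \<rightarrow>\<^sub>M count_space UNIV" "distr M (count_space UNIV) X = measure_pmf p"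
    and z: "0 \<le> z" "z \<le> 1"
  shows "(\<integral>\<omega>. z ^ X \<omega> \<partial>M) = pgf p z"
proof -
  have int: "integrable (count_space UNIV) (\<lambda>j. pmf p j * z ^ j)"
    using sums_summable[OF pgf_sums[OF z]] z by (simp add: integrable_count_space_nat_iff abs_mult)
  have "(\<integral>\<omega>. z ^ X \<omega> \<partial>M) = (\<integral>j. z ^ j \<partial>distr M (count_space UNIV) X)"
    using assms(2) by (simp add: integral_distr)
  also have "\<dots> = (\<integral>j. pmf p j * z ^ j \<partial>count_space UNIV)"
    unfolding assms(3) measure_pmf_eq_density by (subst integral_density) auto
  also have "\<dots> = pgf p z" unfolding pgf_def by (rule integral_count_space_nat[OF int])
  finally show ?thesis .
qed

text \<open>This allows the process to be evaluated on the space of finite pasts: by itself, \<open>\<xi>\<close> is replaced by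
  the coordinate functions of a product space.\<close>

lemma galton_watson_cong:
  assumes "\<And>m i. m < n \<Longrightarrow> \<xi> m i \<omega> = \<xi>' m i \<omega>'"
  shows "galton_watson \<xi> n \<omega> = galton_watson \<xi>' n \<omega>'"
  using assms by (induction n) auto

lemma measurable_random_sum:
  fixes f :: "nat \<Rightarrow> 'a \<Rightarrow> nat"
  assumes f: "\<And>i. f i \<in> N \<rightarrow>\<^sub>M count_space UNIV"
  shows "(\<lambda>\<omega>. \<Sum>i<(j::nat). f i \<omega>) \<in> N \<rightarrow>\<^sub>M count_space UNIV"
proof (induction j)
  case (Suc j)
  have "(\<lambda>\<omega>. (\<lambda>k \<omega>. k + f j \<omega>) (\<Sum>i<j. f i \<omega>) \<omega>) \<in> N \<rightarrow>\<^sub>M count_space UNIV"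
  proof (rule measurable_compose_countable[OF _ Suc])
    show "(\<lambda>\<omega>. k + f j \<omega>) \<in> N \<rightarrow>\<^sub>M count_space UNIV" for k
      by (rule measurable_compose[OF f]) simp
  qed
  then show ?case by simp
qed simp

lemma measurable_galton_watson:
  assumes "\<And>m i. m < n \<Longrightarrow> \<xi> m i \<in> N \<rightarrow>\<^sub>M count_space UNIV"
  shows "galton_watson \<xi> n \<in> N \<rightarrow>\<^sub>M count_space UNIV"
  using assms
proof (induction n)
  case (Suc n)
  have "(\<lambda>\<omega>. (\<lambda>j \<omega>. \<Sum>i<j. \<xi> n i \<omega>) (galton_watson \<xi> n \<omega>) \<omega>) \<in> N \<rightarrow>\<^sub>M count_space UNIV"
    by (rule measurable_compose_countable) (use Suc in \<open>auto intro: measurable_random_sum\<close>)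
  then show ?case by simp
next
  case 0
  have "galton_watson \<xi> 0 = (\<lambda>_. 1)" by (simp add: fun_eq_iff)
  then show ?case by simp
qed

text \<open>Decomposition of an expectation over the values of \<open>X\<close>, by dominated convergence of \<open>1\<^bsub>{X < n}\<^esub> Y\<close>.\<close>

lemma expectation_sums_over_values:
  fixes X :: "'a \<Rightarrow> nat" and Y :: "'a \<Rightarrow> real"
  assumes "prob_space M" and X: "X \<in> M \<rightarrow>\<^sub>M count_space UNIV" and Y: "Y \<in> borel_measurable M"
    and b: "\<And>\<omega>. \<bar>Y \<omega>\<bar> \<le> 1"
  shows "(\<lambda>j. \<integral>\<omega>. indicator {\<omega>'. X \<omega>' = j} \<omega> * Y \<omega> \<partial>M) sums (\<integral>\<omega>. Y \<omega> \<partial>M)"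
  unfolding sums_def
proof -
  interpret prob_space M by fact
  have m: "(\<lambda>\<omega>. indicator {\<omega>'. X \<omega>' = j} \<omega> :: real) \<in> borel_measurable M" for j
  proof -
    have "(\<lambda>\<omega>. if X \<omega> = j then 1 else 0 :: real) \<in> borel_measurable M"
      by (rule measurable_compose[OF X, of "\<lambda>i. if i = j then 1 else 0"]) simp
    moreover have "(\<lambda>\<omega>. indicator {\<omega>'. X \<omega>' = j} \<omega>) = (\<lambda>\<omega>. if X \<omega> = j then 1 else 0 :: real)"
      by (auto simp: indicator_def)
    ultimately show ?thesis by simp
  qed
  have int: "integrable M (\<lambda>\<omega>. indicator {\<omega>'. X \<omega>' = j} \<omega> * Y \<omega>)" for j
    by (rule integrable_const_bound[of _ 1]) (use m Y b in \<open>auto simp: indicator_def\<close>)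
  have eq: "(\<Sum>j<n. \<integral>\<omega>. indicator {\<omega>'. X \<omega>' = j} \<omega> * Y \<omega> \<partial>M)
      = (\<integral>\<omega>. (\<Sum>j<n. indicator {\<omega>'. X \<omega>' = j} \<omega> * Y \<omega>) \<partial>M)" for n
    by (rule Bochner_Integration.integral_sum[symmetric]) (rule int)
  have val: "(\<Sum>j<n. indicator {\<omega>'. X \<omega>' = j} \<omega> * Y \<omega>) = (if X \<omega> < n then Y \<omega> else 0)" for n \<omega>
    by (simp add: indicator_def of_bool_def if_distrib[of "\<lambda>x. x * _"] sum.delta cong: if_cong)
  show "(\<lambda>n. \<Sum>j<n. \<integral>\<omega>. indicator {\<omega>'. X \<omega>' = j} \<omega> * Y \<omega> \<partial>M) \<longlonglongrightarrow> (\<integral>\<omega>. Y \<omega> \<partial>M)"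
    unfolding eq
  proof (rule integral_dominated_convergence[where w = "\<lambda>_. 1"])
    show "AE \<omega> in M. (\<lambda>n. \<Sum>j<n. indicator {\<omega>'. X \<omega>' = j} \<omega> * Y \<omega>) \<longlonglongrightarrow> Y \<omega>"
    proof (rule AE_I2)
      fix \<omega>
      have "\<forall>\<^sub>F n in sequentially. Y \<omega> = (\<Sum>j<n. indicator {\<omega>'. X \<omega>' = j} \<omega> * Y \<omega>)"
        using eventually_gt_at_top[of "X \<omega>"] by eventually_elim (simp only: val if_True)
      then show "(\<lambda>n. \<Sum>j<n. indicator {\<omega>'. X \<omega>' = j} \<omega> * Y \<omega>) \<longlonglongrightarrow> Y \<omega>"
        by (rule Lim_transform_eventually[OF tendsto_const])
    qed
    show "AE \<omega> in M. norm (\<Sum>j<n. indicator {\<omega>'. X \<omega>' = j} \<omega> * Y \<omega>) \<le> 1" for n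
      unfolding val using b by auto
    show "(\<lambda>\<omega>. \<Sum>j<n. indicator {\<omega>'. X \<omega>' = j} \<omega> * Y \<omega>) \<in> borel_measurable M" for n
      by (rule borel_measurable_sum, rule borel_measurable_times[OF m Y])
  qed (simp_all add: Y)
qed

lemma abs_power_le_1: "0 \<le> a \<Longrightarrow> a \<le> 1 \<Longrightarrow> \<bar>a ^ k\<bar> \<le> (1::real)"
  by (simp add: power_le_one)

lemma measurable_galton_watson_iid:
  assumes gw: "iid_family_sizes M p \<xi>"
  shows "\<xi> n i \<in> M \<rightarrow>\<^sub>M count_space UNIV" "galton_watson \<xi> n \<in> M \<rightarrow>\<^sub>M count_space UNIV"
proof -
  interpret prob_space M using gw by (simp add: iid_family_sizes_def)
  have "random_variable (count_space UNIV) ((\<lambda>(n, i). \<xi> n i) q)" for q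
    using gw unfolding iid_family_sizes_def indep_vars_def by blast
  from this[of "(_, _)"] show m: "\<xi> n i \<in> M \<rightarrow>\<^sub>M count_space UNIV" for n i
    by simp
  show "galton_watson \<xi> n \<in> M \<rightarrow>\<^sub>M count_space UNIV"
    by (rule measurable_galton_watson) (rule m)
qed

lemma expectation_power_sum_of_families:
  assumes gw: "iid_family_sizes M p \<xi>" and z: "0 \<le> z" "z \<le> 1"
  shows "(\<integral>\<omega>. (\<Prod>i<j. z ^ \<xi> n i \<omega>) \<partial>M) = pgf p z ^ j"
proof -
  interpret prob_space M using gw by (simp add: iid_family_sizes_def)
  let ?X = "\<lambda>(n, i). \<xi> n i"
  let ?I = "Pair n ` {..<j}"
  have ind: "indep_vars (\<lambda>_. count_space UNIV) ?X UNIV"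
    and dist: "\<And>n i. distr M (count_space UNIV) (\<xi> n i) = measure_pmf p"
    using gw by (auto simp: iid_family_sizes_def)
  note m = measurable_galton_watson_iid(1)[OF gw]
  have pw: "(\<lambda>k. z ^ k) \<in> borel_measurable (count_space UNIV)" by simp
  have "indep_vars (\<lambda>_. count_space UNIV) ?X ?I" by (rule indep_vars_subset[OF ind]) simp
  then have "indep_vars (\<lambda>_. borel) (\<lambda>q \<omega>. z ^ ?X q \<omega>) ?I"
    by (rule indep_vars_compose2) simp
  then have "(\<integral>\<omega>. (\<Prod>q\<in>?I. z ^ ?X q \<omega>) \<partial>M) = (\<Prod>q\<in>?I. \<integral>\<omega>. z ^ ?X q \<omega> \<partial>M)"
  proof (rule indep_vars_lebesgue_integral[rotated])
    fix q assume "q \<in> ?I"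
    then obtain i where q: "q = (n, i)" by auto
    show "integrable M (\<lambda>\<omega>. z ^ ?X q \<omega>)"
      unfolding q prod.case
      by (rule integrable_const_bound[of _ 1, OF AE_I2 measurable_compose[OF m pw]])
         (use abs_power_le_1[OF z] in simp)
  qed simp
  also have "\<dots> = (\<Prod>i<j. \<integral>\<omega>. z ^ \<xi> n i \<omega> \<partial>M)"
    by (subst prod.reindex) (simp_all add: inj_on_def)
  also have "\<dots> = (\<Prod>i<j. pgf p z)"
    using expectation_power_pmf[OF prob_space_axioms m dist z] by simp
  also have "(\<lambda>\<omega>. \<Prod>q\<in>?I. z ^ ?X q \<omega>) = (\<lambda>\<omega>. \<Prod>i<j. z ^ \<xi> n i \<omega>)"
    by (subst prod.reindex) (simp_all add: inj_on_def)
  finally show ?thesis by simp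
qed

text \<open>The generation \<open>n\<close> only depends on the families of the earlier generations.\<close>

lemma indep_galton_watson_families:
  assumes gw: "iid_family_sizes M p \<xi>"
  shows "prob_space.indep_var M borel (indicator {\<omega>'. galton_watson \<xi> n \<omega>' = k} :: _ \<Rightarrow> real)
    borel (\<lambda>\<omega>. \<Prod>i<j. (z::real) ^ \<xi> n i \<omega>)"
proof -
  interpret prob_space M using gw by (simp add: iid_family_sizes_def)
  let ?X = "\<lambda>(n, i). \<xi> n i"
  have ind: "indep_vars (\<lambda>_. count_space UNIV) ?X UNIV"
    using gw by (auto simp: iid_family_sizes_def)
  let ?A = "{(m, i::nat). m < n}" and ?B = "{(m, i::nat). m = n}"
  let ?C = "\<lambda>_::nat \<times> nat. count_space (UNIV :: nat set)"
  let ?T = "\<lambda>f. galton_watson (\<lambda>m i f. f (m, i)) n f"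
  let ?F = "\<lambda>f. (if ?T f = k then 1 else 0) :: real"
  let ?H = "\<lambda>f. \<Prod>i<j. z ^ f (n, i)"
  have iv: "indep_var (PiM ?A ?C) (\<lambda>\<omega>. restrict (\<lambda>i. ?X i \<omega>) ?A)
    (PiM ?B ?C) (\<lambda>\<omega>. restrict (\<lambda>i. ?X i \<omega>) ?B)"
    by (rule indep_var_restrict[OF ind]) auto
  have mT: "?T \<in> PiM ?A ?C \<rightarrow>\<^sub>M count_space UNIV"
  proof (rule measurable_galton_watson)
    fix m i assume "m < n"
    then show "(\<lambda>f. f (m, i)) \<in> PiM ?A ?C \<rightarrow>\<^sub>M count_space UNIV"
      by (intro measurable_component_singleton[of "(m, i)" ?A ?C]) simp
  qed
  have mF: "?F \<in> borel_measurable (PiM ?A ?C)"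
    by (rule measurable_compose[OF mT, of "\<lambda>i. if i = k then 1 else 0"]) simp
  have mH: "?H \<in> borel_measurable (PiM ?B ?C)"
  proof (rule borel_measurable_prod)
    fix i
    have "(\<lambda>f. f (n, i)) \<in> PiM ?B ?C \<rightarrow>\<^sub>M count_space UNIV"
      by (intro measurable_component_singleton[of "(n, i)" ?B ?C]) simp
    then show "(\<lambda>f. z ^ f (n, i)) \<in> borel_measurable (PiM ?B ?C)"
      by (rule measurable_compose) simp
  qed
  have iv': "indep_var borel (?F \<circ> (\<lambda>\<omega>. restrict (\<lambda>i. ?X i \<omega>) ?A)) borel (?H \<circ> (\<lambda>\<omega>. restrict (\<lambda>i. ?X i \<omega>) ?B))"
    by (rule indep_var_compose[OF iv mF mH])
  have F_eq: "?F \<circ> (\<lambda>\<omega>. restrict (\<lambda>i. ?X i \<omega>) ?A) = indicator {\<omega>'. galton_watson \<xi> n \<omega>' = k}"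
  proof
    fix \<omega>
    have "galton_watson (\<lambda>m i f. f (m, i)) n (restrict (\<lambda>i. ?X i \<omega>) ?A) = galton_watson \<xi> n \<omega>"
      by (rule galton_watson_cong) simp
    then show "(?F \<circ> (\<lambda>\<omega>. restrict (\<lambda>i. ?X i \<omega>) ?A)) \<omega> = indicator {\<omega>'. galton_watson \<xi> n \<omega>' = k} \<omega>"
      by (simp only: o_def indicator_def mem_Collect_eq of_bool_def)
  qed
  have H_eq: "?H \<circ> (\<lambda>\<omega>. restrict (\<lambda>i. ?X i \<omega>) ?B) = (\<lambda>\<omega>. \<Prod>i<j. z ^ \<xi> n i \<omega>)"
    by (simp add: fun_eq_iff)
  show ?thesis using iv' unfolding F_eq H_eq .
qed

text \<open>The branching property: conditionally on \<open>X\<^sub>n = j\<close>, the next generation is a sum of \<open>j\<close>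
  independent copies of the family size, which are independent of \<open>X\<^sub>n\<close>.\<close>

lemma expectation_power_galton_watson_Suc:
  assumes gw: "iid_family_sizes M p \<xi>" and z: "0 \<le> z" "z \<le> 1"
  shows "(\<integral>\<omega>. z ^ galton_watson \<xi> (Suc n) \<omega> \<partial>M) = (\<integral>\<omega>. pgf p z ^ galton_watson \<xi> n \<omega> \<partial>M)"
proof -
  interpret prob_space M using gw by (simp add: iid_family_sizes_def)
  let ?G = "galton_watson \<xi> n"
  note mg = measurable_galton_watson_iid(2)[OF gw]
  have pw: "(\<lambda>k. a ^ k) \<in> borel_measurable (count_space UNIV)" for a :: real by simp
  have key: "(\<integral>\<omega>. indicator {\<omega>'. ?G \<omega>' = j} \<omega> * z ^ galton_watson \<xi> (Suc n) \<omega> \<partial>M)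
    = (\<integral>\<omega>. indicator {\<omega>'. ?G \<omega>' = j} \<omega> \<partial>M) * pgf p z ^ j" for j
  proof -
    note iv = indep_galton_watson_families[OF gw, where n = n and k = j and j = j and z = z]
    have "(\<integral>\<omega>. indicator {\<omega>'. ?G \<omega>' = j} \<omega> * z ^ galton_watson \<xi> (Suc n) \<omega> \<partial>M)
        = (\<integral>\<omega>. indicator {\<omega>'. ?G \<omega>' = j} \<omega> * (\<Prod>i<j. z ^ \<xi> n i \<omega>) \<partial>M)"
      by (rule Bochner_Integration.integral_cong[OF refl]) (simp add: indicator_def power_sum)
    also have "\<dots> = (\<integral>\<omega>. indicator {\<omega>'. ?G \<omega>' = j} \<omega> \<partial>M) * (\<integral>\<omega>. (\<Prod>i<j. z ^ \<xi> n i \<omega>) \<partial>M)"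
    proof (rule indep_var_lebesgue_integral[OF iv])
      show "integrable M (indicator {\<omega>'. ?G \<omega>' = j} :: _ \<Rightarrow> real)"
        by (rule integrable_const_bound[of _ 1, OF AE_I2 indep_var_rv1[OF iv]]) (simp add: indicator_def)
      have "\<bar>\<Prod>i<j. z ^ \<xi> n i \<omega>\<bar> \<le> 1" for \<omega>
        unfolding abs_prod by (rule prod_le_1) (use abs_power_le_1[OF z] in simp)
      then show "integrable M (\<lambda>\<omega>. \<Prod>i<j. z ^ \<xi> n i \<omega>)"
        by (intro integrable_const_bound[of _ 1, OF AE_I2 indep_var_rv2[OF iv]]) simp
    qed
    finally show ?thesis unfolding expectation_power_sum_of_families[OF gw z] .
  qed
  have 1: "(\<lambda>j. \<integral>\<omega>. indicator {\<omega>'. ?G \<omega>' = j} \<omega> * z ^ galton_watson \<xi> (Suc n) \<omega> \<partial>M)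
      sums (\<integral>\<omega>. z ^ galton_watson \<xi> (Suc n) \<omega> \<partial>M)"
    by (rule expectation_sums_over_values[OF prob_space_axioms mg measurable_compose[OF mg pw]
          abs_power_le_1[OF z]])
  have 2: "(\<lambda>j. \<integral>\<omega>. indicator {\<omega>'. ?G \<omega>' = j} \<omega> * pgf p z ^ ?G \<omega> \<partial>M)
      sums (\<integral>\<omega>. pgf p z ^ ?G \<omega> \<partial>M)"
    by (rule expectation_sums_over_values[OF prob_space_axioms mg measurable_compose[OF mg pw]
          abs_power_le_1[OF pgf_bounds[OF z]]])
  have 3: "(\<integral>\<omega>. indicator {\<omega>'. ?G \<omega>' = j} \<omega> * pgf p z ^ ?G \<omega> \<partial>M)
      = (\<integral>\<omega>. indicator {\<omega>'. ?G \<omega>' = j} \<omega> \<partial>M) * pgf p z ^ j" for j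
  proof -
    have "(\<integral>\<omega>. indicator {\<omega>'. ?G \<omega>' = j} \<omega> * pgf p z ^ ?G \<omega> \<partial>M)
        = (\<integral>\<omega>. indicator {\<omega>'. ?G \<omega>' = j} \<omega> * pgf p z ^ j \<partial>M)"
      by (rule Bochner_Integration.integral_cong[OF refl]) (simp add: indicator_def)
    then show ?thesis by (simp only: Bochner_Integration.integral_mult_left_zero)
  qed
  show ?thesis using 1 2 unfolding key 3 by (rule sums_unique2)
qed

lemma expectation_power_galton_watson:
  assumes gw: "iid_family_sizes M p \<xi>" and z: "0 \<le> z" "z \<le> 1"
  shows "(\<integral>\<omega>. z ^ galton_watson \<xi> n \<omega> \<partial>M) = (pgf p ^^ n) z"
  using z
proof (induction n arbitrary: z)
  case 0
  interpret prob_space M using gw by (simp add: iid_family_sizes_def)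
  show ?case by (simp add: prob_space)
next
  case (Suc n)
  then show ?case
    unfolding expectation_power_galton_watson_Suc[OF gw Suc.prems] funpow_Suc_right o_def
    by (intro Suc.IH pgf_bounds)
qed

section \<open>Rescaled measures as weighted sums\<close>

lemma sets_point_masses: "sets (point_masses J w x) = sets pos_borel"
  by (simp add: point_masses_def)

lemma measurable_point_map:
  assumes "\<And>j. j \<in> J \<Longrightarrow> 0 < x j"
  shows "x \<in> density (count_space J) w \<rightarrow>\<^sub>M pos_borel"
  using assms by (auto simp: measurable_def space_pos_borel)

lemma nn_integral_point_masses:
  assumes x: "\<And>j. j \<in> J \<Longrightarrow> 0 < x j" and f: "f \<in> borel_measurable borel"
  shows "(\<integral>\<^sup>+y. f y \<partial>point_masses J w x) = (\<integral>\<^sup>+j. ennreal (w j) * f (x j) \<partial>count_space J)"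
proof -
  have "f \<in> borel_measurable pos_borel" by (rule measurable_pos_borel[OF refl f])
  then have "(\<integral>\<^sup>+y. f y \<partial>point_masses J w x) = (\<integral>\<^sup>+j. f (x j) \<partial>density (count_space J) (\<lambda>j. ennreal (w j)))"
    unfolding point_masses_def by (subst nn_integral_distr[OF measurable_point_map[OF x]]) simp_all
  also have "\<dots> = (\<integral>\<^sup>+j. ennreal (w j) * f (x j) \<partial>count_space J)"
    by (rule nn_integral_density) simp_all
  finally show ?thesis .
qed

lemma levy_measure_point_masses:
  assumes x: "\<And>j. j \<in> J \<Longrightarrow> 0 < x j" and w: "\<And>j. j \<in> J \<Longrightarrow> 0 \<le> w j" "integrable (count_space J) w"
  shows "levy_measure (point_masses J w x)"
  unfolding levy_measure_def
proof
  have "(\<integral>\<^sup>+y. ennreal (min y 1) \<partial>point_masses J w x) = (\<integral>\<^sup>+j. ennreal (w j) * ennreal (min (x j) 1) \<partial>count_space J)"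
    by (rule nn_integral_point_masses[OF x]) auto
  also have "\<dots> \<le> (\<integral>\<^sup>+j. ennreal (w j) \<partial>count_space J)"
  proof (rule nn_integral_mono)
    fix j
    have "ennreal (w j) * ennreal (min (x j) 1) \<le> ennreal (w j) * 1"
      by (intro mult_left_mono) (auto simp: ennreal_le_1)
    then show "ennreal (w j) * ennreal (min (x j) 1) \<le> ennreal (w j)" by simp
  qed
  also have "\<dots> = ennreal (\<integral>j. w j \<partial>count_space J)"
    by (rule nn_integral_eq_integral[OF w(2)]) (auto simp: w(1) AE_count_space)
  also have "\<dots> < \<infinity>" by simp
  finally show "(\<integral>\<^sup>+y. ennreal (min y 1) \<partial>point_masses J w x) < \<infinity>" .
qed (rule sets_point_masses)

lemma integral_min1_point_masses:
  fixes g :: "ennreal \<Rightarrow> real"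
  assumes x: "\<And>j. j \<in> J \<Longrightarrow> 0 < x j" and w: "\<And>j. j \<in> J \<Longrightarrow> 0 \<le> w j" and g: "g \<in> borel_measurable borel"
  shows "(\<integral>y. g y \<partial>min1_measure (point_masses J w x))
    = (\<integral>j. w j * (min (x j) 1 * g (ennreal (x j))) \<partial>count_space J)"
proof -
  have "(\<lambda>y::real. min y 1 * g (ennreal y)) \<in> borel_measurable borel"
    using g by measurable
  then have m: "(\<lambda>y::real. min y 1 * g (ennreal y)) \<in> borel_measurable pos_borel"
    by (rule measurable_pos_borel[OF refl])
  have "(\<integral>y. g y \<partial>min1_measure (point_masses J w x)) = (\<integral>y. min y 1 * g (ennreal y) \<partial>point_masses J w x)"
    by (rule integral_min1_measure[OF sets_point_masses g])
  also have "\<dots> = (\<integral>j. min (x j) 1 * g (ennreal (x j)) \<partial>density (count_space J) (\<lambda>j. ennreal (w j)))"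
    unfolding point_masses_def by (rule integral_distr[OF measurable_point_map[OF x] m])
  also have "\<dots> = (\<integral>j. w j * (min (x j) 1 * g (ennreal (x j))) \<partial>count_space J)"
    by (subst integral_density) (auto simp: w AE_count_space)
  finally show ?thesis .
qed

lemma integral_count_space_sums:
  fixes f :: "nat \<Rightarrow> real"
  assumes "\<And>j. j \<notin> J \<Longrightarrow> f j = 0" "\<And>j. 0 \<le> f j" "f sums s"
  shows "(\<integral>j. f j \<partial>count_space J) = s"
proof -
  have J: "count_space J = restrict_space (count_space UNIV) J" by (simp add: restrict_count_space)
  have f: "(\<lambda>j. indicator J j *\<^sub>R f j) = f" using assms(1) by (auto simp: indicator_def fun_eq_iff)
  have "integrable (count_space UNIV) f"
    using assms(2,3) by (simp add: integrable_count_space_nat_iff sums_iff)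
  moreover have "(\<integral>j. f j \<partial>count_space J) = (\<integral>j. f j \<partial>count_space UNIV)"
    unfolding J by (subst integral_restrict_space) (simp_all only: f, simp)
  ultimately show ?thesis using assms(3) integral_count_space_nat[of f] by (simp add: sums_iff)
qed

subsection \<open>The rescaled population\<close>

text \<open>The Laplace exponent \<open>\<integral>(1 - e\<^sup>-\<^sup>q\<^sup>x) d\<nu>\<^sub>n\<^sup>h(x)\<close> of the rescaled population, written with the iterates of the
  generating function.\<close>

definition discrete_flow :: "nat pmf \<Rightarrow> real \<Rightarrow> nat \<Rightarrow> real \<Rightarrow> real" where
  "discrete_flow p h n q = (1 - (pgf p ^^ n) (exp (- q * h))) / h"

lemma prob_galton_watson_sums:
  assumes gw: "iid_family_sizes M p \<xi>" and z: "0 \<le> z" "z \<le> 1"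
  shows "(\<lambda>j. \<P>(\<omega> in M. galton_watson \<xi> n \<omega> = j) * z ^ j) sums (pgf p ^^ n) z"
proof -
  interpret prob_space M using gw by (simp add: iid_family_sizes_def)
  note m = measurable_galton_watson_iid(2)[OF gw]
  have "(\<lambda>j. \<integral>\<omega>. indicator {\<omega>'. galton_watson \<xi> n \<omega>' = j} \<omega> * z ^ galton_watson \<xi> n \<omega> \<partial>M)
      sums (pgf p ^^ n) z"
    unfolding expectation_power_galton_watson[OF gw z, symmetric]
    by (rule expectation_sums_over_values[OF prob_space_axioms m])
       (use z measurable_compose[OF m, of "\<lambda>k. z ^ k"] in \<open>auto simp: power_le_one\<close>)
  moreover have "(\<integral>\<omega>. indicator {\<omega>'. galton_watson \<xi> n \<omega>' = j} \<omega> * z ^ galton_watson \<xi> n \<omega> \<partial>M)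
      = \<P>(\<omega> in M. galton_watson \<xi> n \<omega> = j) * z ^ j" for j
  proof -
    let ?A = "{\<omega> \<in> space M. galton_watson \<xi> n \<omega> = j}"
    have "?A = galton_watson \<xi> n -` {j} \<inter> space M" by auto
    then have A: "?A \<in> sets M" using measurable_sets[OF m, of "{j}"] by simp
    have "(\<integral>\<omega>. indicator {\<omega>'. galton_watson \<xi> n \<omega>' = j} \<omega> * z ^ galton_watson \<xi> n \<omega> \<partial>M)
        = (\<integral>\<omega>. indicator ?A \<omega> * z ^ j \<partial>M)"
      by (intro Bochner_Integration.integral_cong) (auto simp: indicator_def)
    also have "\<dots> = \<P>(\<omega> in M. galton_watson \<xi> n \<omega> = j) * z ^ j" using A by simp
    finally show ?thesis .
  qed
  ultimately show ?thesis by simp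
qed

lemma levy_measure_rescaled_population:
  assumes gw: "iid_family_sizes M p \<xi>" and h: "0 < h"
  shows "levy_measure (rescaled_population_measure M \<xi> h n)"
  unfolding rescaled_population_measure_def
proof (rule levy_measure_point_masses)
  let ?w = "\<lambda>j. 1 / h * \<P>(\<omega> in M. galton_watson \<xi> n \<omega> = j)"
  have "(\<lambda>j. 1 / h * (\<P>(\<omega> in M. galton_watson \<xi> n \<omega> = j) * 1 ^ j)) sums (1 / h * (pgf p ^^ n) 1)"
    by (intro sums_mult prob_galton_watson_sums[OF gw]) auto
  then have "summable ?w" by (simp add: sums_iff)
  then have "integrable (count_space UNIV) ?w"
    using h by (simp add: integrable_count_space_nat_iff)
  then have "integrable (count_space UNIV) (\<lambda>j. indicator {1..} j *\<^sub>R ?w j)"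
    by (intro integrable_mult_indicator) auto
  then show "integrable (count_space {1..}) ?w"
    by (subst restrict_count_space[of UNIV, simplified, symmetric], subst integrable_restrict_space) simp_all
qed (use h in auto)

lemma integral_bernstein_test_population:
  assumes gw: "iid_family_sizes M p \<xi>" and h: "0 < h" and q: "0 < q"
  shows "(\<integral>y. bernstein_test q y \<partial>min1_measure (rescaled_population_measure M \<xi> h n)) = discrete_flow p h n q"
proof -
  let ?P = "\<lambda>j. \<P>(\<omega> in M. galton_watson \<xi> n \<omega> = j)" and ?z = "exp (- q * h)"
  have z: "0 \<le> ?z" "?z \<le> 1" using q h by auto
  have "(\<integral>y. bernstein_test q y \<partial>min1_measure (rescaled_population_measure M \<xi> h n))
    = (\<integral>j. 1 / h * ?P j * (min (real j * h) 1 * bernstein_test q (ennreal (real j * h))) \<partial>count_space {1..})"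
    unfolding rescaled_population_measure_def using h q
    by (intro integral_min1_point_masses borel_measurable_continuous_ennreal continuous_bernstein_test) auto
  also have "\<dots> = (\<integral>j. 1 / h * (?P j * 1 ^ j - ?P j * ?z ^ j) \<partial>count_space {1..})"
  proof (rule Bochner_Integration.integral_cong[OF refl])
    fix j :: nat assume "j \<in> space (count_space {1..})"
    then have j: "0 < real j * h" using h by simp
    have ez: "exp (- q * (real j * h)) = ?z ^ j" by (simp add: exp_of_nat_mult[symmetric] mult_ac)
    then show "1 / h * ?P j * (min (real j * h) 1 * bernstein_test q (ennreal (real j * h)))
      = 1 / h * (?P j * 1 ^ j - ?P j * ?z ^ j)"
      unfolding min1_bernstein_test[OF j] ez by (simp add: right_diff_distrib diff_divide_distrib)
  qed
  also have "\<dots> = 1 / h * ((pgf p ^^ n) 1 - (pgf p ^^ n) ?z)"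
  proof (rule integral_count_space_sums)
    show "(\<lambda>j. 1 / h * (?P j * 1 ^ j - ?P j * ?z ^ j)) sums (1 / h * ((pgf p ^^ n) 1 - (pgf p ^^ n) ?z))"
      using z by (intro sums_mult sums_diff prob_galton_watson_sums[OF gw]) auto
    show "0 \<le> 1 / h * (?P j * 1 ^ j - ?P j * ?z ^ j)" for j
      using h mult_left_mono[OF power_le_one[OF z, of j], of "?P j"] by simp
  qed (auto simp: not_le)
  also have "(pgf p ^^ n) 1 = 1"
  proof -
    have "pgf p 1 = 1" using sums_unique2[OF pgf_sums[of 1 p]] pmf_nat_sums_1[of p] by simp
    then show ?thesis by (induction n) auto
  qed
  finally show ?thesis by (simp add: discrete_flow_def)
qed

subsection \<open>The rescaled family sizes\<close>

text \<open>The weights of \<open>(x \<and> 1) d\<mu>(x)\<close> for the rescaled family-size measure \<open>\<mu>\<close>.\<close>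

definition family_weight :: "nat pmf \<Rightarrow> real \<Rightarrow> real \<Rightarrow> nat \<Rightarrow> real" where
  "family_weight p h \<tau> j = 1 / \<tau> * ((real j - 1) * pmf p j) * min (real j * h) 1"

text \<open>Both the family measure and the discrete mechanism are integrals against these weights, which makes them
  comparable term by term.\<close>

definition family_integral :: "nat pmf \<Rightarrow> real \<Rightarrow> real \<Rightarrow> (nat \<Rightarrow> real) \<Rightarrow> real" where
  "family_integral p h \<tau> f = (\<integral>j. family_weight p h \<tau> j * f j \<partial>count_space {2..})"

lemma family_weight_nonneg: "0 < h \<Longrightarrow> 0 < \<tau> \<Longrightarrow> 2 \<le> j \<Longrightarrow> 0 \<le> family_weight p h \<tau> j"
  by (simp add: family_weight_def)

lemma summable_family:
  assumes "(\<lambda>j. real j * pmf p j) sums 1"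
  shows "integrable (count_space {2..}) (\<lambda>j. 1 / \<tau> * ((real j - 1) * pmf p j))"
proof -
  have "summable (\<lambda>j. real j * pmf p j + pmf p j)"
    by (intro summable_add sums_summable[OF assms] sums_summable[OF pmf_nat_sums_1])
  then have "summable (\<lambda>j. \<bar>(real j - 1) * pmf p j\<bar>)"
  proof (rule summable_comparison_test')
    fix j
    have "\<bar>real j - 1\<bar> * pmf p j \<le> (real j + 1) * pmf p j" by (intro mult_right_mono) auto
    then show "norm \<bar>(real j - 1) * pmf p j\<bar> \<le> real j * pmf p j + pmf p j"
      by (simp add: abs_mult distrib_right)
  qed
  then have "integrable (count_space UNIV) (\<lambda>j. 1 / \<tau> * ((real j - 1) * pmf p j))"
    by (intro integrable_mult_right) (simp add: integrable_count_space_nat_iff)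
  then have "integrable (count_space UNIV) (\<lambda>j. indicator {2..} j *\<^sub>R (1 / \<tau> * ((real j - 1) * pmf p j)))"
    by (intro integrable_mult_indicator) auto
  then show ?thesis
    by (subst restrict_count_space[of UNIV, simplified, symmetric], subst integrable_restrict_space) simp_all
qed

lemma levy_measure_rescaled_family:
  assumes "(\<lambda>j. real j * pmf p j) sums 1" "0 < h" "0 < \<tau>"
  shows "levy_measure (rescaled_family_measure p h \<tau>)"
  unfolding rescaled_family_measure_def
  by (rule levy_measure_point_masses) (use assms summable_family in auto)

lemma integral_rescaled_family:
  assumes "0 < h" "0 < \<tau>" "continuous_on UNIV g"
  shows "(\<integral>y. g y \<partial>min1_measure (rescaled_family_measure p h \<tau>))
    = family_integral p h \<tau> (\<lambda>j. g (ennreal (real j * h)))"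
  unfolding rescaled_family_measure_def family_integral_def
  using assms by (subst integral_min1_point_masses)
    (auto simp: family_weight_def mult.assoc intro: borel_measurable_continuous_ennreal)

lemma integrable_family:
  assumes mean: "(\<lambda>j. real j * pmf p j) sums 1" and h: "0 < h" and \<tau>: "0 < \<tau>"
    and f: "\<And>j. 2 \<le> j \<Longrightarrow> \<bar>f j\<bar> \<le> B"
  shows "integrable (count_space {2..}) (\<lambda>j. family_weight p h \<tau> j * f j)"
proof (rule Bochner_Integration.integrable_bound)
  show "integrable (count_space {2..}) (\<lambda>j. B * (1 / \<tau> * ((real j - 1) * pmf p j)))"
    by (intro integrable_mult_right summable_family mean)
  show "AE j in count_space {2..}. norm (family_weight p h \<tau> j * f j)
      \<le> norm (B * (1 / \<tau> * ((real j - 1) * pmf p j)))"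
  proof (clarsimp simp only: AE_count_space atLeast_iff real_norm_def)
    fix j :: nat assume j: "2 \<le> j"
    let ?w = "1 / \<tau> * ((real j - 1) * pmf p j)"
    have w: "0 \<le> ?w" using \<tau> j by simp
    have "\<bar>family_weight p h \<tau> j * f j\<bar> = ?w * (min (real j * h) 1 * \<bar>f j\<bar>)"
    proof -
      have "0 \<le> ?w * min (real j * h) 1" using h by (intro mult_nonneg_nonneg[OF w]) simp
      then show ?thesis unfolding family_weight_def abs_mult[of _ "f j"] by (simp only: abs_of_nonneg mult.assoc)
    qed
    also have "\<dots> \<le> ?w * (1 * B)"
      using f[OF j] h by (intro mult_left_mono[OF _ w] mult_mono) auto
    also have "\<dots> = B * ?w" by (simp only: mult_1_left mult.commute)
    also have "\<dots> \<le> \<bar>B * ?w\<bar>" by (rule abs_ge_self)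
    finally show "\<bar>family_weight p h \<tau> j * f j\<bar> \<le> \<bar>B * ?w\<bar>" .
  qed
qed simp

lemma family_integral_mono:
  assumes fam: "(\<lambda>j. real j * pmf p j) sums 1" "0 < h" "0 < \<tau>"
    and f: "\<And>j. 2 \<le> j \<Longrightarrow> \<bar>f j\<bar> \<le> B" and g: "\<And>j. 2 \<le> j \<Longrightarrow> \<bar>g j\<bar> \<le> B'"
    and le: "\<And>j. 2 \<le> j \<Longrightarrow> f j \<le> g j"
  shows "family_integral p h \<tau> f \<le> family_integral p h \<tau> g"
  unfolding family_integral_def
  by (rule integral_mono[OF integrable_family[OF fam f] integrable_family[OF fam g]])
     (use family_weight_nonneg[OF fam(2,3)] le in \<open>auto intro: mult_left_mono\<close>)

lemma family_integral_cmult: "family_integral p h \<tau> (\<lambda>j. c * f j) = c * family_integral p h \<tau> f"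
  unfolding family_integral_def
  by (subst Bochner_Integration.integral_mult_right_zero[symmetric]) (simp add: mult_ac)

lemma family_integral_const: "family_integral p h \<tau> (\<lambda>j. c) = c * family_integral p h \<tau> (\<lambda>_. 1)"
  using family_integral_cmult[of p h \<tau> c "\<lambda>_. 1"] by simp

lemma family_integral_diff_le:
  assumes fam: "(\<lambda>j. real j * pmf p j) sums 1" "0 < h" "0 < \<tau>"
    and f: "\<And>j. 2 \<le> j \<Longrightarrow> \<bar>f j\<bar> \<le> B" and g: "\<And>j. 2 \<le> j \<Longrightarrow> \<bar>g j\<bar> \<le> B'"
    and e: "\<And>j. 2 \<le> j \<Longrightarrow> \<bar>f j - g j\<bar> \<le> e"
  shows "\<bar>family_integral p h \<tau> f - family_integral p h \<tau> g\<bar> \<le> e * family_integral p h \<tau> (\<lambda>_. 1)"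
proof -
  have "family_integral p h \<tau> f - family_integral p h \<tau> g
      = (\<integral>j. family_weight p h \<tau> j * f j - family_weight p h \<tau> j * g j \<partial>count_space {2..})"
    unfolding family_integral_def
    by (rule Bochner_Integration.integral_diff[symmetric])
       (rule integrable_family[OF fam f], assumption, rule integrable_family[OF fam g], assumption)
  also have "\<dots> = family_integral p h \<tau> (\<lambda>j. f j - g j)"
    unfolding family_integral_def by (simp add: right_diff_distrib)
  finally have eq: "family_integral p h \<tau> f - family_integral p h \<tau> g = family_integral p h \<tau> (\<lambda>j. f j - g j)" .
  have "family_integral p h \<tau> (\<lambda>j. f j - g j) \<le> family_integral p h \<tau> (\<lambda>_. e)"
    by (rule family_integral_mono[OF fam, where B = e and B' = "\<bar>e\<bar>"]) (use e abs_le_D1 abs_ge_self in \<open>auto intro: order_trans\<close>)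
  moreover have "family_integral p h \<tau> (\<lambda>_. - e) \<le> family_integral p h \<tau> (\<lambda>j. f j - g j)"
    by (rule family_integral_mono[OF fam, where B = "\<bar>e\<bar>" and B' = e])
       (use e abs_le_D2 in \<open>force+\<close>)
  ultimately show ?thesis
    unfolding eq using family_integral_const[of p h \<tau> e] family_integral_const[of p h \<tau> "- e"]
    by (simp add: abs_le_iff minus_le_iff)
qed

section \<open>The discrete branching mechanism\<close>

text \<open>The remainder \<open>(1 - u)\<^sup>j - 1 + j u\<close> is the discrete counterpart of \<open>e\<^sup>-\<^sup>v - 1 + v\<close>.\<close>

definition bernoulli_remainder :: "nat \<Rightarrow> real \<Rightarrow> real" where
  "bernoulli_remainder j u = (1 - u) ^ j - 1 + real j * u"

lemma bernoulli_remainder_Suc: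
  "bernoulli_remainder (Suc j) u = (1 - u) * bernoulli_remainder j u + real j * u\<^sup>2"
  by (simp add: bernoulli_remainder_def algebra_simps power2_eq_square)

lemma bernoulli_remainder_nonneg:
  assumes "0 \<le> u" "u \<le> 1" shows "0 \<le> bernoulli_remainder j u"
proof (induction j)
  case (Suc j)
  then show ?case using assms by (simp add: bernoulli_remainder_Suc)
qed (simp add: bernoulli_remainder_def)

lemma bernoulli_remainder_le_linear:
  assumes "0 \<le> u" "u \<le> 1" shows "bernoulli_remainder j u \<le> real j * u"
  using assms power_le_one[of "1 - u" j] by (simp add: bernoulli_remainder_def)

lemma bernoulli_remainder_le_quadratic:
  assumes "0 \<le> u" "u \<le> 1"
  shows "bernoulli_remainder j u \<le> real j * (real j - 1) / 2 * u\<^sup>2"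
proof (induction j)
  case (Suc j)
  have "(1 - u) * bernoulli_remainder j u \<le> 1 * bernoulli_remainder j u"
    using assms bernoulli_remainder_nonneg[OF assms] by (intro mult_right_mono) auto
  with Suc show ?case by (simp add: bernoulli_remainder_Suc algebra_simps)
qed (simp add: bernoulli_remainder_def)

lemma bernoulli_remainder_ge_cubic:
  assumes u: "0 \<le> u" "u \<le> 1"
  shows "real j * (real j - 1) / 2 * u\<^sup>2 - real j * (real j - 1) * (real j - 2) / 6 * u ^ 3 \<le> bernoulli_remainder j u"
proof (induction j)
  case (Suc j)
  have "u * bernoulli_remainder j u \<le> u * (real j * (real j - 1) / 2 * u\<^sup>2)"
    using u bernoulli_remainder_le_quadratic[OF u] by (intro mult_left_mono) auto
  with Suc show ?case
    by (simp add: bernoulli_remainder_Suc field_simps power2_eq_square power3_eq_cube)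
qed (simp add: bernoulli_remainder_def)

lemma power_diff_ge_tangent:
  fixes a b :: real assumes "0 \<le> b" "b \<le> a"
  shows "real j * b ^ (j - 1) * (a - b) \<le> a ^ j - b ^ j"
proof (induction j)
  case (Suc j)
  have "b * (real j * b ^ (j - 1) * (a - b)) \<le> b * (a ^ j - b ^ j)"
    using Suc assms by (intro mult_left_mono) auto
  also have "\<dots> \<le> a * (a ^ j - b ^ j)"
    using assms by (intro mult_right_mono) (auto intro: power_mono)
  finally have "b * (real j * b ^ (j - 1) * (a - b)) \<le> a * (a ^ j - b ^ j)" .
  moreover have "b * (real j * b ^ (j - 1) * (a - b)) = real j * b ^ j * (a - b)"
    by (cases j) (simp_all add: mult_ac)
  ultimately show ?case by (simp add: algebra_simps)
qed simp

lemma bernoulli_remainder_increment: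
  assumes u: "0 \<le> u" "u \<le> v" "v \<le> 1" and j: "2 \<le> j"
  shows "bernoulli_remainder j u \<le> bernoulli_remainder j v"
    and "bernoulli_remainder j v - bernoulli_remainder j u \<le> real j * (v - u) * min 1 ((real j - 1) * v)"
proof -
  have t: "real j * (1 - v) ^ (j - 1) * (v - u) \<le> (1 - u) ^ j - (1 - v) ^ j"
    using power_diff_ge_tangent[of "1 - v" "1 - u" j] u by simp
  have "\<bar>(1 - u) ^ j - (1 - v) ^ j\<bar> \<le> real j * \<bar>(1 - u) - (1 - v)\<bar>"
    using norm_power_diff[of "1 - u" "1 - v" j] u by simp
  then show "bernoulli_remainder j u \<le> bernoulli_remainder j v"
    using u by (simp add: bernoulli_remainder_def algebra_simps)
  have d: "bernoulli_remainder j v - bernoulli_remainder j u \<le> real j * (v - u) * (1 - (1 - v) ^ (j - 1))"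
    using t by (simp add: bernoulli_remainder_def algebra_simps)
  have "1 - (1 - v) ^ (j - 1) \<le> min 1 ((real j - 1) * v)"
    using bernoulli_remainder_nonneg[of v "j - 1"] u j
    by (auto simp: bernoulli_remainder_def of_nat_diff)
  then have "real j * (v - u) * (1 - (1 - v) ^ (j - 1)) \<le> real j * (v - u) * min 1 ((real j - 1) * v)"
    using u by (intro mult_left_mono) auto
  with d show "bernoulli_remainder j v - bernoulli_remainder j u \<le> real j * (v - u) * min 1 ((real j - 1) * v)"
    by linarith
qed

text \<open>The discrete mechanism is the integral of this kernel against the family weights; it is the discrete
  counterpart of \<open>branching_test s (j h)\<close>.\<close>

definition discrete_kernel :: "real \<Rightarrow> real \<Rightarrow> nat \<Rightarrow> real" where
  "discrete_kernel h s j = bernoulli_remainder j (h * s) / ((real j - 1) * h * min (real j * h) 1)"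

text \<open>With \<open>z = 1 - h s\<close> one has \<open>(1 - G(z)) / h = s - \<tau> \<Psi>\<^sub>k(s)\<close>, so a generation of the process is an Euler step
  of length \<open>\<tau>\<close> for \<open>s' = - \<Psi>\<^sub>k(s)\<close>.\<close>

definition discrete_mechanism :: "nat pmf \<Rightarrow> real \<Rightarrow> real \<Rightarrow> real \<Rightarrow> real" where
  "discrete_mechanism p h \<tau> s = (pgf p (1 - h * s) - (1 - h * s)) / (h * \<tau>)"

lemma discrete_kernel_denominator:
  assumes "0 < h" "2 \<le> j" shows "0 < (real j - 1) * h * min (real j * h) 1"
  using assms by simp

text \<open>The kernel is increasing in \<open>s\<close> and Lipschitz uniformly in \<open>h\<close> and \<open>j\<close>: since \<open>1 - (1 - v)\<^sup>j\<^sup>-\<^sup>1\<close> is at most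
  \<open>1\<close> and at most \<open>(j - 1) v\<close>, the slope compares with \<open>j h \<and> 1\<close>.\<close>

lemma discrete_kernel_increment:
  assumes h: "0 < h" and s: "0 \<le> s" "s \<le> s'" "h * s' \<le> 1" and j: "2 \<le> j"
  shows "discrete_kernel h s j \<le> discrete_kernel h s' j"
    and "discrete_kernel h s' j - discrete_kernel h s j \<le> (2 + s') * (s' - s)"
proof -
  let ?D = "(real j - 1) * h * min (real j * h) 1"
  have D: "0 < ?D" by (rule discrete_kernel_denominator[OF h j])
  have u: "0 \<le> h * s" "h * s \<le> h * s'" using h s by auto
  note inc = bernoulli_remainder_increment[OF u s(3) j]
  show "discrete_kernel h s j \<le> discrete_kernel h s' j"
    unfolding discrete_kernel_def using inc(1) D by (intro divide_right_mono) auto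
  have J: "real j \<le> 2 * (real j - 1)" using j by simp
  have "real j * min 1 ((real j - 1) * (h * s')) \<le> (2 + s') * ((real j - 1) * min (real j * h) 1)"
  proof (cases "real j * h \<ge> 1")
    case True
    have "real j * min 1 ((real j - 1) * (h * s')) \<le> real j * 1"
      by (intro mult_left_mono) auto
    also have "\<dots> \<le> 2 * (real j - 1)" using J by simp
    also have "\<dots> \<le> (2 + s') * (real j - 1)" using j s by (intro mult_right_mono) auto
    finally show ?thesis using True by simp
  next
    case False
    have "real j * min 1 ((real j - 1) * (h * s')) \<le> real j * ((real j - 1) * (h * s'))"
      by (intro mult_left_mono) auto
    also have "\<dots> = s' * ((real j - 1) * (real j * h))" by (simp add: mult_ac)
    also have "\<dots> \<le> (2 + s') * ((real j - 1) * (real j * h))"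
      using j h by (intro mult_right_mono) auto
    finally show ?thesis using False by simp
  qed
  then have "h * (s' - s) * (real j * min 1 ((real j - 1) * (h * s')))
      \<le> h * (s' - s) * ((2 + s') * ((real j - 1) * min (real j * h) 1))"
    using h s by (intro mult_left_mono) auto
  then have "bernoulli_remainder j (h * s') - bernoulli_remainder j (h * s) \<le> (2 + s') * (s' - s) * ?D"
  proof -
    have e1: "real j * (h * s' - h * s) * m = h * (s' - s) * (real j * m)" for m
      by (simp add: algebra_simps)
    have e2: "h * (s' - s) * ((2 + s') * ((real j - 1) * c)) = (2 + s') * (s' - s) * ((real j - 1) * h * c)" for c
      by (simp only: mult_ac)
    show ?thesis
      using inc(2) \<open>h * (s' - s) * _ \<le> h * (s' - s) * _\<close> unfolding e1 e2 by (rule order_trans)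
  qed
  then show "discrete_kernel h s' j - discrete_kernel h s j \<le> (2 + s') * (s' - s)"
    unfolding discrete_kernel_def diff_divide_distrib[symmetric] using D by (simp add: pos_divide_le_eq)
qed

lemma discrete_kernel_0 [simp]: "discrete_kernel h 0 j = 0"
  by (simp add: discrete_kernel_def bernoulli_remainder_def)

lemma discrete_kernel_bounds:
  assumes "0 < h" "0 \<le> s" "h * s \<le> 1" "2 \<le> j"
  shows "\<bar>discrete_kernel h s j\<bar> \<le> (2 + s) * s"
  using discrete_kernel_increment[of h 0 s j] assms by auto

text \<open>Points \<open>x = j h\<close> below \<open>d\<close> are treated by Taylor expansion to third order, which makes the
  kernel and its limit both close to \<open>s\<^sup>2 / 2\<close>; above \<open>d\<close> the factor \<open>h / d\<^sup>2 \<le> d\<close> is small.\<close>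

lemma discrete_kernel_close_to_branching_test:
  assumes h: "0 < h" "h \<le> d ^ 3" and d: "0 < d" "d \<le> 1" and s: "0 \<le> s" "h * s \<le> 1" and j: "2 \<le> j"
  shows "\<bar>discrete_kernel h s j - branching_test s (ennreal (real j * h))\<bar> \<le> d * (s ^ 3 + 2 * s + s\<^sup>2)"
proof -
  define J x u where "J = real j" and "x = J * h" and "u = h * s"
  let ?A = "bernoulli_remainder j u" and ?B = "exp (- s * x) - 1 + s * x"
  have J: "2 \<le> J" and x: "0 < x" and u: "0 \<le> u" "u \<le> 1" and Ju: "J * u = s * x"
    using j h s by (auto simp: J_def x_def u_def)
  have K: "discrete_kernel h s j = ?A / ((J - 1) * h * min x 1)"
    by (simp add: discrete_kernel_def u_def J_def x_def)
  have g: "branching_test s (ennreal (real j * h)) = ?B / (x * min x 1)"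
    using x unfolding J_def[symmetric] x_def[symmetric] by (simp add: branching_test_pos_real)
  show ?thesis
  proof (cases "x \<le> d")
    case True
    then have m: "min x 1 = x" using d by simp
    have D1: "0 < (J - 1) * h * x" and D2: "0 < x * x" using J x h by auto
    have sx: "s ^ 3 * x \<le> s ^ 3 * d" using True s by (intro mult_left_mono) auto
    have "?A \<le> s\<^sup>2 / 2 * ((J - 1) * h * x)"
      using bernoulli_remainder_le_quadratic[OF u, of j] unfolding J_def[symmetric]
      by (simp add: u_def x_def algebra_simps power2_eq_square)
    then have K1: "discrete_kernel h s j \<le> s\<^sup>2 / 2" unfolding K m using D1 by (simp add: pos_divide_le_eq)
    have "(s\<^sup>2 / 2 - s ^ 3 * ((J - 2) * h) / 6) * ((J - 1) * h * x) \<le> ?A"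
      using bernoulli_remainder_ge_cubic[OF u, of j] unfolding J_def[symmetric]
      by (simp add: u_def x_def algebra_simps power2_eq_square power3_eq_cube)
    then have "s\<^sup>2 / 2 - s ^ 3 * ((J - 2) * h) / 6 \<le> discrete_kernel h s j"
      unfolding K m using D1 by (simp add: pos_le_divide_eq)
    moreover have "s ^ 3 * ((J - 2) * h) \<le> s ^ 3 * x"
      using h s by (intro mult_left_mono) (auto simp: x_def)
    ultimately have K2: "s\<^sup>2 / 2 - s ^ 3 * d / 6 \<le> discrete_kernel h s j" using sx by linarith
    have "?B \<le> s\<^sup>2 / 2 * (x * x)"
      using exp_minus_le_quadratic[of "s * x"] s x by (simp add: algebra_simps power2_eq_square)
    then have g1: "?B / (x * min x 1) \<le> s\<^sup>2 / 2" unfolding m using D2 by (simp add: pos_divide_le_eq)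
    have "(s\<^sup>2 / 2 - s ^ 3 * x / 6) * (x * x) \<le> ?B"
      using exp_minus_ge_cubic[of "s * x"] s x by (simp add: algebra_simps power2_eq_square power3_eq_cube)
    then have "s\<^sup>2 / 2 - s ^ 3 * x / 6 \<le> ?B / (x * min x 1)" unfolding m using D2 by (simp add: pos_le_divide_eq)
    then have g2: "s\<^sup>2 / 2 - s ^ 3 * d / 6 \<le> ?B / (x * min x 1)" using sx by linarith
    have "s ^ 3 * d / 6 \<le> d * (s ^ 3 + 2 * s + s\<^sup>2)"
      using s d by (simp add: distrib_left)
    then show ?thesis unfolding g using K1 K2 g1 g2 by linarith
  next
    case False
    then have m: "d \<le> min x 1" using d by simp
    have A: "0 \<le> ?A" "?A \<le> s * x"
      using bernoulli_remainder_nonneg[OF u, of j] bernoulli_remainder_le_linear[OF u, of j] Ju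
      by (auto simp: J_def)
    have JJ: "1 / (J - 1) \<le> 2 / J" using J by (simp add: field_simps)
    have "?A / ((J - 1) * h) - ?A / (J * h) = ?A / x * (1 / (J - 1))"
      using J h by (simp add: x_def field_simps)
    also have "\<dots> \<le> s * (2 / J)"
      using A x J s JJ by (intro mult_mono) (auto simp: field_simps)
    also have "\<dots> = 2 * s * (h / x)" using h J by (simp add: x_def)
    also have "\<dots> \<le> 2 * s * (d ^ 3 / d)"
      using False h d s x by (intro mult_left_mono frac_le) auto
    also have "\<dots> = 2 * s * (d * d)" using d by (simp add: power3_eq_cube)
    finally have 1: "?A / ((J - 1) * h) - ?A / (J * h) \<le> 2 * s * (d * d)" .
    have nn: "0 \<le> ?A / ((J - 1) * h) - ?A / (J * h)"
      using A J h by (simp add: field_simps)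
    have "exp (- s * x) = exp (- u) ^ j"
      using Ju by (simp add: exp_of_nat_mult[symmetric] J_def)
    then have "\<bar>?B - ?A\<bar> = \<bar>exp (- u) ^ j - (1 - u) ^ j\<bar>"
      using Ju by (simp add: bernoulli_remainder_def J_def)
    also have "\<dots> \<le> J * \<bar>exp (- u) - (1 - u)\<bar>"
      using norm_power_diff[of "exp (- u)" "1 - u" j] u by (simp add: J_def)
    also have "\<dots> \<le> J * (u\<^sup>2 / 2)"
      using exp_minus_le_quadratic[OF u(1)] exp_minus_nonneg[of u] J
      by (intro mult_left_mono) (auto simp: abs_le_iff)
    finally have "\<bar>?B - ?A\<bar> / (J * h) \<le> J * (u\<^sup>2 / 2) / (J * h)"
      using J h by (intro divide_right_mono) auto
    also have "\<dots> = s\<^sup>2 * h / 2" using J h by (simp add: u_def power2_eq_square)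
    also have "\<dots> \<le> s\<^sup>2 * (d * d) / 2"
    proof -
      have "d ^ 3 \<le> d ^ 2" using d by (intro power_decreasing) auto
      then have "h \<le> d * d" using h(2) unfolding power2_eq_square by linarith
      then show ?thesis by (intro divide_right_mono mult_left_mono) auto
    qed
    finally have 2: "\<bar>?B / x - ?A / (J * h)\<bar> \<le> s\<^sup>2 * (d * d) / 2"
      using x by (simp add: x_def[symmetric] diff_divide_distrib[symmetric] abs_divide)
    have "\<bar>?A / ((J - 1) * h) - ?B / x\<bar> \<le> 2 * s * (d * d) + s\<^sup>2 * (d * d) / 2"
      using 1 nn 2 by linarith
    also have "\<dots> \<le> (2 * s + s\<^sup>2) * d * d"
      using d s by (simp add: algebra_simps)
    finally have 3: "\<bar>?A / ((J - 1) * h) - ?B / x\<bar> \<le> (2 * s + s\<^sup>2) * d * d" .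
    have "\<bar>discrete_kernel h s j - branching_test s (ennreal (real j * h))\<bar> = \<bar>?A / ((J - 1) * h) - ?B / x\<bar> / min x 1"
    proof -
      have "a / (b * c) - e / (x * c) = (a / b - e / x) / c" for a b c e :: real
        by (simp add: diff_divide_distrib)
      moreover have "0 < min x 1" using x by simp
      ultimately show ?thesis unfolding K g by (simp only: abs_divide abs_of_pos)
    qed
    also have "\<dots> \<le> (2 * s + s\<^sup>2) * d * d / d"
      using 3 m d s by (intro frac_le) auto
    also have "\<dots> = (2 * s + s\<^sup>2) * d" using d by simp
    also have "\<dots> \<le> d * (s ^ 3 + 2 * s + s\<^sup>2)" using d s by (simp add: algebra_simps)
    finally show ?thesis .
  qed
qed

text \<open>Criticality enters here: with mean one, \<open>G(1 - u) - (1 - u)\<close> is the expectation of the Bernoulli remainder,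
  whose terms \<open>j = 0\<close> and \<open>j = 1\<close> vanish.\<close>

lemma discrete_mechanism_eq_family_integral:
  assumes mean: "(\<lambda>j. real j * pmf p j) sums 1" and h: "0 < h" and \<tau>: "0 < \<tau>" and s: "0 \<le> s" "h * s \<le> 1"
  shows "discrete_mechanism p h \<tau> s = family_integral p h \<tau> (discrete_kernel h s)"
proof -
  let ?u = "h * s"
  have u: "0 \<le> ?u" "?u \<le> 1" using h s by auto
  have "(\<lambda>j. pmf p j * (1 - ?u) ^ j - pmf p j + real j * pmf p j * ?u) sums (pgf p (1 - ?u) - 1 + 1 * ?u)"
    using u by (intro sums_add sums_diff sums_mult2 pgf_sums mean pmf_nat_sums_1) auto
  then have "(\<lambda>j. 1 / (h * \<tau>) * (pmf p j * (1 - ?u) ^ j - pmf p j + real j * pmf p j * ?u))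
      sums (1 / (h * \<tau>) * (pgf p (1 - ?u) - 1 + 1 * ?u))"
    by (rule sums_mult)
  moreover have "1 / (h * \<tau>) * (pmf p j * (1 - ?u) ^ j - pmf p j + real j * pmf p j * ?u)
      = 1 / (h * \<tau>) * pmf p j * bernoulli_remainder j ?u" for j
  proof -
    have "pmf p j * (1 - ?u) ^ j - pmf p j + real j * pmf p j * ?u = pmf p j * bernoulli_remainder j ?u"
      by (simp add: bernoulli_remainder_def algebra_simps)
    then show ?thesis by simp
  qed
  moreover have "1 / (h * \<tau>) * (pgf p (1 - ?u) - 1 + 1 * ?u) = discrete_mechanism p h \<tau> s"
    by (simp add: discrete_mechanism_def)
  ultimately have S: "(\<lambda>j. 1 / (h * \<tau>) * pmf p j * bernoulli_remainder j ?u) sums discrete_mechanism p h \<tau> s"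
    by (simp only:)
  have "discrete_mechanism p h \<tau> s = (\<integral>j. 1 / (h * \<tau>) * pmf p j * bernoulli_remainder j ?u \<partial>count_space {2..})"
  proof (rule integral_count_space_sums[OF _ _ S, symmetric])
    fix j :: nat assume "j \<notin> {2..}"
    then have "j = 0 \<or> j = 1" by auto
    then show "1 / (h * \<tau>) * pmf p j * bernoulli_remainder j ?u = 0" by (auto simp: bernoulli_remainder_def)
  qed (use bernoulli_remainder_nonneg[OF u] h \<tau> in simp)
  also have "\<dots> = family_integral p h \<tau> (discrete_kernel h s)"
    unfolding family_integral_def
  proof (rule Bochner_Integration.integral_cong[OF refl])
    fix j :: nat assume "j \<in> space (count_space {2..})"
    then have j: "2 \<le> j" by simp
    have "0 < min (real j * h) 1" using j h by simp
    then have "0 < real j - 1" "min (real j * h) 1 \<noteq> 0" using j by linarith+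
    then show "1 / (h * \<tau>) * pmf p j * bernoulli_remainder j ?u = family_weight p h \<tau> j * discrete_kernel h s j"
      using h \<tau> by (simp add: family_weight_def discrete_kernel_def)
  qed
  finally show ?thesis .
qed

lemma discrete_mechanism_increment:
  assumes fam: "(\<lambda>j. real j * pmf p j) sums 1" "0 < h" "0 < \<tau>" and s: "0 \<le> s" "s \<le> s'" "h * s' \<le> 1"
  shows "discrete_mechanism p h \<tau> s \<le> discrete_mechanism p h \<tau> s'"
    and "discrete_mechanism p h \<tau> s' - discrete_mechanism p h \<tau> s \<le> (2 + s') * (s' - s) * family_integral p h \<tau> (\<lambda>_. 1)"
proof -
  have s1: "h * s \<le> 1" using s fam(2) by (meson less_imp_le mult_left_mono order_trans)
  have s': "0 \<le> s'" using s by simp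
  note D = discrete_mechanism_eq_family_integral[OF fam s(1) s1] discrete_mechanism_eq_family_integral[OF fam s' s(3)]
  note b = discrete_kernel_bounds[OF fam(2) s(1) s1] discrete_kernel_bounds[OF fam(2) s' s(3)]
  show "discrete_mechanism p h \<tau> s \<le> discrete_mechanism p h \<tau> s'"
    unfolding D by (rule family_integral_mono[OF fam b discrete_kernel_increment(1)[OF fam(2) s]])
  have "\<bar>family_integral p h \<tau> (discrete_kernel h s') - family_integral p h \<tau> (discrete_kernel h s)\<bar>
      \<le> (2 + s') * (s' - s) * family_integral p h \<tau> (\<lambda>_. 1)"
    by (rule family_integral_diff_le[OF fam b(2) b(1)])
       (use discrete_kernel_increment[OF fam(2) s] in \<open>auto simp: abs_le_iff intro: order_trans[of _ 0]\<close>)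
  then show "discrete_mechanism p h \<tau> s' - discrete_mechanism p h \<tau> s \<le> (2 + s') * (s' - s) * family_integral p h \<tau> (\<lambda>_. 1)"
    unfolding D by linarith
qed

lemma discrete_mechanism_0 [simp]: "discrete_mechanism p h \<tau> 0 = 0"
  using sums_unique2[OF pgf_sums[of 1 p]] pmf_nat_sums_1[of p] by (simp add: discrete_mechanism_def)

lemma discrete_mechanism_nonneg:
  assumes "(\<lambda>j. real j * pmf p j) sums 1" "0 < h" "0 < \<tau>" "0 \<le> s" "h * s \<le> 1"
  shows "0 \<le> discrete_mechanism p h \<tau> s"
  using discrete_mechanism_increment(1)[of p h \<tau> 0 s] assms by simp

lemma discrete_mechanism_close:
  assumes fam: "(\<lambda>j. real j * pmf p j) sums 1" "0 < h" "0 < \<tau>"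
    and h: "h \<le> d ^ 3" and d: "0 < d" "d \<le> 1" and s: "0 \<le> s" "h * s \<le> 1"
  shows "\<bar>discrete_mechanism p h \<tau> s - (\<integral>y. branching_test s y \<partial>min1_measure (rescaled_family_measure p h \<tau>))\<bar>
    \<le> d * (s ^ 3 + 2 * s + s\<^sup>2) * family_integral p h \<tau> (\<lambda>_. 1)"
proof -
  obtain B where B: "\<And>x. \<bar>branching_test s x\<bar> \<le> B"
    using continuous_ennreal_bounded[OF continuous_branching_test[OF s(1)]] by blast
  show ?thesis
    unfolding discrete_mechanism_eq_family_integral[OF fam s]
      integral_rescaled_family[OF fam(2,3) continuous_branching_test[OF s(1)]]
    by (rule family_integral_diff_le[OF fam discrete_kernel_bounds[OF fam(2) s] B
          discrete_kernel_close_to_branching_test[OF fam(2) h d s]])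
qed

subsection \<open>The discrete flow\<close>

lemma discrete_flow_bounds:
  assumes "0 < h" "0 \<le> q"
  shows "0 \<le> discrete_flow p h n q" "h * discrete_flow p h n q \<le> 1"
  using iterated_pgf_bounds[of "exp (- q * h)" n p] assms by (auto simp: discrete_flow_def)

lemma discrete_flow_0: "discrete_flow p h 0 q = (1 - exp (- q * h)) / h"
  by (simp add: discrete_flow_def)

lemma discrete_flow_0_le: "0 < h \<Longrightarrow> 0 \<le> q \<Longrightarrow> discrete_flow p h 0 q \<le> q"
  using one_minus_exp_bounds(2)[of "q * h"] by (simp add: discrete_flow_0 pos_divide_le_eq)

lemma discrete_flow_0_tendsto:
  assumes h: "\<And>k. 0 < h k" "h \<longlonglongrightarrow> 0" and q: "0 \<le> q"
  shows "(\<lambda>k. discrete_flow (p k) (h k) 0 q) \<longlonglongrightarrow> q"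
proof (rule tendsto_sandwich)
  have "q - q\<^sup>2 * h k / 2 \<le> discrete_flow (p k) (h k) 0 q" for k
  proof -
    have "(q - q\<^sup>2 * h k / 2) * h k \<le> 1 - exp (- q * h k)"
      using one_minus_exp_bounds(4)[of "q * h k"] h(1)[of k] q by (simp add: algebra_simps power2_eq_square)
    then show ?thesis unfolding discrete_flow_0 using h(1)[of k] by (simp only: pos_le_divide_eq)
  qed
  then show "\<forall>\<^sub>F k in sequentially. q - q\<^sup>2 * h k / 2 \<le> discrete_flow (p k) (h k) 0 q" by simp
  show "\<forall>\<^sub>F k in sequentially. discrete_flow (p k) (h k) 0 q \<le> q"
    using discrete_flow_0_le[OF h(1) q] by simp
  have "(\<lambda>k. q - q\<^sup>2 * h k / 2) \<longlonglongrightarrow> q - q\<^sup>2 * 0 / 2" by (intro tendsto_intros h(2)) auto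
  then show "(\<lambda>k. q - q\<^sup>2 * h k / 2) \<longlonglongrightarrow> q" by simp
qed simp

lemma discrete_flow_Suc:
  assumes "0 < h" "0 < \<tau>"
  shows "discrete_flow p h (Suc n) q = discrete_flow p h n q - \<tau> * discrete_mechanism p h \<tau> (discrete_flow p h n q)"
  using assms by (simp add: discrete_flow_def discrete_mechanism_def field_simps)

lemma discrete_flow_decreasing:
  fixes \<tau> :: real
  assumes fam: "(\<lambda>j. real j * pmf p j) sums 1" "0 < h" "0 < \<tau>" and q: "0 \<le> q" and "m \<le> n"
  shows "discrete_flow p h n q \<le> discrete_flow p h m q"
  using \<open>m \<le> n\<close>
proof (induction rule: dec_induct)
  case (step n)
  have "0 \<le> discrete_mechanism p h \<tau> (discrete_flow p h n q)"
    by (rule discrete_mechanism_nonneg[OF fam discrete_flow_bounds[OF fam(2) q]])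
  then have "0 \<le> \<tau> * discrete_mechanism p h \<tau> (discrete_flow p h n q)" using fam(3) by simp
  then show ?case unfolding discrete_flow_Suc[OF fam(2,3)] using step.IH by linarith
qed simp

section \<open>The branching mechanism\<close>

text \<open>This is \<open>\<Psi>'\<close> on \<open>(0,\<infinity>)\<close>; it is a Bernstein function of \<open>q\<close> with drift \<open>\<alpha>\<^sub>0\<close> and killing rate \<open>\<alpha>\<^sub>\<infinity>\<close>.\<close>

definition mechanism_derivative :: "real \<Rightarrow> real \<Rightarrow> real measure \<Rightarrow> real \<Rightarrow> real" where
  "mechanism_derivative a0 ainf \<mu> q = a0 * q + ainf + (\<integral>x. (1 - exp (- q * x)) \<partial>\<mu>)"

lemma levy_triple_measure: "levy_triple a0 ainf \<mu> \<Longrightarrow> levy_measure \<mu>"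
  by (simp add: levy_triple_def)

lemma bernstein_integrand_bound:
  fixes q x :: real
  assumes "0 \<le> q" "0 < x" shows "\<bar>1 - exp (- q * x)\<bar> \<le> (1 + q) * min x 1"
proof -
  have b: "0 \<le> 1 - exp (- q * x)" "1 - exp (- q * x) \<le> q * x" "1 - exp (- q * x) \<le> 1"
    using one_minus_exp_bounds[of "q * x"] assms by auto
  show ?thesis
  proof (cases "x \<le> 1")
    case True
    have "q * x \<le> (1 + q) * x" using assms by (intro mult_right_mono) auto
    then show ?thesis using b True by (simp add: min_absorb1)
  next
    case False
    then have "min x 1 = 1" by simp
    then show ?thesis using b assms(1) by (simp only: mult_1_right)
  qed
qed

lemma integrable_bernstein_integrand:
  assumes "levy_measure \<mu>" "0 \<le> q" shows "integrable \<mu> (\<lambda>x. 1 - exp (- q * x))"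
  by (rule levy_integrable[OF assms(1) _ bernstein_integrand_bound[OF assms(2)]]) measurable

lemma mechanism_integrand_bound:
  fixes q x :: real
  assumes "0 \<le> q" "0 < x"
  shows "\<bar>(exp (- q * x) - 1 + q * x) / x\<bar> \<le> (q + q\<^sup>2 / 2) * min x 1"
proof -
  have b: "0 \<le> exp (- q * x) - 1 + q * x" "exp (- q * x) - 1 + q * x \<le> (q * x)\<^sup>2 / 2"
      "exp (- q * x) - 1 + q * x \<le> q * x"
    using exp_minus_nonneg[of "q * x"] exp_minus_le_quadratic[of "q * x"] assms by auto
  then have n: "0 \<le> (exp (- q * x) - 1 + q * x) / x" using assms by simp
  show "\<bar>(exp (- q * x) - 1 + q * x) / x\<bar> \<le> (q + q\<^sup>2 / 2) * min x 1"
  proof (cases "x \<le> 1")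
    case True
    have "(exp (- q * x) - 1 + q * x) / x \<le> q\<^sup>2 / 2 * x"
      using b(2) assms by (simp add: pos_divide_le_eq power2_eq_square mult_ac)
    also have "\<dots> \<le> (q + q\<^sup>2 / 2) * x" using assms by (intro mult_right_mono) auto
    finally show ?thesis using True n by (simp add: min_absorb1)
  next
    case False
    have "(exp (- q * x) - 1 + q * x) / x \<le> q"
      using b(3) assms by (simp add: pos_divide_le_eq)
    then show ?thesis using False n by (simp add: min_absorb2 add_increasing2)
  qed
qed

lemma integrable_mechanism_integrand:
  assumes "levy_measure \<mu>" "0 \<le> q"
  shows "integrable \<mu> (\<lambda>x. (exp (- q * x) - 1 + q * x) / x)"
  by (rule levy_integrable[OF assms(1) _ mechanism_integrand_bound[OF assms(2)]]) measurable

lemma branching_mechanism_eq_integral_test: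
  assumes "levy_triple a0 ainf \<mu>" "0 \<le> q"
  shows "branching_mechanism a0 ainf \<mu> q = (\<integral>y. branching_test q y \<partial>kappa_measure a0 ainf \<mu>)"
proof -
  have "(\<integral>x. min x 1 * branching_test q (ennreal x) \<partial>\<mu>) = (\<integral>x. (exp (- q * x) - 1 + q * x) / x \<partial>\<mu>)"
    by (rule Bochner_Integration.integral_cong[OF refl])
       (use levy_measure_space[of \<mu>] assms in \<open>simp add: levy_triple_def min1_branching_test\<close>)
  then show ?thesis
    using assms by (simp add: integral_kappa_measure levy_triple_def continuous_branching_test branching_mechanism_def)
qed

lemma mechanism_derivative_mono:
  assumes "levy_triple a0 ainf \<mu>" "0 \<le> q" "q \<le> q'"
  shows "mechanism_derivative a0 ainf \<mu> q \<le> mechanism_derivative a0 ainf \<mu> q'"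
proof -
  note l = levy_triple_measure[OF assms(1)]
  have "(\<integral>x. (1 - exp (- q * x)) \<partial>\<mu>) \<le> (\<integral>x. (1 - exp (- q' * x)) \<partial>\<mu>)"
    by (rule integral_mono) (use assms integrable_bernstein_integrand[OF l] levy_measure_space[OF l] in auto)
  moreover have "a0 * q \<le> a0 * q'" using assms by (intro mult_left_mono) (auto simp: levy_triple_def)
  ultimately show ?thesis by (simp add: mechanism_derivative_def)
qed

lemma mechanism_derivative_nonneg:
  assumes "levy_triple a0 ainf \<mu>" "0 \<le> q" shows "0 \<le> mechanism_derivative a0 ainf \<mu> q"
  using mechanism_derivative_mono[OF assms(1) order_refl assms(2)] assms(1)
  by (simp add: mechanism_derivative_def levy_triple_def)

text \<open>Convexity, in integrated form: increments lie between the tangents at the two end points.\<close>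

lemma mechanism_increment:
  assumes lt: "levy_triple a0 ainf \<mu>" and ab: "0 \<le> a" "a \<le> b"
  shows "(b - a) * mechanism_derivative a0 ainf \<mu> a \<le> branching_mechanism a0 ainf \<mu> b - branching_mechanism a0 ainf \<mu> a"
    and "branching_mechanism a0 ainf \<mu> b - branching_mechanism a0 ainf \<mu> a \<le> (b - a) * mechanism_derivative a0 ainf \<mu> b"
proof -
  note l = levy_triple_measure[OF lt]
  let ?\<psi> = "\<lambda>q x. (exp (- q * x) - 1 + q * x) / x"
  have b: "0 \<le> b" using ab by simp
  have a0: "0 \<le> a0" using lt by (simp add: levy_triple_def)
  have pt: "(b - a) * (1 - exp (- a * x)) \<le> ?\<psi> b x - ?\<psi> a x" "?\<psi> b x - ?\<psi> a x \<le> (b - a) * (1 - exp (- b * x))"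
    if x: "x \<in> space \<mu>" for x
  proof -
    have x: "0 < x" using x levy_measure_space[OF l] by simp
    have eq: "?\<psi> b x - ?\<psi> a x = ((b - a) * x - (exp (- a * x) - exp (- b * x))) / x"
      by (simp add: diff_divide_distrib[symmetric] algebra_simps)
    have "exp (- a * x) - exp (- b * x) = exp (- a * x) * (1 - exp (- ((b - a) * x)))"
      by (simp add: algebra_simps mult_exp_exp)
    also have "\<dots> \<le> exp (- a * x) * ((b - a) * x)"
      using one_minus_exp_bounds(2)[of "(b - a) * x"] ab x by (intro mult_left_mono) auto
    finally have 1: "exp (- a * x) - exp (- b * x) \<le> (b - a) * x * exp (- a * x)" by (simp add: mult_ac)
    have "exp (- b * x) * ((b - a) * x) \<le> exp (- b * x) * (exp ((b - a) * x) - 1)"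
      using exp_ge_add_one_self[of "(b - a) * x"] by (intro mult_left_mono, linarith, simp)
    also have "\<dots> = exp (- a * x) - exp (- b * x)" by (simp add: algebra_simps mult_exp_exp)
    finally have 2: "(b - a) * x * exp (- b * x) \<le> exp (- a * x) - exp (- b * x)" by (simp add: mult_ac)
    show "(b - a) * (1 - exp (- a * x)) \<le> ?\<psi> b x - ?\<psi> a x"
      unfolding eq pos_le_divide_eq[OF x] using 1 by (simp add: algebra_simps)
    show "?\<psi> b x - ?\<psi> a x \<le> (b - a) * (1 - exp (- b * x))"
      unfolding eq pos_divide_le_eq[OF x] using 2 by (simp add: algebra_simps)
  qed
  note i\<psi> = integrable_mechanism_integrand[OF l] and ib = integrable_bernstein_integrand[OF l]
  have eq: "branching_mechanism a0 ainf \<mu> b - branching_mechanism a0 ainf \<mu> a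
    = (b - a) * (a0 * (a + b) / 2 + ainf) + (\<integral>x. ?\<psi> b x - ?\<psi> a x \<partial>\<mu>)"
  proof -
    have "1 / 2 * a0 * b\<^sup>2 + ainf * b + B - (1 / 2 * a0 * a\<^sup>2 + ainf * a + A)
      = (b - a) * (a0 * (a + b) / 2 + ainf) + (B - A)" for A B :: real
      by (simp add: field_simps power2_eq_square)
    then show ?thesis
      unfolding branching_mechanism_def Bochner_Integration.integral_diff[OF i\<psi>[OF b] i\<psi>[OF ab(1)]] .
  qed
  have I1: "(b - a) * (\<integral>x. (1 - exp (- a * x)) \<partial>\<mu>) \<le> (\<integral>x. ?\<psi> b x - ?\<psi> a x \<partial>\<mu>)"
    unfolding integral_mult_right_zero[symmetric]
    by (rule integral_mono[OF integrable_mult_right[OF ib[OF ab(1)]] Bochner_Integration.integrable_diff[OF i\<psi>[OF b] i\<psi>[OF ab(1)]] pt(1)])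
  have I2: "(\<integral>x. ?\<psi> b x - ?\<psi> a x \<partial>\<mu>) \<le> (b - a) * (\<integral>x. (1 - exp (- b * x)) \<partial>\<mu>)"
    unfolding integral_mult_right_zero[symmetric]
    by (rule integral_mono[OF Bochner_Integration.integrable_diff[OF i\<psi>[OF b] i\<psi>[OF ab(1)]] integrable_mult_right[OF ib[OF b]] pt(2)])
  have h: "a0 * a \<le> a0 * b" by (rule mult_left_mono[OF ab(2) a0])
  have mid: "x \<le> (x + y) / 2 \<and> (x + y) / 2 \<le> y" if "x \<le> y" for x y :: real using that by simp
  have "a0 * a \<le> a0 * (a + b) / 2" unfolding distrib_left using mid[OF h] by blast
  then have q1: "(b - a) * (a0 * a) \<le> (b - a) * (a0 * (a + b) / 2)"
    by (rule mult_left_mono) (use ab in simp)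
  have "a0 * (a + b) / 2 \<le> a0 * b" unfolding distrib_left using mid[OF h] by blast
  then have q2: "(b - a) * (a0 * (a + b) / 2) \<le> (b - a) * (a0 * b)"
    by (rule mult_left_mono) (use ab in simp)
  show "(b - a) * mechanism_derivative a0 ainf \<mu> a \<le> branching_mechanism a0 ainf \<mu> b - branching_mechanism a0 ainf \<mu> a"
    unfolding eq mechanism_derivative_def using I1 q1 by (simp only: distrib_left)
  show "branching_mechanism a0 ainf \<mu> b - branching_mechanism a0 ainf \<mu> a \<le> (b - a) * mechanism_derivative a0 ainf \<mu> b"
    unfolding eq mechanism_derivative_def using I2 q2 by (simp only: distrib_left)
qed

lemma branching_mechanism_0 [simp]: "branching_mechanism a0 ainf \<mu> 0 = 0"
  by (simp add: branching_mechanism_def)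

lemma branching_mechanism_mono:
  assumes "levy_triple a0 ainf \<mu>" "0 \<le> a" "a \<le> b"
  shows "branching_mechanism a0 ainf \<mu> a \<le> branching_mechanism a0 ainf \<mu> b"
proof -
  have "0 \<le> (b - a) * mechanism_derivative a0 ainf \<mu> a"
    using mechanism_derivative_nonneg[OF assms(1,2)] assms by simp
  then show ?thesis using mechanism_increment(1)[OF assms] by linarith
qed

lemma branching_mechanism_nonneg:
  "levy_triple a0 ainf \<mu> \<Longrightarrow> 0 \<le> q \<Longrightarrow> 0 \<le> branching_mechanism a0 ainf \<mu> q"
  using branching_mechanism_mono[of a0 ainf \<mu> 0 q] by simp

lemma branching_mechanism_lipschitz:
  assumes lt: "levy_triple a0 ainf \<mu>" and "0 \<le> a" "a \<le> q" "0 \<le> b" "b \<le> q"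
  shows "\<bar>branching_mechanism a0 ainf \<mu> b - branching_mechanism a0 ainf \<mu> a\<bar> \<le> mechanism_derivative a0 ainf \<mu> q * \<bar>b - a\<bar>"
  using assms(2-)
proof (induction a b rule: linorder_wlog)
  case (le a b)
  have "(b - a) * mechanism_derivative a0 ainf \<mu> b \<le> (b - a) * mechanism_derivative a0 ainf \<mu> q"
    using le mechanism_derivative_mono[OF lt] by (intro mult_left_mono) auto
  then show ?case
    using mechanism_increment(2)[OF lt le(2) le(1)] branching_mechanism_mono[OF lt le(2) le(1)] le
    by (simp add: mult.commute)
next
  case (sym a b)
  then show ?case by (simp add: abs_minus_commute)
qed

subsection \<open>Power series expansion\<close>

text \<open>Termwise integration of a series whose absolute partial sums are dominated by a multiple of \<open>x \<and> 1\<close>.\<close>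

lemma levy_sums_integral:
  fixes f :: "nat \<Rightarrow> real \<Rightarrow> real"
  assumes l: "levy_measure \<mu>" and f: "\<And>k. f k \<in> borel_measurable borel" and F: "F \<in> borel_measurable borel"
    and sums: "\<And>x. 0 < x \<Longrightarrow> (\<lambda>k. f k x) sums F x"
    and bound: "\<And>x n. 0 < x \<Longrightarrow> (\<Sum>k<n. \<bar>f k x\<bar>) \<le> C * min x 1"
  shows "(\<lambda>k. \<integral>x. f k x \<partial>\<mu>) sums (\<integral>x. F x \<partial>\<mu>)" and "integrable \<mu> (f k)"
proof -
  note ms = measurable_pos_borel[OF levy_measure_sets[OF l]]
  have "\<bar>f k x\<bar> \<le> C * min x 1" if "0 < x" for k x
    using bound[OF that, of "Suc k"] sum_nonneg[of "{..<k}" "\<lambda>k. \<bar>f k x\<bar>", OF abs_ge_zero]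
    by (simp only: sum.lessThan_Suc)
  then show int: "integrable \<mu> (f k)" for k
    by (rule levy_integrable[OF l f])
  have eq: "(\<Sum>k<n. \<integral>x. f k x \<partial>\<mu>) = (\<integral>x. (\<Sum>k<n. f k x) \<partial>\<mu>)" for n
    by (rule Bochner_Integration.integral_sum[symmetric]) (rule int)
  show "(\<lambda>k. \<integral>x. f k x \<partial>\<mu>) sums (\<integral>x. F x \<partial>\<mu>)"
    unfolding sums_def eq
  proof (rule integral_dominated_convergence)
    show "integrable \<mu> (\<lambda>x. C * min x 1)"
      by (intro integrable_mult_right levy_integrable[OF l, of _ 1]) auto
    show "AE x in \<mu>. (\<lambda>n. \<Sum>k<n. f k x) \<longlonglongrightarrow> F x"
      by (rule AE_I2) (use sums levy_measure_space[OF l] in \<open>simp add: sums_def\<close>)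
    show "AE x in \<mu>. norm (\<Sum>k<n. f k x) \<le> C * min x 1" for n
    proof (rule AE_I2)
      fix x assume "x \<in> space \<mu>"
      then have "0 < x" using levy_measure_space[OF l] by simp
      from order_trans[OF sum_abs bound[OF this]] show "norm (\<Sum>k<n. f k x) \<le> C * min x 1"
        by simp
    qed
    show "(\<lambda>x. \<Sum>k<n. f k x) \<in> borel_measurable \<mu>" for n
      by (intro borel_measurable_sum ms f)
  qed (rule ms[OF F])
qed

text \<open>Up to sign, the part of \<open>\<Psi>\<^sup>(\<^sup>k\<^sup>+\<^sup>2\<^sup>)(\<rho>)\<close> that comes from \<open>\<mu>\<close>.\<close>

definition exp_moment :: "real measure \<Rightarrow> real \<Rightarrow> nat \<Rightarrow> real" where
  "exp_moment \<mu> \<rho> k = (\<integral>x. x ^ Suc k * exp (- \<rho> * x) \<partial>\<mu>)"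

lemma exp_tail_sums: "(\<lambda>k. v ^ (k + 2) / fact (k + 2)) sums (exp v - 1 - (v::real))"
  using sums_split_initial_segment[OF exp_converges[of v], of 2]
  by (simp add: numeral_2_eq_2 scaleR_conv_of_real field_simps diff_diff_eq)

lemma exp_tail_sums_1: "(\<lambda>k. v ^ Suc k / fact (Suc k)) sums (exp v - (1::real))"
  using sums_split_initial_segment[OF exp_converges[of v], of 1]
  by (simp add: scaleR_conv_of_real field_simps)

text \<open>Expand \<open>e\<^sup>r\<^sup>x - 1 - r x\<close> and integrate termwise.  The series still converges on the boundary
  \<open>\<bar>r\<bar> = \<rho>\<close>, where the dominating function is \<open>(1 - (1 + v) e\<^sup>-\<^sup>v) / x\<close> with \<open>v = \<rho> x\<close>.\<close>

lemma exp_moment_sums_mechanism: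
  assumes l: "levy_measure \<mu>" and \<rho>: "0 < \<rho>" and r: "\<bar>r\<bar> \<le> \<rho>"
  shows "(\<lambda>k. r ^ (k + 2) / fact (k + 2) * exp_moment \<mu> \<rho> k)
    sums (\<integral>x. (exp (r * x) - 1 - r * x) * exp (- \<rho> * x) / x \<partial>\<mu>)"
proof -
  let ?f = "\<lambda>k x. r ^ (k + 2) / fact (k + 2) * (x ^ Suc k * exp (- \<rho> * x))"
  have fx: "?f k x = (r * x) ^ (k + 2) / fact (k + 2) * (exp (- \<rho> * x) / x)" if "0 < x" for k x
    using that by (simp add: power_mult_distrib field_simps del: fact_Suc)
  have "(\<lambda>k. \<integral>x. ?f k x \<partial>\<mu>) sums (\<integral>x. (exp (r * x) - 1 - r * x) * exp (- \<rho> * x) / x \<partial>\<mu>)"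
  proof (rule levy_sums_integral[OF l, where C = "1 + \<rho>\<^sup>2"])
    fix x :: real and n assume x: "0 < x"
    have "(\<lambda>k. (r * x) ^ (k + 2) / fact (k + 2) * (exp (- \<rho> * x) / x))
        sums ((exp (r * x) - 1 - r * x) * (exp (- \<rho> * x) / x))"
      by (intro sums_mult2 exp_tail_sums)
    then show "(\<lambda>k. ?f k x) sums ((exp (r * x) - 1 - r * x) * exp (- \<rho> * x) / x)"
      using fx[OF x] by simp
    let ?v = "\<rho> * x"
    have v: "0 \<le> ?v" using \<rho> x by simp
    have exp_partial: "(\<Sum>k<n. ?v ^ (k + 2) / fact (k + 2)) \<le> exp ?v - 1 - ?v" for n
      unfolding sums_unique[OF exp_tail_sums]
      by (rule sum_le_suminf[OF sums_summable[OF exp_tail_sums]]) (use v in auto)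
    have "(\<Sum>k<n. \<bar>?f k x\<bar>) \<le> (\<Sum>k<n. ?v ^ (k + 2) / fact (k + 2) * (exp (- \<rho> * x) / x))"
    proof (rule sum_mono)
      fix k
      have "\<bar>(r * x) ^ (k + 2)\<bar> \<le> ?v ^ (k + 2)"
        unfolding power_abs using r x by (intro power_mono) (auto simp: abs_mult)
      then have "\<bar>(r * x) ^ (k + 2)\<bar> / fact (k + 2) * (exp (- \<rho> * x) / x) \<le> ?v ^ (k + 2) / fact (k + 2) * (exp (- \<rho> * x) / x)"
        using x by (intro mult_right_mono divide_right_mono) auto
      then show "\<bar>?f k x\<bar> \<le> ?v ^ (k + 2) / fact (k + 2) * (exp (- \<rho> * x) / x)"
        unfolding fx[OF x] using x by (simp add: abs_mult abs_divide del: fact_Suc power_Suc)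
    qed
    also have "\<dots> = (\<Sum>k<n. ?v ^ (k + 2) / fact (k + 2)) * (exp (- \<rho> * x) / x)"
      by (simp only: sum_distrib_right)
    also have "\<dots> \<le> (exp ?v - 1 - ?v) * (exp (- \<rho> * x) / x)"
      using v x exp_partial[of n] by (intro mult_right_mono) auto
    also have "\<dots> = (1 - exp (- ?v) - ?v * exp (- ?v)) / x"
      by (simp add: left_diff_distrib mult_exp_exp)
    also have "\<dots> \<le> (1 + \<rho>\<^sup>2) * min x 1"
    proof (cases "x \<le> 1")
      case True
      \<comment> \<open>\<open>1 - (1 + v) e\<^sup>-\<^sup>v \<le> v\<^sup>2\<close>, because \<open>e\<^sup>-\<^sup>v \<ge> 1 - v\<close>\<close>
      have "(1 + ?v) * (1 - ?v) \<le> (1 + ?v) * exp (- ?v)"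
        using exp_ge_add_one_self[of "- ?v"] v by (intro mult_left_mono) auto
      then have "1 - exp (- ?v) - ?v * exp (- ?v) \<le> \<rho>\<^sup>2 * x * x"
        by (simp add: algebra_simps power2_eq_square)
      then have "(1 - exp (- ?v) - ?v * exp (- ?v)) / x \<le> \<rho>\<^sup>2 * x" using x by (simp add: pos_divide_le_eq)
      also have "\<dots> \<le> (1 + \<rho>\<^sup>2) * x" using x by (intro mult_right_mono) auto
      finally show ?thesis using True by (simp add: min_absorb1)
    next
      case False
      have "0 \<le> ?v * exp (- ?v)" "0 \<le> exp (- ?v)" using v by simp_all
      then have "1 - exp (- ?v) - ?v * exp (- ?v) \<le> 1" by linarith
      then have "(1 - exp (- ?v) - ?v * exp (- ?v)) / x \<le> 1 / 1"
        using False by (intro frac_le) auto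
      also have "\<dots> \<le> (1 + \<rho>\<^sup>2)" by simp
      finally show ?thesis using False by (simp add: min_absorb2)
    qed
    finally show "(\<Sum>k<n. \<bar>?f k x\<bar>) \<le> (1 + \<rho>\<^sup>2) * min x 1" .
  qed measurable
  then show ?thesis by (simp only: integral_mult_right_zero exp_moment_def)
qed

lemma exp_moment_sums_derivative:
  assumes l: "levy_measure \<mu>" and \<rho>: "0 < \<rho>"
  shows "(\<lambda>k. \<rho> ^ (k + 2) / fact (Suc k) * exp_moment \<mu> \<rho> k) sums (\<rho> * (\<integral>x. (1 - exp (- \<rho> * x)) \<partial>\<mu>))"
proof -
  let ?f = "\<lambda>k x. \<rho> ^ (k + 2) / fact (Suc k) * (x ^ Suc k * exp (- \<rho> * x))"
  have fx: "?f k x = (\<rho> * x) ^ Suc k / fact (Suc k) * (\<rho> * exp (- \<rho> * x))" for k x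
    by (simp add: power_mult_distrib field_simps del: fact_Suc)
  have "(\<lambda>k. \<integral>x. ?f k x \<partial>\<mu>) sums (\<integral>x. \<rho> * (1 - exp (- \<rho> * x)) \<partial>\<mu>)"
  proof (rule levy_sums_integral[OF l, where C = "\<rho> * (1 + \<rho>)"])
    fix x :: real and n assume x: "0 < x"
    have "(\<lambda>k. ?f k x) sums ((exp (\<rho> * x) - 1) * (\<rho> * exp (- \<rho> * x)))"
      unfolding fx by (intro sums_mult2 exp_tail_sums_1)
    also have "(exp (\<rho> * x) - 1) * (\<rho> * exp (- \<rho> * x)) = \<rho> * (1 - exp (- \<rho> * x))"
      by (simp add: algebra_simps mult_exp_exp)
    finally show s: "(\<lambda>k. ?f k x) sums (\<rho> * (1 - exp (- \<rho> * x)))" .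
    have n: "0 \<le> ?f k x" for k using x \<rho> by simp
    have "(\<Sum>k<n. \<bar>?f k x\<bar>) = (\<Sum>k<n. ?f k x)" by (simp only: abs_of_nonneg[OF n])
    also have "\<dots> \<le> \<rho> * (1 - exp (- \<rho> * x))"
      using sum_le_suminf[OF sums_summable[OF s], of "{..<n}"] n sums_unique[OF s] by simp
    also have "\<dots> \<le> \<rho> * ((1 + \<rho>) * min x 1)"
      using bernstein_integrand_bound[of \<rho> x] \<rho> x by (intro mult_left_mono) auto
    finally show "(\<Sum>k<n. \<bar>?f k x\<bar>) \<le> \<rho> * (1 + \<rho>) * min x 1" by simp
  qed measurable
  then show ?thesis by (simp only: integral_mult_right_zero exp_moment_def)
qed

text \<open>The Taylor coefficients of \<open>r \<mapsto> \<Psi>(\<rho> - r)\<close> at \<open>0\<close>.\<close>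

definition mechanism_coeff :: "real \<Rightarrow> real \<Rightarrow> real measure \<Rightarrow> real \<Rightarrow> nat \<Rightarrow> real" where
  "mechanism_coeff a0 ainf \<mu> \<rho> n =
     (if n = 0 then branching_mechanism a0 ainf \<mu> \<rho>
      else if n = 1 then - mechanism_derivative a0 ainf \<mu> \<rho>
      else exp_moment \<mu> \<rho> (n - 2) / fact n + (if n = 2 then a0 / 2 else 0))"

text \<open>The integrand of \<open>\<Psi>(\<rho> - r)\<close> splits as \<open>(e\<^sup>-\<^sup>\<rho>\<^sup>x - 1 + \<rho> x) / x - r (1 - e\<^sup>-\<^sup>\<rho>\<^sup>x) + (e\<^sup>r\<^sup>x - 1 - r x) e\<^sup>-\<^sup>\<rho>\<^sup>x / x\<close>.
  The range \<open>\<bar>r\<bar> \<le> \<rho>\<close> is closed because the coagulation sums are evaluated at \<open>r = \<rho>\<close>.\<close>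

lemma mechanism_tail_sums:
  assumes lt: "levy_triple a0 ainf \<mu>" and \<rho>: "0 < \<rho>" and r: "\<bar>r\<bar> \<le> \<rho>"
  shows "(\<lambda>k. mechanism_coeff a0 ainf \<mu> \<rho> (k + 2) * r ^ (k + 2))
    sums (branching_mechanism a0 ainf \<mu> (\<rho> - r) - branching_mechanism a0 ainf \<mu> \<rho> + r * mechanism_derivative a0 ainf \<mu> \<rho>)"
proof -
  note l = levy_triple_measure[OF lt]
  let ?\<psi> = "\<lambda>q x. (exp (- q * x) - 1 + q * x) / x"
  let ?S = "\<lambda>x. (exp (r * x) - 1 - r * x) * exp (- \<rho> * x) / x"
  have \<rho>r: "0 \<le> \<rho> - r" "0 \<le> \<rho>" using r \<rho> by auto
  have pt: "?S x = ?\<psi> (\<rho> - r) x - ?\<psi> \<rho> x + r * (1 - exp (- \<rho> * x))" if "x \<in> space \<mu>" for x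
  proof -
    have x: "0 < x" using that levy_measure_space[OF l] by simp
    have "exp (- (\<rho> - r) * x) = exp (r * x) * exp (- \<rho> * x)" by (simp add: mult_exp_exp algebra_simps)
    then show ?thesis using x by (simp add: field_simps)
  qed
  have "(\<integral>x. ?S x \<partial>\<mu>) = (\<integral>x. ?\<psi> (\<rho> - r) x - ?\<psi> \<rho> x + r * (1 - exp (- \<rho> * x)) \<partial>\<mu>)"
    by (rule Bochner_Integration.integral_cong[OF refl pt])
  also have "\<dots> = (\<integral>x. ?\<psi> (\<rho> - r) x \<partial>\<mu>) - (\<integral>x. ?\<psi> \<rho> x \<partial>\<mu>) + r * (\<integral>x. (1 - exp (- \<rho> * x)) \<partial>\<mu>)"
    using integrable_mechanism_integrand[OF l \<rho>r(1)] integrable_mechanism_integrand[OF l \<rho>r(2)]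
      integrable_bernstein_integrand[OF l \<rho>r(2)]
    by (simp only: Bochner_Integration.integral_add Bochner_Integration.integral_diff
        Bochner_Integration.integrable_diff integrable_mult_right integral_mult_right_zero)
  finally have I: "(\<integral>x. ?S x \<partial>\<mu>) = \<dots>" .
  have "(\<lambda>k. r ^ (k + 2) / fact (k + 2) * exp_moment \<mu> \<rho> k + (if k = 0 then a0 / 2 * r\<^sup>2 else 0))
      sums ((\<integral>x. ?S x \<partial>\<mu>) + a0 / 2 * r\<^sup>2)"
    by (intro sums_add exp_moment_sums_mechanism[OF l \<rho> r] sums_single)
  moreover have "r ^ (k + 2) / fact (k + 2) * exp_moment \<mu> \<rho> k + (if k = 0 then a0 / 2 * r\<^sup>2 else 0)
      = mechanism_coeff a0 ainf \<mu> \<rho> (k + 2) * r ^ (k + 2)" for k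
    by (simp add: mechanism_coeff_def distrib_right del: fact_Suc power_Suc) (simp add: power2_eq_square)
  moreover have "(\<integral>x. ?S x \<partial>\<mu>) + a0 / 2 * r\<^sup>2
      = branching_mechanism a0 ainf \<mu> (\<rho> - r) - branching_mechanism a0 ainf \<mu> \<rho> + r * mechanism_derivative a0 ainf \<mu> \<rho>"
    unfolding I branching_mechanism_def mechanism_derivative_def by (simp add: algebra_simps power2_eq_square)
  ultimately show ?thesis by simp
qed

lemma mechanism_coeff_nonneg:
  assumes "levy_triple a0 ainf \<mu>" "0 < \<rho>" shows "0 \<le> mechanism_coeff a0 ainf \<mu> \<rho> (k + 2)"
proof -
  have "0 \<le> exp_moment \<mu> \<rho> k"
    unfolding exp_moment_def using levy_measure_space[OF levy_triple_measure[OF assms(1)]]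
    by (intro Bochner_Integration.integral_nonneg) auto
  then show ?thesis using assms(1) by (simp add: mechanism_coeff_def levy_triple_def)
qed

text \<open>This sum controls \<open>\<Sum>k R\<^sub>k\<close>, hence the absolute convergence of the coagulation operator.\<close>

lemma mechanism_weighted_tail_sums:
  assumes lt: "levy_triple a0 ainf \<mu>" and \<rho>: "0 < \<rho>"
  shows "(\<lambda>k. real (k + 2) * (mechanism_coeff a0 ainf \<mu> \<rho> (k + 2) * \<rho> ^ (k + 2)))
    sums (\<rho> * (mechanism_derivative a0 ainf \<mu> \<rho> - ainf))"
proof -
  have "(\<lambda>k. \<rho> ^ (k + 2) / fact (Suc k) * exp_moment \<mu> \<rho> k + (if k = 0 then a0 * \<rho>\<^sup>2 else 0))
      sums (\<rho> * (\<integral>x. (1 - exp (- \<rho> * x)) \<partial>\<mu>) + a0 * \<rho>\<^sup>2)"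
    by (intro sums_add exp_moment_sums_derivative[OF levy_triple_measure[OF lt] \<rho>] sums_single)
  moreover have "\<rho> ^ (k + 2) / fact (Suc k) * exp_moment \<mu> \<rho> k + (if k = 0 then a0 * \<rho>\<^sup>2 else 0)
      = real (k + 2) * (mechanism_coeff a0 ainf \<mu> \<rho> (k + 2) * \<rho> ^ (k + 2))" for k
  proof -
    have "fact (k + 2) = real (k + 2) * fact (Suc k)" by (simp add: algebra_simps)
    then have "real (k + 2) * (exp_moment \<mu> \<rho> k / fact (k + 2)) = exp_moment \<mu> \<rho> k / fact (Suc k)"
      by (simp del: fact_Suc)
    then show ?thesis
    proof -
      assume eq: "real (k + 2) * (exp_moment \<mu> \<rho> k / fact (k + 2)) = exp_moment \<mu> \<rho> k / fact (Suc k)"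
      have c: "mechanism_coeff a0 ainf \<mu> \<rho> (k + 2) = exp_moment \<mu> \<rho> k / fact (k + 2) + (if k = 0 then a0 / 2 else 0)"
        by (simp add: mechanism_coeff_def)
      have "real (k + 2) * (mechanism_coeff a0 ainf \<mu> \<rho> (k + 2) * \<rho> ^ (k + 2))
        = (real (k + 2) * (exp_moment \<mu> \<rho> k / fact (k + 2))) * \<rho> ^ (k + 2)
          + real (k + 2) * (if k = 0 then a0 / 2 else 0) * \<rho> ^ (k + 2)"
        unfolding c by (simp only: distrib_left distrib_right mult.assoc)
      also have "\<dots> = \<rho> ^ (k + 2) / fact (Suc k) * exp_moment \<mu> \<rho> k + (if k = 0 then a0 * \<rho>\<^sup>2 else 0)"
        unfolding eq by (cases "k = 0") (simp_all add: power2_eq_square)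
      finally show ?thesis by simp
    qed
  qed
  moreover have "\<rho> * (\<integral>x. (1 - exp (- \<rho> * x)) \<partial>\<mu>) + a0 * \<rho>\<^sup>2 = \<rho> * (mechanism_derivative a0 ainf \<mu> \<rho> - ainf)"
    by (simp add: mechanism_derivative_def algebra_simps power2_eq_square)
  ultimately show ?thesis by (simp only:)
qed

lemma mechanism_power_series:
  assumes lt: "levy_triple a0 ainf \<mu>" and \<rho>: "0 < \<rho>" and u: "\<bar>u\<bar> \<le> \<rho>"
  shows "(\<lambda>n. (- 1) ^ n * mechanism_coeff a0 ainf \<mu> \<rho> n * u ^ n) sums branching_mechanism a0 ainf \<mu> (\<rho> + u)"
proof -
  let ?b = "mechanism_coeff a0 ainf \<mu> \<rho>"
  have "(\<lambda>n. ?b (n + 2) * (- u) ^ (n + 2)) sums (branching_mechanism a0 ainf \<mu> (\<rho> + u) - (\<Sum>i<2. ?b i * (- u) ^ i))"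
    using mechanism_tail_sums[OF lt \<rho>, of "- u"] u
    by (simp add: numeral_2_eq_2 mechanism_coeff_def algebra_simps)
  then have "(\<lambda>n. ?b n * (- u) ^ n) sums branching_mechanism a0 ainf \<mu> (\<rho> + u)"
    by (rule sums_iff_shift'[of "\<lambda>n. ?b n * (- u) ^ n" 2, THEN iffD1])
  then show ?thesis by (simp add: power_minus[of u] mult_ac)
qed

text \<open>Termwise differentiation, iterated.\<close>

lemma higher_deriv_power_series:
  fixes f :: "real \<Rightarrow> real"
  assumes "0 < R" "\<And>u. \<bar>u\<bar> < R \<Longrightarrow> (\<lambda>n. a n * u ^ n) sums f u"
  shows "(deriv ^^ n) f 0 = fact n * a n"
    and "(f has_real_derivative a 1) (at 0)"
proof -
  have D: "(f has_real_derivative (\<Sum>n. diffs a n * u ^ n)) (at u)"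
    and S: "summable (\<lambda>n. diffs a n * u ^ n)"
    if R: "0 < R" "\<And>u. \<bar>u\<bar> < R \<Longrightarrow> (\<lambda>n. a n * u ^ n) sums f u" and u: "\<bar>u\<bar> < R"
    for f :: "real \<Rightarrow> real" and a R u
  proof -
    obtain K where K: "\<bar>u\<bar> < K" "K < R" using dense[OF u] by blast
    have sK: "summable (\<lambda>n. a n * K ^ n)" using R(2)[of K] K by (auto simp: sums_iff)
    have "((\<lambda>u. \<Sum>n. a n * u ^ n) has_real_derivative (\<Sum>n. diffs a n * u ^ n)) (at u)"
      by (rule termdiffs_strong[OF sK]) (use K in simp)
    moreover have ev: "\<forall>\<^sub>F v in nhds u. (\<Sum>n. a n * v ^ n) = f v"
    proof -
      have "\<forall>\<^sub>F v in nhds u. v \<in> {-R<..<R}" by (rule eventually_nhds_in_open) (use u in auto)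
      then show ?thesis by eventually_elim (use R(2) in \<open>auto simp: sums_iff abs_less_iff\<close>)
    qed
    ultimately show "(f has_real_derivative (\<Sum>n. diffs a n * u ^ n)) (at u)"
      by (simp only: DERIV_cong_ev[OF refl ev refl])
    show "summable (\<lambda>n. diffs a n * u ^ n)"
      by (rule termdiff_converges[of u K]) (use K R(2) in \<open>auto simp: sums_iff\<close>)
  qed
  show "(f has_real_derivative a 1) (at 0)"
    using D[OF assms, of 0] assms(1) by (simp add: diffs_def)
  show "(deriv ^^ n) f 0 = fact n * a n"
    using assms
  proof (induction n arbitrary: f a)
    case 0
    have "(\<lambda>n. a n * 0 ^ n) sums a 0" by (rule powser_sums_zero)
    then show ?case using "0.prems"(2)[of 0] "0.prems"(1) sums_unique2 by fastforce
  next
    case (Suc n)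
    have "(\<lambda>n. diffs a n * u ^ n) sums deriv f u" if "\<bar>u\<bar> < R" for u
      using D[OF Suc.prems that] S[OF Suc.prems that] by (simp add: DERIV_imp_deriv summable_sums)
    from Suc.IH[OF Suc.prems(1) this] show ?case
      unfolding funpow_Suc_right o_def by (simp add: diffs_def algebra_simps)
  qed
qed

lemma higher_deriv_shift:
  fixes f :: "real \<Rightarrow> real"
  shows "(deriv ^^ n) (\<lambda>u. f (c + u)) = (\<lambda>u. (deriv ^^ n) f (c + u))"
proof (induction n)
  case (Suc n)
  have "deriv (\<lambda>u. g (c + u)) u = deriv g (c + u)" for g :: "real \<Rightarrow> real" and u
    unfolding deriv_def using DERIV_shift[of g _ u c] by (simp add: add.commute)
  then show ?case by (simp add: Suc)
qed simp

lemma branching_mechanism_derivs: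
  assumes lt: "levy_triple a0 ainf \<mu>" and \<rho>: "0 < \<rho>"
  shows "(branching_mechanism a0 ainf \<mu> has_real_derivative mechanism_derivative a0 ainf \<mu> \<rho>) (at \<rho>)"
    and "deriv (branching_mechanism a0 ainf \<mu>) \<rho> = mechanism_derivative a0 ainf \<mu> \<rho>"
    and "coag_rate (branching_mechanism a0 ainf \<mu>) (k + 2) \<rho> = mechanism_coeff a0 ainf \<mu> \<rho> (k + 2) * \<rho> ^ (k + 2)"
proof -
  let ?\<Psi> = "branching_mechanism a0 ainf \<mu>" and ?a = "\<lambda>n. (- 1) ^ n * mechanism_coeff a0 ainf \<mu> \<rho> n"
  have s: "(\<lambda>n. ?a n * u ^ n) sums ?\<Psi> (\<rho> + u)" if "\<bar>u\<bar> < \<rho>" for u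
    using mechanism_power_series[OF lt \<rho>, of u] that by simp
  have "((\<lambda>u. ?\<Psi> (\<rho> + u)) has_real_derivative ?a 1) (at 0)"
    by (rule higher_deriv_power_series(2)[OF \<rho> s])
  then show d: "(?\<Psi> has_real_derivative mechanism_derivative a0 ainf \<mu> \<rho>) (at \<rho>)"
    using DERIV_shift[of ?\<Psi> "?a 1" 0 \<rho>] by (simp add: add.commute mechanism_coeff_def)
  then show "deriv ?\<Psi> \<rho> = mechanism_derivative a0 ainf \<mu> \<rho>" by (rule DERIV_imp_deriv)
  have "(deriv ^^ n) ?\<Psi> \<rho> = fact n * ?a n" for n
    using higher_deriv_power_series(1)[OF \<rho> s, of n] by (simp add: higher_deriv_shift)
  then have "coag_rate ?\<Psi> n \<rho> = (- \<rho>) ^ n * ?a n" for n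
    by (simp add: coag_rate_def)
  also have "(- \<rho>) ^ n * ?a n = mechanism_coeff a0 ainf \<mu> \<rho> n * \<rho> ^ n" for n
  proof -
    have "(- \<rho>) ^ n * ?a n = ((- 1) ^ n * (- 1) ^ n) * (mechanism_coeff a0 ainf \<mu> \<rho> n * \<rho> ^ n)"
      by (simp only: power_minus[of \<rho>] mult_ac)
    also have "(- 1) ^ n * (- 1) ^ n = (1 :: real)" by (simp flip: power_mult_distrib)
    finally show ?thesis by simp
  qed
  finally show "coag_rate ?\<Psi> (k + 2) \<rho> = mechanism_coeff a0 ainf \<mu> \<rho> (k + 2) * \<rho> ^ (k + 2)" .
qed

subsection \<open>The limit of the derivative at infinity\<close>

lemma filterlim_at_top_of_mono:
  fixes f :: "real \<Rightarrow> real"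
  assumes mono: "\<And>a b. 0 < a \<Longrightarrow> a \<le> b \<Longrightarrow> f a \<le> f b" and unb: "\<And>Z. \<exists>a>0. Z \<le> f a"
  shows "filterlim f at_top at_top"
  unfolding filterlim_at_top
proof
  fix Z
  obtain a where a: "0 < a" "Z \<le> f a" using unb by blast
  have "Z \<le> f x" if "a \<le> x" for x using mono[OF a(1) that] a(2) by simp
  then show "\<forall>\<^sub>F x in at_top. Z \<le> f x"
    by (rule eventually_mono[OF eventually_ge_at_top])
qed

lemma nn_integral_bernstein_limit:
  assumes l: "levy_measure \<mu>"
  shows "(\<lambda>n. \<integral>\<^sup>+x. ennreal (1 - exp (- real n * x)) \<partial>\<mu>) \<longlonglongrightarrow> (\<integral>\<^sup>+x. 1 \<partial>\<mu>)"
proof -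
  have ind: "(\<integral>\<^sup>+x. f x * indicator (space \<mu>) x \<partial>\<mu>) = (\<integral>\<^sup>+x. f x \<partial>\<mu>)" for f
    by (rule nn_integral_cong) simp
  have "(\<lambda>n. \<integral>\<^sup>+x. ennreal (1 - exp (- real n * x)) * indicator (space \<mu>) x \<partial>\<mu>)
      \<longlonglongrightarrow> (\<integral>\<^sup>+x. 1 * indicator (space \<mu>) x \<partial>\<mu>)"
  proof (rule nn_integral_LIMSEQ)
    note ms = measurable_pos_borel[OF levy_measure_sets[OF l]]
    have pos: "0 < x" if "x \<in> space \<mu>" for x using that levy_measure_space[OF l] by simp
    show "incseq (\<lambda>n x. ennreal (1 - exp (- real n * x)) * indicator (space \<mu>) x)"
      using pos by (auto simp: incseq_def le_fun_def indicator_def intro!: ennreal_leI mult_right_mono)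
    show "(\<lambda>x. ennreal (1 - exp (- real n * x)) * indicator (space \<mu>) x) \<in> borel_measurable \<mu>" for n
      by (intro borel_measurable_times_ennreal ms borel_measurable_indicator) measurable
    show "(\<lambda>n. ennreal (1 - exp (- real n * x)) * indicator (space \<mu>) x) \<longlonglongrightarrow> 1 * indicator (space \<mu>) x" for x
    proof (cases "x \<in> space \<mu>")
      case True
      then have x: "0 < x" by (rule pos)
      have "(\<lambda>n. exp (- x * real n)) \<longlonglongrightarrow> 0"
        by (rule filterlim_compose[OF exp_neg_linear_at_top[OF x] filterlim_real_sequentially])
      then have "(\<lambda>n. 1 - exp (- real n * x)) \<longlonglongrightarrow> 1 - 0"
        by (intro tendsto_intros) (simp add: mult.commute)
      then have "(\<lambda>n. ennreal (1 - exp (- real n * x))) \<longlonglongrightarrow> ennreal 1"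
        by (intro tendsto_ennrealI) simp
      then show ?thesis using True by simp
    qed simp
  qed
  then show ?thesis unfolding ind .
qed

text \<open>Under the stated alternative \<open>\<Psi>'\<close> is unbounded; otherwise \<open>\<mu>\<close> is finite and \<open>\<Psi>'(\<infinity>) = \<alpha>\<^sub>\<infinity> + \<mu>(0,\<infinity>)\<close>
  by dominated convergence.\<close>

lemma mechanism_derivative_limit:
  assumes lt: "levy_triple a0 ainf \<mu>"
  obtains L :: ereal where "((\<lambda>q. ereal (mechanism_derivative a0 ainf \<mu> q)) \<longlongrightarrow> L) at_top"
    "L = \<infinity> \<longleftrightarrow> a0 > 0 \<or> (\<integral>\<^sup>+x. 1 \<partial>\<mu>) = \<infinity>" "0 \<le> L"
proof -
  note l = levy_triple_measure[OF lt]
  have a: "0 \<le> a0" "0 \<le> ainf" using lt by (auto simp: levy_triple_def)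
  let ?D = "mechanism_derivative a0 ainf \<mu>" and ?I = "\<lambda>q. \<integral>x. (1 - exp (- q * x)) \<partial>\<mu>"
  have pos: "0 < x" if "x \<in> space \<mu>" for x using that levy_measure_space[OF l] by simp
  have In: "0 \<le> ?I q" if "0 \<le> q" for q
    using that by (intro Bochner_Integration.integral_nonneg) (auto dest!: pos)
  have enn: "(\<integral>\<^sup>+x. ennreal (1 - exp (- q * x)) \<partial>\<mu>) = ennreal (?I q)" if "0 \<le> q" for q
    using that by (intro nn_integral_eq_integral[OF integrable_bernstein_integrand[OF l that]] AE_I2) (auto dest!: pos)
  note lim = nn_integral_bernstein_limit[OF l, unfolded enn[OF of_nat_0_le_iff]]
  have D_mono: "?D q \<le> ?D q'" if "0 < q" "q \<le> q'" for q q' using that mechanism_derivative_mono[OF lt] by simp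
  show thesis
  proof (cases "a0 > 0 \<or> (\<integral>\<^sup>+x. 1 \<partial>\<mu>) = \<infinity>")
    case True
    have "\<exists>q>0. Z \<le> ?D q" for Z
    proof (cases "a0 > 0")
      case a0: True
      define q where "q = max 1 (Z / a0)"
      have "0 < q" by (simp add: q_def)
      have "Z \<le> a0 * q" using a0 by (simp add: q_def max_def field_simps)
      then have "Z \<le> ?D q" using In[of q] a \<open>0 < q\<close> by (simp add: mechanism_derivative_def)
      then show ?thesis using \<open>0 < q\<close> by blast
    next
      case False
      then have "(\<lambda>n. ennreal (?I (real n))) \<longlonglongrightarrow> \<infinity>" using lim True by simp
      then have "\<forall>\<^sub>F n in sequentially. ennreal (max Z 0) < ennreal (?I (real n))"
        by (rule order_tendstoD) simp
      then obtain n where "ennreal (max Z 0) < ennreal (?I (real n))" "n > 0"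
        by (metis (mono_tags, lifting) eventually_conj eventually_gt_at_top eventually_happens trivial_limit_sequentially)
      then have "max Z 0 < ?I (real n)" by (subst (asm) ennreal_less_iff) auto
      moreover have "0 \<le> a0 * real n" using a by simp
      ultimately have "Z \<le> ?D (real n)" using a unfolding mechanism_derivative_def by linarith
      then show ?thesis using \<open>n > 0\<close> by (intro exI[of _ "real n"]) simp
    qed
    then have "filterlim ?D at_top at_top" using filterlim_at_top_of_mono[of ?D] D_mono by blast
    then have "((\<lambda>q. ereal (?D q)) \<longlongrightarrow> \<infinity>) at_top" by (simp add: tendsto_PInfty_eq_at_top)
    with True show thesis by (intro that[of \<infinity>]) auto
  next
    case False
    then have a0: "a0 = 0" and fin: "(\<integral>\<^sup>+x. 1 \<partial>\<mu>) \<noteq> \<infinity>" using a by auto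
    then have i1: "integrable \<mu> (\<lambda>x. 1 :: real)" by (intro integrableI_bounded) (auto simp: less_top)
    have "(?I \<longlongrightarrow> (\<integral>x. 1 \<partial>\<mu>)) at_top"
    proof (rule integral_dominated_convergence_at_top[where w = "\<lambda>_. 1"])
      show "\<forall>\<^sub>F q in at_top. AE x in \<mu>. norm (1 - exp (- q * x)) \<le> 1"
        using eventually_ge_at_top[of "0::real"]
      proof eventually_elim
        case (elim q)
        show ?case
        proof (rule AE_I2)
          fix x assume "x \<in> space \<mu>"
          then have "0 \<le> q * x" using pos elim by (simp add: less_imp_le)
          then show "norm (1 - exp (- q * x)) \<le> 1" using one_minus_exp_bounds[of "q * x"] by simp
        qed
      qed
      show "AE x in \<mu>. ((\<lambda>q. 1 - exp (- q * x)) \<longlongrightarrow> 1) at_top"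
      proof (rule AE_I2)
        fix x assume "x \<in> space \<mu>"
        then have x: "0 < x" by (rule pos)
        have "((\<lambda>q. 1 - exp (- x * q)) \<longlongrightarrow> 1 - 0) at_top"
          by (intro tendsto_diff tendsto_const exp_neg_linear_at_top x)
        then show "((\<lambda>q. 1 - exp (- q * x)) \<longlongrightarrow> 1) at_top" by (simp add: mult.commute)
      qed
      show "(\<lambda>x. 1 - exp (- q * x)) \<in> borel_measurable \<mu>" for q
        by (rule measurable_pos_borel[OF levy_measure_sets[OF l]]) measurable
    qed (use i1 in auto)
    then have "((\<lambda>q. ainf + ?I q) \<longlongrightarrow> ainf + (\<integral>x. 1 \<partial>\<mu>)) at_top" by (intro tendsto_intros)
    then have "(?D \<longlongrightarrow> ainf + (\<integral>x. 1 \<partial>\<mu>)) at_top" by (simp add: mechanism_derivative_def[abs_def] a0)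
    then have "((\<lambda>q. ereal (?D q)) \<longlongrightarrow> ereal (ainf + (\<integral>x. 1 \<partial>\<mu>))) at_top" by simp
    moreover have "0 \<le> ainf + (\<integral>x. 1 \<partial>\<mu>)" using a by (intro add_nonneg_nonneg Bochner_Integration.integral_nonneg) auto
    ultimately show thesis using False by (intro that[of "ereal (ainf + (\<integral>x. 1 \<partial>\<mu>))"]) auto
  qed
qed

lemma mechanism_derivative_le_limit:
  assumes lt: "levy_triple a0 ainf \<mu>" and L: "((\<lambda>q. ereal (mechanism_derivative a0 ainf \<mu> q)) \<longlongrightarrow> L) at_top"
    and q: "0 \<le> q"
  shows "ereal (mechanism_derivative a0 ainf \<mu> q) \<le> L"
proof (rule tendsto_lowerbound[OF L])
  show "\<forall>\<^sub>F x in at_top. ereal (mechanism_derivative a0 ainf \<mu> q) \<le> ereal (mechanism_derivative a0 ainf \<mu> x)"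
    using eventually_ge_at_top[of q] by eventually_elim (simp add: mechanism_derivative_mono[OF lt q])
qed simp

lemma mechanism_derivative_tendsto_at_0:
  assumes lt: "levy_triple a0 ainf \<mu>"
  shows "(mechanism_derivative a0 ainf \<mu> \<longlongrightarrow> ainf) (at_right 0)"
proof -
  note l = levy_triple_measure[OF lt]
  let ?D = "mechanism_derivative a0 ainf \<mu>" and ?I = "\<lambda>q. \<integral>x. (1 - exp (- q * x)) \<partial>\<mu>"
  have pos: "0 < x" if "x \<in> space \<mu>" for x using that levy_measure_space[OF l] by simp
  have seq: "(\<lambda>n. ?D (1 / real (Suc n))) \<longlonglongrightarrow> ainf"
  proof -
    have "(\<lambda>n. ?I (1 / real (Suc n))) \<longlonglongrightarrow> (\<integral>x. 0 \<partial>\<mu>)"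
    proof (rule integral_dominated_convergence[where w = "\<lambda>x. 2 * min x 1"])
      show "integrable \<mu> (\<lambda>x. 2 * min x 1)"
        by (intro integrable_mult_right levy_integrable[OF l, of _ 1]) auto
      show "AE x in \<mu>. norm (1 - exp (- (1 / real (Suc n)) * x)) \<le> 2 * min x 1" for n
      proof (rule AE_I2)
        fix x assume "x \<in> space \<mu>"
        then have x: "0 < x" by (rule pos)
        have "\<bar>1 - exp (- (1 / real (Suc n)) * x)\<bar> \<le> (1 + 1 / real (Suc n)) * min x 1"
          by (rule bernstein_integrand_bound) (use x in auto)
        also have "\<dots> \<le> 2 * min x 1" using x by (intro mult_right_mono) auto
        finally show "norm (1 - exp (- (1 / real (Suc n)) * x)) \<le> 2 * min x 1" by simp
      qed
      show "AE x in \<mu>. (\<lambda>n. 1 - exp (- (1 / real (Suc n)) * x)) \<longlonglongrightarrow> 0"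
      proof (rule AE_I2)
        fix x
        have "(\<lambda>n. 1 - exp (- (1 / real (Suc n)) * x)) \<longlonglongrightarrow> 1 - exp (- 0 * x)"
          by (intro tendsto_intros LIMSEQ_Suc[OF lim_1_over_n])
        then show "(\<lambda>n. 1 - exp (- (1 / real (Suc n)) * x)) \<longlonglongrightarrow> 0" by simp
      qed
      show "(\<lambda>x. 1 - exp (- (1 / real (Suc n)) * x)) \<in> borel_measurable \<mu>" for n
        by (rule measurable_pos_borel[OF levy_measure_sets[OF l]]) measurable
    qed simp
    moreover have "(\<lambda>n. a0 * (1 / real (Suc n)) + ainf) \<longlonglongrightarrow> a0 * 0 + ainf"
      by (intro tendsto_intros LIMSEQ_Suc[OF lim_1_over_n])
    ultimately have "(\<lambda>n. a0 * (1 / real (Suc n)) + ainf + ?I (1 / real (Suc n))) \<longlonglongrightarrow> a0 * 0 + ainf + (\<integral>x. 0 \<partial>\<mu>)"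
      by (rule tendsto_add[rotated])
    then show ?thesis by (simp add: mechanism_derivative_def)
  qed
  show ?thesis
  proof (rule order_tendstoI)
    fix a assume "a < ainf"
    have "a < ?D q" if "0 < q" for q
      using mechanism_derivative_mono[OF lt order_refl, of q] that \<open>a < ainf\<close>
      by (simp add: mechanism_derivative_def)
    then show "\<forall>\<^sub>F q in at_right 0. a < ?D q"
      using eventually_at_right_less[of 0] by (auto elim: eventually_mono)
  next
    fix a assume "ainf < a"
    then have "\<forall>\<^sub>F n in sequentially. ?D (1 / real (Suc n)) < a" using seq by (intro order_tendstoD)
    then obtain n where n: "?D (1 / real (Suc n)) < a" using eventually_happens trivial_limit_sequentially by blast
    have "\<forall>\<^sub>F q in at_right 0. 0 < q \<and> q < 1 / real (Suc n)"
      unfolding eventually_at_right_field by (intro exI[of _ "1 / real (Suc n)"]) auto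
    then show "\<forall>\<^sub>F q in at_right 0. ?D q < a"
    proof eventually_elim
      case (elim q)
      then have "?D q \<le> ?D (1 / real (Suc n))" by (intro mechanism_derivative_mono[OF lt]) auto
      with n show ?case by simp
    qed
  qed
qed

text \<open>The inequality holds pointwise for the integrands, because \<open>4 (e\<^sup>-\<^sup>v - 1 + v) - (e\<^sup>-\<^sup>2\<^sup>v - 1 + 2 v)\<close> has
  derivative \<open>2 (1 - e\<^sup>-\<^sup>v)\<^sup>2\<close>.  It shows that \<open>\<Psi>\<close> vanishes identically once it has a positive zero.\<close>

lemma branching_mechanism_double:
  assumes lt: "levy_triple a0 ainf \<mu>" and q: "0 \<le> q"
  shows "branching_mechanism a0 ainf \<mu> (2 * q) \<le> 4 * branching_mechanism a0 ainf \<mu> q"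
proof -
  note l = levy_triple_measure[OF lt]
  have key: "exp (- (2 * v)) - 1 + 2 * v \<le> 4 * (exp (- v) - 1 + v)" if "0 \<le> v" for v :: real
  proof -
    have "(\<lambda>v. 4 * (exp (- v) - 1 + v) - (exp (- (2 * v)) - 1 + 2 * v)) 0
        \<le> (\<lambda>v::real. 4 * (exp (- v) - 1 + v) - (exp (- (2 * v)) - 1 + 2 * v)) v"
    proof (rule DERIV_nonneg_imp_nondecreasing[OF that])
      fix x :: real
      have sq: "exp (- (2 * x)) = exp (- x) * exp (- x)" by (simp add: mult_exp_exp)
      have "4 * (- exp (- x) + 1) - (- 2 * exp (- (2 * x)) + 2) = 2 * (1 - exp (- x))\<^sup>2"
        unfolding sq by (simp add: power2_eq_square algebra_simps)
      then have "0 \<le> 4 * (- exp (- x) + 1) - (- 2 * exp (- (2 * x)) + 2)" by simp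
      then show "\<exists>y. ((\<lambda>v. 4 * (exp (- v) - 1 + v) - (exp (- (2 * v)) - 1 + 2 * v)) has_real_derivative y) (at x) \<and> 0 \<le> y"
        by (intro exI[of _ "4 * (- exp (- x) + 1) - (- 2 * exp (- (2 * x)) + 2)"] conjI)
           (auto intro!: derivative_eq_intros)
    qed
    then show ?thesis by simp
  qed
  let ?\<psi> = "\<lambda>q x. (exp (- q * x) - 1 + q * x) / x"
  have q2: "0 \<le> 2 * q" using q by simp
  have "(\<integral>x. ?\<psi> (2 * q) x \<partial>\<mu>) \<le> (\<integral>x. 4 * ?\<psi> q x \<partial>\<mu>)"
  proof (rule integral_mono[OF integrable_mechanism_integrand[OF l q2]
        integrable_mult_right[OF integrable_mechanism_integrand[OF l q]]])
    fix x assume "x \<in> space \<mu>"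
    then have x: "0 < x" using levy_measure_space[OF l] by simp
    have "exp (- (2 * q) * x) - 1 + 2 * q * x \<le> 4 * (exp (- q * x) - 1 + q * x)"
      using key[of "q * x"] q x by (simp add: mult.assoc)
    from divide_right_mono[OF this, of x] x
    show "?\<psi> (2 * q) x \<le> 4 * ?\<psi> q x" by simp
  qed
  then have I: "(\<integral>x. ?\<psi> (2 * q) x \<partial>\<mu>) \<le> 4 * (\<integral>x. ?\<psi> q x \<partial>\<mu>)" by (simp only: integral_mult_right_zero)
  have "ainf * (2 * q) \<le> 4 * (ainf * q)" using lt q by (simp add: levy_triple_def)
  with I show ?thesis by (simp add: branching_mechanism_def power2_eq_square) 
qed

lemma branching_mechanism_vanishes:
  assumes lt: "levy_triple a0 ainf \<mu>" and c: "0 < c" "branching_mechanism a0 ainf \<mu> c = 0" and u: "0 \<le> u"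
  shows "branching_mechanism a0 ainf \<mu> u = 0"
proof -
  let ?\<Psi> = "branching_mechanism a0 ainf \<mu>"
  have z: "?\<Psi> (2 ^ n * c) \<le> 0" for n
  proof (induction n)
    case (Suc n)
    have "?\<Psi> (2 * (2 ^ n * c)) \<le> 4 * ?\<Psi> (2 ^ n * c)"
      by (rule branching_mechanism_double[OF lt]) (use c in simp)
    with Suc show ?case by (simp add: mult.assoc)
  qed (use c in simp)
  obtain n where "u / c < 2 ^ n" using real_arch_pow[of 2 "u / c"] by auto
  then have "u \<le> 2 ^ n * c" using c by (simp add: pos_divide_less_eq)
  then have "?\<Psi> u \<le> 0" using branching_mechanism_mono[OF lt u] z order_trans by blast
  with branching_mechanism_nonneg[OF lt u] show ?thesis by simp
qed

section \<open>The branching flow\<close>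

locale branching_flow_setup =
  fixes a0 ainf :: real and \<mu> :: "real measure" and \<phi> :: "real \<Rightarrow> real \<Rightarrow> real"
  assumes lt: "levy_triple a0 ainf \<mu>"
    and flow: "branching_flow (branching_mechanism a0 ainf \<mu>) \<phi>"
begin

abbreviation "\<Psi> \<equiv> branching_mechanism a0 ainf \<mu>"
abbreviation "D \<equiv> mechanism_derivative a0 ainf \<mu>"

lemma flow_0: "0 < q \<Longrightarrow> \<phi> q 0 = q"
  using flow by (simp add: branching_flow_def)

lemma flow_nonneg: "0 < q \<Longrightarrow> 0 \<le> t \<Longrightarrow> 0 \<le> \<phi> q t"
  using flow by (simp add: branching_flow_def)

lemma flow_deriv_within:
  "0 < q \<Longrightarrow> 0 \<le> t \<Longrightarrow> (\<phi> q has_real_derivative - \<Psi> (\<phi> q t)) (at t within {0..})"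
  using flow by (simp add: branching_flow_def)

lemma flow_deriv:
  assumes "0 < q" "0 < t" shows "(\<phi> q has_real_derivative - \<Psi> (\<phi> q t)) (at t)"
proof -
  have "(\<phi> q has_real_derivative - \<Psi> (\<phi> q t)) (at t within {0<..})"
    by (rule DERIV_subset[OF flow_deriv_within]) (use assms in auto)
  then show ?thesis using at_within_open[of t "{0<..}"] assms by simp
qed

lemma flow_continuous: "0 < q \<Longrightarrow> continuous_on {0..} (\<phi> q)"
  by (rule DERIV_continuous_on[OF flow_deriv_within]) auto

lemma flow_decreasing:
  assumes q: "0 < q" and "0 \<le> s" "s \<le> t" shows "\<phi> q t \<le> \<phi> q s"
proof (rule DERIV_nonpos_imp_decreasing_open[OF \<open>s \<le> t\<close>])
  fix x assume x: "s < x" "x < t"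
  then have "0 \<le> \<Psi> (\<phi> q x)" using assms by (intro branching_mechanism_nonneg[OF lt] flow_nonneg) auto
  then show "\<exists>y. (\<phi> q has_real_derivative y) (at x) \<and> y \<le> 0"
    using flow_deriv[OF q, of x] x assms by (intro exI[of _ "- \<Psi> (\<phi> q x)"]) auto
next
  show "continuous_on {s..t} (\<phi> q)"
    by (rule continuous_on_subset[OF flow_continuous[OF q]]) (use assms in auto)
qed

lemma flow_le: "0 < q \<Longrightarrow> 0 \<le> t \<Longrightarrow> \<phi> q t \<le> q"
  using flow_decreasing[of q 0 t] flow_0 by simp

text \<open>The function \<open>s \<mapsto> \<phi>(q,s) e\<^sup>c\<^sup>s\<close> is increasing.\<close>

lemma flow_ge_exp:
  assumes q: "0 < q" and t: "0 \<le> t" and c: "\<And>s. 0 < s \<Longrightarrow> s < t \<Longrightarrow> \<Psi> (\<phi> q s) \<le> c * \<phi> q s"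
  shows "q * exp (- c * t) \<le> \<phi> q t"
proof -
  have "\<phi> q 0 * exp (c * 0) \<le> \<phi> q t * exp (c * t)"
  proof (rule DERIV_nonneg_imp_increasing_open[OF t])
    fix x assume x: "0 < x" "x < t"
    have "0 \<le> (c * \<phi> q x - \<Psi> (\<phi> q x)) * exp (c * x)" using c[OF x] by simp
    then show "\<exists>y. ((\<lambda>s. \<phi> q s * exp (c * s)) has_real_derivative y) (at x) \<and> 0 \<le> y"
      by (intro exI[of _ "(c * \<phi> q x - \<Psi> (\<phi> q x)) * exp (c * x)"] conjI)
         (auto intro!: derivative_eq_intros flow_deriv q x simp: algebra_simps)
  next
    show "continuous_on {0..t} (\<lambda>s. \<phi> q s * exp (c * s))"
      by (intro continuous_intros continuous_on_subset[OF flow_continuous[OF q]]) auto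
  qed
  then show ?thesis using flow_0[OF q] by (simp add: exp_minus field_simps)
qed

text \<open>The function \<open>s \<mapsto> \<phi>(q,s) e\<^sup>c\<^sup>s\<close> is decreasing.\<close>

lemma flow_le_exp:
  assumes q: "0 < q" and t: "0 \<le> t" and c: "\<And>s. 0 < s \<Longrightarrow> s < t \<Longrightarrow> c * \<phi> q s \<le> \<Psi> (\<phi> q s)"
  shows "\<phi> q t \<le> q * exp (- c * t)"
proof -
  have "\<phi> q t * exp (c * t) \<le> \<phi> q 0 * exp (c * 0)"
  proof (rule DERIV_nonpos_imp_decreasing_open[OF t])
    fix x assume x: "0 < x" "x < t"
    have "(c * \<phi> q x - \<Psi> (\<phi> q x)) * exp (c * x) \<le> 0" using c[OF x] by (simp add: mult_nonpos_nonneg)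
    then show "\<exists>y. ((\<lambda>s. \<phi> q s * exp (c * s)) has_real_derivative y) (at x) \<and> y \<le> 0"
      by (intro exI[of _ "(c * \<phi> q x - \<Psi> (\<phi> q x)) * exp (c * x)"] conjI)
         (auto intro!: derivative_eq_intros flow_deriv q x simp: algebra_simps)
  next
    show "continuous_on {0..t} (\<lambda>s. \<phi> q s * exp (c * s))"
      by (intro continuous_intros continuous_on_subset[OF flow_continuous[OF q]]) auto
  qed
  then show ?thesis using flow_0[OF q] by (simp add: exp_minus field_simps)
qed

lemma mechanism_le_linear: "0 \<le> y \<Longrightarrow> \<Psi> y \<le> D y * y"
  using mechanism_increment(2)[OF lt order_refl, of y] by (simp add: mult.commute)

lemma flow_pos:
  assumes q: "0 < q" and t: "0 \<le> t" shows "0 < \<phi> q t"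
proof -
  have "q * exp (- D q * t) \<le> \<phi> q t"
  proof (rule flow_ge_exp[OF q t])
    fix s assume s: "0 < s" "s < t"
    then have f: "0 \<le> \<phi> q s" "\<phi> q s \<le> q" using flow_nonneg flow_le q by auto
    have "D (\<phi> q s) * \<phi> q s \<le> D q * \<phi> q s" by (intro mult_right_mono mechanism_derivative_mono[OF lt] f)
    then show "\<Psi> (\<phi> q s) \<le> D q * \<phi> q s" using mechanism_le_linear[OF f(1)] by simp
  qed
  moreover have "0 < q * exp (- D q * t)" using q by simp
  ultimately show ?thesis by linarith
qed

end

lemma bernstein_integral_mono:
  assumes l: "levy_measure \<nu>" and q: "0 \<le> q" "q \<le> q'"
  shows "(\<integral>x. (1 - exp (- q * x)) \<partial>\<nu>) \<le> (\<integral>x. (1 - exp (- q' * x)) \<partial>\<nu>)"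
  by (rule integral_mono) (use q integrable_bernstein_integrand[OF l] levy_measure_space[OF l] in auto)

text \<open>The drift is recovered as the asymptotic slope, since \<open>(1 - e\<^sup>-\<^sup>n\<^sup>x) / n\<close> tends to \<open>0\<close> and is at most \<open>x \<and> 1\<close>.\<close>

lemma bernstein_representation_slope:
  assumes rep: "bernstein_representation F b \<nu>"
  shows "(\<lambda>n. F (real (Suc n)) / real (Suc n)) \<longlonglongrightarrow> b"
proof -
  have l: "levy_measure \<nu>" and F: "\<And>q. 0 < q \<Longrightarrow> F q = b * q + (\<integral>x. (1 - exp (- q * x)) \<partial>\<nu>)"
    using rep by (auto simp: bernstein_representation_def)
  have "(\<lambda>n. \<integral>x. (1 - exp (- real (Suc n) * x)) / real (Suc n) \<partial>\<nu>) \<longlonglongrightarrow> (\<integral>x. 0 \<partial>\<nu>)"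
  proof (rule integral_dominated_convergence[where w = "\<lambda>x. min x 1"])
    show "integrable \<nu> (\<lambda>x. min x 1)" by (rule levy_integrable[OF l, of _ 1]) auto
    show "AE x in \<nu>. norm ((1 - exp (- real (Suc n) * x)) / real (Suc n)) \<le> min x 1" for n
    proof (rule AE_I2)
      fix x assume "x \<in> space \<nu>"
      then have x: "0 < x" using levy_measure_space[OF l] by simp
      let ?e = "1 - exp (- real (Suc n) * x)"
      have b: "0 \<le> ?e" "?e \<le> real (Suc n) * x" "?e \<le> 1"
        using one_minus_exp_bounds[of "real (Suc n) * x"] x by (simp_all del: of_nat_Suc)
      have "?e / real (Suc n) \<le> x" using b(2) by (simp only: pos_divide_le_eq of_nat_0_less_iff mult.commute zero_less_Suc)
      moreover have "?e / real (Suc n) \<le> 1 / 1" using b by (intro frac_le) auto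
      moreover have "norm (?e / real (Suc n)) = ?e / real (Suc n)" using b(1) by simp
      ultimately show "norm (?e / real (Suc n)) \<le> min x 1" by simp
    qed
    show "AE x in \<nu>. (\<lambda>n. (1 - exp (- real (Suc n) * x)) / real (Suc n)) \<longlonglongrightarrow> 0"
    proof (rule AE_I2)
      fix x assume "x \<in> space \<nu>"
      then have x: "0 < x" using levy_measure_space[OF l] by simp
      show "(\<lambda>n. (1 - exp (- real (Suc n) * x)) / real (Suc n)) \<longlonglongrightarrow> 0"
      proof (rule tendsto_sandwich)
        show "\<forall>\<^sub>F n in sequentially. 0 \<le> (1 - exp (- real (Suc n) * x)) / real (Suc n)"
          by (intro always_eventually allI divide_nonneg_nonneg) (use x in \<open>simp_all del: of_nat_Suc\<close>)
        show "\<forall>\<^sub>F n in sequentially. (1 - exp (- real (Suc n) * x)) / real (Suc n) \<le> 1 / real (Suc n)"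
          by (intro always_eventually allI divide_right_mono) auto
        show "(\<lambda>n. 1 / real (Suc n)) \<longlonglongrightarrow> 0" by (rule LIMSEQ_Suc[OF lim_1_over_n])
      qed simp
    qed
    show "(\<lambda>x. (1 - exp (- real (Suc n) * x)) / real (Suc n)) \<in> borel_measurable \<nu>" for n
      by (rule measurable_pos_borel[OF levy_measure_sets[OF l]]) measurable
  qed simp
  then have "(\<lambda>n. b + (\<integral>x. (1 - exp (- real (Suc n) * x)) / real (Suc n) \<partial>\<nu>)) \<longlonglongrightarrow> b + 0"
    by (intro tendsto_intros) simp
  moreover have "F (real (Suc n)) / real (Suc n) = b + (\<integral>x. (1 - exp (- real (Suc n) * x)) / real (Suc n) \<partial>\<nu>)" for n
    by (simp add: F add_divide_distrib del: of_nat_Suc)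
  ultimately show ?thesis by simp
qed

lemma bernstein_representation_mono:
  assumes rep: "bernstein_representation F b \<nu>" and q: "0 < q" "q \<le> q'"
  shows "F q \<le> F q'"
proof -
  have "b * q \<le> b * q'" using rep q by (intro mult_left_mono) (auto simp: bernstein_representation_def)
  then show ?thesis
    using rep q bernstein_integral_mono[of \<nu> q q'] by (simp add: bernstein_representation_def add_mono)
qed

lemma bernstein_representation_ge_drift:
  assumes rep: "bernstein_representation F b \<nu>" and q: "0 < q"
  shows "b * q \<le> F q"
proof -
  have l: "levy_measure \<nu>" using rep by (simp add: bernstein_representation_def)
  have "0 \<le> (\<integral>x. (1 - exp (- q * x)) \<partial>\<nu>)"
    using q levy_measure_space[OF l] by (intro Bochner_Integration.integral_nonneg) simp
  then show ?thesis using rep q by (simp add: bernstein_representation_def)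
qed

lemma ennreal_tendsto_at_top_of_mono:
  fixes f :: "real \<Rightarrow> ennreal"
  assumes mono: "\<And>a b. 0 < a \<Longrightarrow> a \<le> b \<Longrightarrow> f a \<le> f b" and lim: "(\<lambda>n. f (real n)) \<longlonglongrightarrow> l"
  shows "(f \<longlongrightarrow> l) at_top"
proof (rule order_tendstoI)
  fix a assume "a < l"
  then have "\<forall>\<^sub>F n in sequentially. a < f (real n) \<and> 0 < n"
    using order_tendstoD(1)[OF lim] eventually_gt_at_top[of 0] by (auto intro: eventually_conj)
  then obtain n where n: "a < f (real n)" "0 < n"
    using eventually_happens trivial_limit_sequentially by blast
  show "\<forall>\<^sub>F x in at_top. a < f x"
    using eventually_ge_at_top[of "real n"]
    by eventually_elim (use n mono[of "real n"] in \<open>auto intro: less_le_trans\<close>)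
next
  fix a assume "l < a"
  have le: "f q \<le> l" if "0 < q" for q
  proof (rule tendsto_lowerbound[OF lim])
    obtain m where m: "q \<le> real m" using real_arch_simple by blast
    show "\<forall>\<^sub>F n in sequentially. f q \<le> f (real n)"
      using eventually_ge_at_top[of m] by eventually_elim (use m mono[OF that] in auto)
  qed simp
  show "\<forall>\<^sub>F x in at_top. f x < a"
    using eventually_gt_at_top[of "0::real"] by eventually_elim (use le \<open>l < a\<close> in \<open>auto intro: le_less_trans\<close>)
qed

text \<open>Thus finiteness of \<open>\<phi>(\<infinity>,t)\<close>, including the absence of a drift, is the same as boundedness of \<open>\<phi>(\<cdot>,t)\<close>.\<close>

lemma bernstein_representation_limit:
  assumes rep: "bernstein_representation F b \<nu>"
  defines "l \<equiv> if b = 0 then \<integral>\<^sup>+x. 1 \<partial>\<nu> else \<infinity>"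
  shows "((\<lambda>q. ennreal (F q)) \<longlongrightarrow> l) at_top"
    and "l = (\<integral>\<^sup>+x. 1 \<partial>\<nu>) \<and> (\<integral>\<^sup>+x. 1 \<partial>\<nu>) < \<infinity> \<longleftrightarrow> (\<exists>B. \<forall>q>0. F q \<le> B)"
    and "(\<exists>B. \<forall>q>0. F q \<le> B) \<Longrightarrow> b = 0"
proof -
  have lv: "levy_measure \<nu>" and b: "0 \<le> b"
    and F: "\<And>q. 0 < q \<Longrightarrow> F q = b * q + (\<integral>x. (1 - exp (- q * x)) \<partial>\<nu>)"
    using rep by (auto simp: bernstein_representation_def)
  have pos: "0 < x" if "x \<in> space \<nu>" for x using that levy_measure_space[OF lv] by simp
  have enn: "(\<integral>\<^sup>+x. ennreal (1 - exp (- q * x)) \<partial>\<nu>) = ennreal (\<integral>x. (1 - exp (- q * x)) \<partial>\<nu>)" if "0 \<le> q" for q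
    using that by (intro nn_integral_eq_integral[OF integrable_bernstein_integrand[OF lv that]] AE_I2) (auto dest!: pos)
  have mono: "ennreal (F q) \<le> ennreal (F q')" if "0 < q" "q \<le> q'" for q q'
    by (intro ennreal_leI bernstein_representation_mono[OF rep] that)
  show lim: "((\<lambda>q. ennreal (F q)) \<longlongrightarrow> l) at_top"
  proof (cases "b = 0")
    case True
    show ?thesis
    proof (rule ennreal_tendsto_at_top_of_mono[OF mono])
      have "\<forall>\<^sub>F n in sequentially. (\<integral>\<^sup>+x. ennreal (1 - exp (- real n * x)) \<partial>\<nu>) = ennreal (F (real n))"
        using eventually_gt_at_top[of 0]
      proof eventually_elim
        case (elim n)
        then have "F (real n) = (\<integral>x. (1 - exp (- real n * x)) \<partial>\<nu>)" using F[of "real n"] True by simp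
        then show ?case by (simp only: enn[OF of_nat_0_le_iff])
      qed
      then show "(\<lambda>n. ennreal (F (real n))) \<longlonglongrightarrow> l"
        using nn_integral_bernstein_limit[OF lv] True by (simp add: l_def tendsto_cong)
    qed
  next
    case False
    then have b: "0 < b" using b by simp
    have "filterlim F at_top at_top"
    proof (rule filterlim_at_top_mono)
      show "filterlim (\<lambda>q. b * q) at_top at_top"
        by (rule filterlim_tendsto_pos_mult_at_top[OF tendsto_const b filterlim_ident])
      show "\<forall>\<^sub>F q in at_top. b * q \<le> F q"
        using eventually_gt_at_top[of "0::real"] by eventually_elim (rule bernstein_representation_ge_drift[OF rep])
    qed
    then show ?thesis using False
      by (simp add: l_def ennreal_tendsto_top_eq_at_top)
  qed
  show b0: "b = 0" if bd: "\<exists>B. \<forall>q>0. F q \<le> B"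
  proof (rule ccontr)
    assume "b \<noteq> 0"
    then have bp: "0 < b" using b by simp
    obtain B where B: "\<And>q. 0 < q \<Longrightarrow> F q \<le> B" using bd by blast
    have "b * (\<bar>B\<bar> / b + 1) \<le> B"
      using bernstein_representation_ge_drift[OF rep, of "\<bar>B\<bar> / b + 1"] B[of "\<bar>B\<bar> / b + 1"] bp
      by (simp add: add_nonneg_pos)
    then show False using bp by (simp add: distrib_left)
  qed
  show "l = (\<integral>\<^sup>+x. 1 \<partial>\<nu>) \<and> (\<integral>\<^sup>+x. 1 \<partial>\<nu>) < \<infinity> \<longleftrightarrow> (\<exists>B. \<forall>q>0. F q \<le> B)"
  proof
    assume "\<exists>B. \<forall>q>0. F q \<le> B"
    then obtain B where B: "\<And>q. 0 < q \<Longrightarrow> F q \<le> B" by blast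
    have "b = 0" using b0 B by blast
    then have "l = (\<integral>\<^sup>+x. 1 \<partial>\<nu>)" by (simp add: l_def)
    moreover have "l \<le> ennreal B"
    proof (rule tendsto_upperbound[OF lim])
      show "\<forall>\<^sub>F q in at_top. ennreal (F q) \<le> ennreal B"
        using eventually_gt_at_top[of "0::real"] by eventually_elim (intro ennreal_leI B)
    qed simp
    ultimately show "l = (\<integral>\<^sup>+x. 1 \<partial>\<nu>) \<and> (\<integral>\<^sup>+x. 1 \<partial>\<nu>) < \<infinity>"
      by (auto intro: le_less_trans)
  next
    assume *: "l = (\<integral>\<^sup>+x. 1 \<partial>\<nu>) \<and> (\<integral>\<^sup>+x. 1 \<partial>\<nu>) < \<infinity>"
    then have "l < \<infinity>" by simp
    then obtain B where B: "l = ennreal B" "0 \<le> B" by (cases l) auto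
    have "F q \<le> B" if q: "0 < q" for q
    proof -
      have "ennreal (F q) \<le> ennreal B" unfolding B(1)[symmetric]
      proof (rule tendsto_lowerbound[OF lim])
        show "\<forall>\<^sub>F q' in at_top. ennreal (F q) \<le> ennreal (F q')"
          using eventually_ge_at_top[of q] by eventually_elim (rule mono[OF q])
      qed simp
      then show ?thesis using B(2) by (simp add: ennreal_le_iff)
    qed
    then show "\<exists>B. \<forall>q>0. F q \<le> B" by blast
  qed
qed

context branching_flow_setup
begin

text \<open>The drift of \<open>\<phi>(\<cdot>,t)\<close> is squeezed between \<open>e\<^sup>-\<^sup>L\<^sup>t\<close> and \<open>e\<^sup>-\<^sup>c\<^sup>t\<close> for all \<open>c < L = \<Psi>'(\<infinity>)\<close>.\<close>

lemma drift_ge: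
  assumes rep: "bernstein_representation (\<lambda>q. \<phi> q t) b \<nu>" and t: "0 \<le> t" and L: "\<And>q. 0 \<le> q \<Longrightarrow> D q \<le> L"
  shows "exp (- L * t) \<le> b"
proof (rule tendsto_lowerbound[OF bernstein_representation_slope[OF rep]])
  have "exp (- L * t) \<le> \<phi> q t / q" if q: "0 < q" for q
  proof -
    have "q * exp (- L * t) \<le> \<phi> q t"
    proof (rule flow_ge_exp[OF q t])
      fix s assume "0 < s" "s < t"
      then have f: "0 \<le> \<phi> q s" using flow_nonneg[OF q] by simp
      have "D (\<phi> q s) * \<phi> q s \<le> L * \<phi> q s" using L[OF f] f by (intro mult_right_mono)
      then show "\<Psi> (\<phi> q s) \<le> L * \<phi> q s" using mechanism_le_linear[OF f] by simp
    qed
    then show ?thesis using q by (simp add: pos_le_divide_eq mult.commute)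
  qed
  then show "\<forall>\<^sub>F n in sequentially. exp (- L * t) \<le> \<phi> (real (Suc n)) t / real (Suc n)" by simp
qed simp

text \<open>By convexity \<open>\<Psi>(y) \<ge> (y - a) \<Psi>'(a)\<close>, and \<open>y - a \<ge> (1 - 1 / a) y\<close> once \<open>y \<ge> a\<^sup>2\<close>.  A positive drift keeps the
  flow from large \<open>q\<close> above \<open>a\<^sup>2\<close> up to time \<open>t\<close>.\<close>

lemma drift_le:
  assumes rep: "bernstein_representation (\<lambda>q. \<phi> q t) b \<nu>" and t: "0 \<le> t" and b: "0 < b" and a: "1 < a"
  shows "b \<le> exp (- ((1 - 1 / a) * D a) * t)"
proof (rule tendsto_upperbound[OF bernstein_representation_slope[OF rep]])
  have "\<forall>\<^sub>F n in sequentially. a\<^sup>2 / b < real (Suc n)"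
    by (rule eventually_compose_filterlim[OF eventually_gt_at_top filterlim_compose[OF filterlim_real_sequentially filterlim_Suc]])
  then show "\<forall>\<^sub>F n in sequentially. \<phi> (real (Suc n)) t / real (Suc n) \<le> exp (- ((1 - 1 / a) * D a) * t)"
  proof eventually_elim
    case (elim n)
    let ?q = "real (Suc n)"
    have q: "0 < ?q" by simp
    have "a\<^sup>2 \<le> b * ?q" using elim b by (simp add: pos_divide_less_eq mult.commute)
    also have "\<dots> \<le> \<phi> ?q t" by (rule bernstein_representation_ge_drift[OF rep q])
    finally have big: "a\<^sup>2 \<le> \<phi> ?q t" .
    have "\<phi> ?q t \<le> ?q * exp (- ((1 - 1 / a) * D a) * t)"
    proof (rule flow_le_exp[OF q t])
      fix s assume s: "0 < s" "s < t"
      let ?y = "\<phi> ?q s"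
      have y: "a\<^sup>2 \<le> ?y" using flow_decreasing[OF q, of s t] s big by simp
      have "a * 1 \<le> a * a" using a by (intro mult_left_mono) auto
      then have ay: "a \<le> ?y" using y by (simp add: power2_eq_square)
      have Da: "0 \<le> D a" using a by (intro mechanism_derivative_nonneg[OF lt]) simp
      have h: "(1 - 1 / a) * ?y \<le> ?y - a"
        using y a by (simp add: field_simps power2_eq_square)
      have "(1 - 1 / a) * D a * ?y = (1 - 1 / a) * ?y * D a" by (simp only: mult_ac)
      also have "\<dots> \<le> (?y - a) * D a" by (rule mult_right_mono[OF h Da])
      also have "\<dots> \<le> \<Psi> ?y - \<Psi> a" using mechanism_increment(1)[OF lt _ ay] a by simp
      also have "\<dots> \<le> \<Psi> ?y" using branching_mechanism_nonneg[OF lt, of a] a by simp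
      finally show "(1 - 1 / a) * D a * ?y \<le> \<Psi> ?y" .
    qed
    then show ?case using q by (simp add: pos_divide_le_eq mult.commute)
  qed
qed simp

text \<open>A positive drift \<open>b\<close> would satisfy \<open>b \<le> e\<^sup>-\<^sup>c\<^sup>t\<close> for arbitrarily large \<open>c\<close>.\<close>

lemma drift_eq_0:
  assumes rep: "bernstein_representation (\<lambda>q. \<phi> q t) b \<nu>" and t: "0 < t"
    and L: "((\<lambda>q. ereal (D q)) \<longlongrightarrow> \<infinity>) at_top"
  shows "b = 0"
proof (rule ccontr)
  assume "b \<noteq> 0"
  then have b: "0 < b" using rep by (simp add: bernstein_representation_def)
  \<comment> \<open>large enough that \<open>e\<^sup>-\<^sup>Z\<^sup>t\<^sup>/\<^sup>2 < b\<close>\<close>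
  define Z where "Z = 2 * (\<bar>ln b\<bar> + 1) / t"
  have "\<forall>\<^sub>F a in at_top. Z \<le> D a \<and> 2 \<le> a"
    using L by (intro eventually_conj) (auto simp: tendsto_PInfty_eq_at_top filterlim_at_top eventually_ge_at_top)
  then obtain a where a: "Z \<le> D a" "2 \<le> a" using eventually_happens trivial_limit_at_top_linorder by blast
  have "1 / a \<le> 1 / 2" using a by (intro divide_left_mono) auto
  moreover have "0 \<le> Z" using t by (simp add: Z_def)
  ultimately have "1 / 2 * Z \<le> (1 - 1 / a) * D a" using a by (intro mult_mono) auto
  then have "1 / 2 * Z * t \<le> (1 - 1 / a) * D a * t" using t by (intro mult_right_mono) auto
  moreover have "1 / 2 * Z * t = \<bar>ln b\<bar> + 1" using t by (simp add: Z_def)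
  ultimately have le: "\<bar>ln b\<bar> + 1 \<le> (1 - 1 / a) * D a * t" by (simp only:)
  have "b \<le> exp (- ((1 - 1 / a) * D a) * t)" by (rule drift_le[OF rep _ b]) (use t a in auto)
  then have "ln b \<le> ln (exp (- ((1 - 1 / a) * D a) * t))" using b by (subst ln_le_cancel_iff) auto
  then show False using le by simp
qed

lemma drift_eq_exp:
  assumes rep: "bernstein_representation (\<lambda>q. \<phi> q t) b \<nu>" and t: "0 \<le> t"
    and L: "((\<lambda>q. ereal (D q)) \<longlongrightarrow> ereal L) at_top"
  shows "b = exp (- L * t)"
proof (rule antisym)
  have DL: "D q \<le> L" if "0 \<le> q" for q using mechanism_derivative_le_limit[OF lt L that] by simp
  show ge: "exp (- L * t) \<le> b" by (rule drift_ge[OF rep t DL])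
  then have b: "0 < b" by (rule less_le_trans[OF exp_gt_zero])
  show "b \<le> exp (- L * t)"
  proof (rule tendsto_lowerbound)
    have "((\<lambda>a::real. 1 / a) \<longlongrightarrow> 0) at_top"
      by (rule tendsto_divide_0[OF tendsto_const]) (rule filterlim_at_top_imp_at_infinity[OF filterlim_ident])
    then have "((\<lambda>a. exp (- ((1 - 1 / a) * D a) * t)) \<longlongrightarrow> exp (- ((1 - 0) * L) * t)) at_top"
      using L by (intro tendsto_intros) simp_all
    then show "((\<lambda>a. exp (- ((1 - 1 / a) * D a) * t)) \<longlongrightarrow> exp (- L * t)) at_top" by simp
    show "\<forall>\<^sub>F a in at_top. b \<le> exp (- ((1 - 1 / a) * D a) * t)"
      using eventually_gt_at_top[of "1::real"] by eventually_elim (rule drift_le[OF rep t b])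
  qed simp
qed

subsection \<open>Grey's condition\<close>

lemma mechanism_continuous: "continuous_on {0<..} \<Psi>"
  using branching_mechanism_derivs(1)[OF lt] by (intro DERIV_continuous_on[of _ _ D]) (auto intro: DERIV_subset)

lemma inverse_mechanism_continuous:
  assumes "0 < c" "0 < \<Psi> c" shows "continuous_on {c..} (\<lambda>u. 1 / \<Psi> u)"
proof (rule continuous_on_divide)
  show "continuous_on {c..} \<Psi>" by (rule continuous_on_subset[OF mechanism_continuous]) (use assms in auto)
  show "\<forall>u\<in>{c..}. \<Psi> u \<noteq> 0"
  proof
    fix u assume "u \<in> {c..}"
    then have "\<Psi> c \<le> \<Psi> u" using assms by (intro branching_mechanism_mono[OF lt]) auto
    then show "\<Psi> u \<noteq> 0" using assms by simp
  qed
qed simp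

text \<open>Separation of variables: along the flow, the antiderivative of \<open>1 / \<Psi>\<close> decreases at unit speed.\<close>

lemma flow_time:
  assumes q: "0 < q" and t: "0 \<le> t" and c: "0 < c" "0 < \<Psi> c" "c \<le> \<phi> q t"
  shows "integral {c..q} (\<lambda>u. 1 / \<Psi> u) - integral {c..\<phi> q t} (\<lambda>u. 1 / \<Psi> u) = t"
proof -
  let ?F = "\<lambda>x. integral {c..x} (\<lambda>u. 1 / \<Psi> u)"
  have cont: "continuous_on {c..q} (\<lambda>u. 1 / \<Psi> u)"
    by (rule continuous_on_subset[OF inverse_mechanism_continuous[OF c(1,2)]]) auto
  have range: "\<phi> q s \<in> {c..q}" if "s \<in> {0..t}" for s
    using that flow_decreasing[OF q, of s t] flow_le[OF q, of s] c by auto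
  have "((\<lambda>s. ?F (\<phi> q s) + s) has_real_derivative 0) (at s within {0..t})" if s: "s \<in> {0..t}" for s
  proof -
    have "(?F has_real_derivative 1 / \<Psi> (\<phi> q s)) (at (\<phi> q s) within {c..q})"
      by (rule integral_has_real_derivative[OF cont range[OF s]])
    then have F: "(?F has_real_derivative 1 / \<Psi> (\<phi> q s)) (at (\<phi> q s) within \<phi> q ` {0..t})"
      by (rule DERIV_subset) (use range in auto)
    have "(\<phi> q has_real_derivative - \<Psi> (\<phi> q s)) (at s within {0..t})"
      by (rule DERIV_subset[OF flow_deriv_within[OF q]]) (use s in auto)
    from DERIV_image_chain[OF F this]
    have "((\<lambda>s. ?F (\<phi> q s)) has_real_derivative 1 / \<Psi> (\<phi> q s) * - \<Psi> (\<phi> q s)) (at s within {0..t})"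
      by (simp add: o_def)
    moreover have "\<Psi> c \<le> \<Psi> (\<phi> q s)" using range[OF s] c by (intro branching_mechanism_mono[OF lt]) auto
    ultimately have "((\<lambda>s. ?F (\<phi> q s)) has_real_derivative - 1) (at s within {0..t})" using c by simp
    from DERIV_add[OF this DERIV_ident] show ?thesis by simp
  qed
  then obtain k where k: "\<And>s. s \<in> {0..t} \<Longrightarrow> ?F (\<phi> q s) + s = k"
    using has_field_derivative_zero_constant[of "{0..t}" "\<lambda>s. ?F (\<phi> q s) + s"] by auto
  from k[of 0] k[of t] t flow_0[OF q] show ?thesis by simp
qed

lemma grey_condition_iff:
  assumes \<Psi>1: "0 < \<Psi> 1"
  shows "grey_condition \<Psi> \<longleftrightarrow> (\<exists>C. \<forall>q\<ge>1. integral {1..q} (\<lambda>u. 1 / \<Psi> u) \<le> C)"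
proof -
  let ?F = "\<lambda>q. integral {1..q} (\<lambda>u. 1 / \<Psi> u)"
  have pos: "0 < \<Psi> u" if "1 \<le> u" for u
    using branching_mechanism_mono[OF lt, of 1 u] that \<Psi>1 by simp
  have cont: "continuous_on {1..q} (\<lambda>u. 1 / \<Psi> u)" for q
    by (rule continuous_on_subset[OF inverse_mechanism_continuous[OF _ \<Psi>1]]) auto
  have N: "(\<integral>\<^sup>+u\<in>{1..q}. (1 / ennreal (\<Psi> u)) \<partial>lborel) = ennreal (?F q)"
    and M: "(\<lambda>u. 1 / ennreal (\<Psi> u) * indicator {1..q} u) \<in> borel_measurable lborel" for q
  proof -
    have eq: "1 / ennreal (\<Psi> u) * indicator {1..q} u = ennreal (indicator {1..q} u *\<^sub>R (1 / \<Psi> u))" for u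
      using pos[of u] divide_ennreal[of 1 "\<Psi> u"] by (auto simp: indicator_def)
    have m: "(\<lambda>u. indicator {1..q} u *\<^sub>R (1 / \<Psi> u)) \<in> borel_measurable borel"
      by (rule borel_measurable_continuous_on_indicator[OF _ cont]) simp
    then show "(\<lambda>u. 1 / ennreal (\<Psi> u) * indicator {1..q} u) \<in> borel_measurable lborel"
      unfolding eq by measurable
    have "((\<lambda>u. if u \<in> {1..q} then 1 / \<Psi> u else 0) has_integral ?F q) UNIV"
      unfolding has_integral_restrict_UNIV by (rule integrable_integral[OF integrable_continuous_real[OF cont]])
    then have "((\<lambda>u. indicator {1..q} u *\<^sub>R (1 / \<Psi> u)) has_integral ?F q) UNIV"
      by (rule has_integral_eq[rotated]) (simp add: indicator_def)
    then show "(\<integral>\<^sup>+u\<in>{1..q}. (1 / ennreal (\<Psi> u)) \<partial>lborel) = ennreal (?F q)"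
      unfolding eq using pos
      by (intro nn_integral_has_integral_lborel m) (auto simp: indicator_def less_imp_le)
  qed
  have F_mono: "?F a \<le> ?F b" if "a \<le> b" for a b
    by (rule integral_subset_le)
       (use that pos in \<open>auto intro!: integrable_continuous_real cont simp: less_imp_le\<close>)
  have F0: "0 \<le> ?F q" for q
    by (rule integral_nonneg[OF integrable_continuous_real[OF cont]]) (use pos in \<open>auto simp: less_imp_le\<close>)
  have I: "(\<integral>\<^sup>+u\<in>{1..}. (1 / ennreal (\<Psi> u)) \<partial>lborel) = (SUP n. ennreal (?F (real n)))"
  proof -
    have pt: "(SUP n. 1 / ennreal (\<Psi> u) * indicator {1..real n} u) = 1 / ennreal (\<Psi> u) * indicator {1..} u" for u
    proof (cases "1 \<le> u")
      case True
      obtain m where "u \<le> real m" using real_arch_simple by blast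
      then show ?thesis using True by (intro antisym SUP_least SUP_upper2[of m]) (auto simp: indicator_def)
    qed (simp add: indicator_def)
    have "(\<integral>\<^sup>+u\<in>{1..}. (1 / ennreal (\<Psi> u)) \<partial>lborel) = (\<integral>\<^sup>+u. (SUP n. 1 / ennreal (\<Psi> u) * indicator {1..real n} u) \<partial>lborel)"
      unfolding pt ..
    also have "\<dots> = (SUP n. \<integral>\<^sup>+u\<in>{1..real n}. (1 / ennreal (\<Psi> u)) \<partial>lborel)"
    proof (rule nn_integral_monotone_convergence_SUP[OF _ M])
      show "incseq (\<lambda>n u. 1 / ennreal (\<Psi> u) * indicator {1..real n} u)"
        by (auto simp: incseq_def le_fun_def indicator_def)
    qed
    finally show ?thesis unfolding N .
  qed
  show ?thesis
  proof
    assume "grey_condition \<Psi>"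
    then obtain C where C: "(SUP n. ennreal (?F (real n))) = ennreal C" "0 \<le> C"
      unfolding grey_condition_def I by (cases "SUP n. ennreal (?F (real n))") auto
    have "?F q \<le> C" for q
    proof -
      obtain n where n: "q \<le> real n" using real_arch_simple by blast
      have "ennreal (?F (real n)) \<le> ennreal C" unfolding C(1)[symmetric] by (rule SUP_upper) simp
      then show ?thesis using F_mono[OF n] C(2) by (simp add: ennreal_le_iff)
    qed
    then show "\<exists>C. \<forall>q\<ge>1. ?F q \<le> C" by blast
  next
    assume "\<exists>C. \<forall>q\<ge>1. ?F q \<le> C"
    then obtain C where C: "\<And>q. 1 \<le> q \<Longrightarrow> ?F q \<le> C" by blast
    have "?F (real n) \<le> C" for n
      using C[of "max 1 (real n)"] F_mono[of "real n" "max 1 (real n)"] by simp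
    then have "(SUP n. ennreal (?F (real n))) \<le> ennreal C" by (intro SUP_least ennreal_leI)
    then show "grey_condition \<Psi>" unfolding grey_condition_def I by (rule le_less_trans) simp
  qed
qed

text \<open>If \<open>\<Psi>\<close> vanishes, the integrand \<open>1 / \<Psi>\<close> of Grey's condition is identically \<open>\<infinity>\<close>.\<close>

lemma grey_imp_mechanism_pos:
  assumes "grey_condition \<Psi>" shows "0 < \<Psi> 1"
proof (rule ccontr)
  assume "\<not> 0 < \<Psi> 1"
  then have "\<Psi> 1 = 0" using branching_mechanism_nonneg[OF lt, of 1] by simp
  then have z: "\<Psi> u = 0" if "1 \<le> u" for u
    using branching_mechanism_vanishes[OF lt, of 1 u] that by simp
  have "(\<integral>\<^sup>+u\<in>{1..}. (1 / ennreal (\<Psi> u)) \<partial>lborel) = (\<integral>\<^sup>+(u::real)\<in>{1..}. \<infinity> \<partial>lborel)"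
    by (rule nn_integral_cong) (simp add: z indicator_def)
  also have "\<dots> = \<infinity>"
  proof -
    have "emeasure lborel {1..2::real} \<le> emeasure lborel {1::real..}" by (rule emeasure_mono) auto
    then have "emeasure lborel {1::real..} \<noteq> 0" by auto
    then show ?thesis by (subst nn_integral_cmult_indicator) (simp_all add: ennreal_top_mult)
  qed
  finally show False using assms by (simp add: grey_condition_def)
qed

text \<open>If \<open>\<phi>(\<cdot>,t) \<le> B\<close>, every trajectory from above descends to \<open>B\<close> before time \<open>t\<close>, so the integral of \<open>1 / \<Psi>\<close> from \<open>B\<close>
  upwards is at most \<open>t\<close>.  Conversely, if the integral from \<open>c\<close> upwards is less than \<open>t\<close>, no trajectory can still
  be above \<open>c\<close> at time \<open>t\<close>.\<close>

lemma flow_bounded_iff_grey: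
  assumes t: "0 < t"
  shows "(\<exists>B. \<forall>q>0. \<phi> q t \<le> B) \<longleftrightarrow> grey_condition \<Psi>"
proof
  assume "\<exists>B. \<forall>q>0. \<phi> q t \<le> B"
  then obtain B0 where B0: "\<And>q. 0 < q \<Longrightarrow> \<phi> q t \<le> B0" by blast
  define B where "B = max 1 B0"
  have B: "\<phi> q t \<le> B" "1 \<le> B" if "0 < q" for q using B0[OF that] by (auto simp: B_def)
  have B1: "1 \<le> B" by (simp add: B_def)
  have \<Psi>1: "0 < \<Psi> 1"
  proof (rule ccontr)
    assume "\<not> 0 < \<Psi> 1"
    then have "\<Psi> 1 = 0" using branching_mechanism_nonneg[OF lt, of 1] by simp
    then have z: "\<Psi> u = 0" if "0 \<le> u" for u
      using branching_mechanism_vanishes[OF lt, of 1 u] that by simp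
    have "(B + 1) * exp (- 0 * t) \<le> \<phi> (B + 1) t"
      by (rule flow_ge_exp) (use t z flow_nonneg B1 in auto)
    then show False using B(1)[of "B + 1"] B1 by simp
  qed
  have pos: "0 < \<Psi> u" if "1 \<le> u" for u
    using branching_mechanism_mono[OF lt, of 1 u] that \<Psi>1 by simp
  have cont: "continuous_on {1..q} (\<lambda>u. 1 / \<Psi> u)" for q
    by (rule continuous_on_subset[OF inverse_mechanism_continuous[OF _ \<Psi>1]]) auto
  have "integral {1..q} (\<lambda>u. 1 / \<Psi> u) \<le> integral {1..B} (\<lambda>u. 1 / \<Psi> u) + t" if q: "1 \<le> q" for q
  proof (cases "q \<le> B")
    case True
    have "integral {1..q} (\<lambda>u. 1 / \<Psi> u) \<le> integral {1..B} (\<lambda>u. 1 / \<Psi> u)"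
      by (rule integral_subset_le) (use True pos in \<open>auto intro!: integrable_continuous_real cont simp: less_imp_le\<close>)
    then show ?thesis using t by simp
  next
    case False
    have q0: "0 < q" using q by simp
    have "\<exists>s\<ge>0. s \<le> t \<and> \<phi> q s = B"
      by (rule IVT2') (use False flow_0[OF q0] B(1)[OF q0] t continuous_on_subset[OF flow_continuous[OF q0]] in auto)
    then obtain s where s: "0 \<le> s" "s \<le> t" "\<phi> q s = B" by blast
    have "integral {1..q} (\<lambda>u. 1 / \<Psi> u) - integral {1..\<phi> q s} (\<lambda>u. 1 / \<Psi> u) = s"
      by (rule flow_time[OF q0 s(1) _ \<Psi>1]) (use s B1 in auto)
    then show ?thesis using s by simp
  qed
  then show "grey_condition \<Psi>" unfolding grey_condition_iff[OF \<Psi>1] by blast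
next
  assume g: "grey_condition \<Psi>"
  have \<Psi>1: "0 < \<Psi> 1" by (rule grey_imp_mechanism_pos[OF g])
  let ?F = "\<lambda>q. integral {1..q} (\<lambda>u. 1 / \<Psi> u)"
  have pos: "0 < \<Psi> u" if "1 \<le> u" for u
    using branching_mechanism_mono[OF lt, of 1 u] that \<Psi>1 by simp
  have cont: "continuous_on {1..q} (\<lambda>u. 1 / \<Psi> u)" for q
    by (rule continuous_on_subset[OF inverse_mechanism_continuous[OF _ \<Psi>1]]) auto
  obtain C where C: "\<And>q. 1 \<le> q \<Longrightarrow> ?F q \<le> C" using g unfolding grey_condition_iff[OF \<Psi>1] by blast
  \<comment> \<open>the value of the integral of \<open>1 / \<Psi>\<close> over \<open>[1,\<infinity>)\<close>\<close>
  define S where "S = (SUP q\<in>{1..}. ?F q)"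
  have bdd: "bdd_above (?F ` {1..})" using C by (intro bdd_aboveI[of _ C]) auto
  have "S - t < S" using t by simp
  then obtain c where c: "1 \<le> c" "S - t < ?F c"
    unfolding S_def using less_cSUP_iff[OF _ bdd, of "S - t"] by (auto simp: S_def)
  have "\<phi> q t \<le> c" if q: "0 < q" for q
  proof (rule ccontr)
    assume "\<not> \<phi> q t \<le> c"
    then have big: "c \<le> \<phi> q t" by simp
    then have q1: "1 \<le> q" using flow_le[OF q, of t] c t by simp
    have "?F q - ?F (\<phi> q t) = t" by (rule flow_time[OF q _ _ \<Psi>1]) (use t big c in auto)
    moreover have "?F c \<le> ?F (\<phi> q t)"
      by (rule integral_subset_le) (use big pos in \<open>auto intro!: integrable_continuous_real cont simp: less_imp_le\<close>)
    moreover have "?F q \<le> S" unfolding S_def by (rule cSUP_upper[OF _ bdd]) (use q1 in simp)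
    ultimately show False using c by simp
  qed
  then show "\<exists>B. \<forall>q>0. \<phi> q t \<le> B" by blast
qed

end

section \<open>The generalized Smoluchowski equation\<close>

lemma has_real_derivative_sequence:
  fixes f :: "nat \<Rightarrow> real \<Rightarrow> real"
  assumes S: "open S" "convex S"
    and df: "\<And>n s. s \<in> S \<Longrightarrow> (f n has_real_derivative f' n s) (at s)"
    and unif: "\<And>e. 0 < e \<Longrightarrow> \<forall>\<^sub>F n in sequentially. \<forall>s\<in>S. \<bar>f' n s - g' s\<bar> \<le> e"
    and lim: "\<And>s. s \<in> S \<Longrightarrow> (\<lambda>n. f n s) \<longlonglongrightarrow> g s" and t: "t \<in> S"
  shows "(g has_real_derivative g' t) (at t)"
proof -
  have "\<exists>k. \<forall>x\<in>S. (\<lambda>n. f n x) \<longlonglongrightarrow> k x \<and> (k has_derivative (\<lambda>h. g' x * h)) (at x within S)"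
  proof (rule has_derivative_sequence[where f = f and f' = "\<lambda>n x h. f' n x * h"
        and g' = "\<lambda>x h. g' x * h" and l = "g t", OF S(2) _ _ t lim[OF t]])
    show "(f n has_derivative (\<lambda>h. f' n x * h)) (at x within S)" if "x \<in> S" for n x
      using has_field_derivative_at_within[OF df[OF that]] by (simp add: has_field_derivative_def)
    fix e :: real assume "0 < e"
    from unif[OF this] show "\<forall>\<^sub>F n in sequentially. \<forall>x\<in>S. \<forall>h. norm (f' n x * h - g' x * h) \<le> e * norm h"
      by eventually_elim (auto simp: left_diff_distrib[symmetric] abs_mult intro: mult_right_mono)
  qed
  then obtain k where k: "\<And>x. x \<in> S \<Longrightarrow> (\<lambda>n. f n x) \<longlonglongrightarrow> k x"
      "\<And>x. x \<in> S \<Longrightarrow> (k has_derivative (\<lambda>h. g' x * h)) (at x within S)" by blast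
  have eq: "k x = g x" if "x \<in> S" for x using LIMSEQ_unique[OF k(1)[OF that] lim[OF that]] .
  have "(k has_real_derivative g' t) (at t)"
    using k(2)[OF t] at_within_open[OF t S(1)] by (simp add: has_field_derivative_def)
  then show ?thesis by (rule has_field_derivative_transform_within_open[OF _ S(1) t eq])
qed

lemma integral_scale_measure:
  fixes f :: "'a \<Rightarrow> real"
  assumes c: "0 \<le> c" and f: "f \<in> borel_measurable L"
  shows "(\<integral>x. f x \<partial>scale_measure (ennreal c) L) = c * (\<integral>x. f x \<partial>L)"
proof -
  have "scale_measure (ennreal c) L = density L (\<lambda>_. ennreal c)"
    by (rule measure_eqI) (auto simp: emeasure_density nn_integral_cmult_indicator)
  then have "(\<integral>x. f x \<partial>scale_measure (ennreal c) L) = (\<integral>x. c * f x \<partial>L)"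
    using c f by (simp only:) (subst integral_density, auto)
  then show ?thesis by simp
qed

lemma exp_neg_power: "0 \<le> x \<Longrightarrow> exp_neg (ennreal x) ^ i = exp (- real i * x)"
  by (simp add: exp_of_nat_mult[symmetric])

text \<open>Below, \<open>N\<close> is the law of the size of one cluster, and \<open>P k\<close> that of \<open>k\<close> independent clusters.\<close>

locale finite_size_distribution =
  fixes \<nu> :: "real measure"
  assumes sets_\<nu>: "sets \<nu> = sets pos_borel" and fin: "finite_measure \<nu>" and mass_pos: "0 < measure \<nu> {0<..}"
begin

abbreviation "mass \<equiv> measure \<nu> {0<..}"
definition "N = scale_measure (ennreal (1 / mass)) \<nu>"

lemma space_\<nu>: "space \<nu> = {0<..}"
  by (rule space_eq_of_sets_pos_borel[OF sets_\<nu>])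

lemma pairing_1: "pairing (\<lambda>_. 1) \<nu> = mass"
  by (simp add: pairing_def space_\<nu>)

lemma space_N: "space N = {0<..}" by (simp add: N_def space_scale_measure space_\<nu>)

lemma sets_N: "sets N = sets pos_borel" by (simp add: N_def sets_\<nu>)

lemma prob_N: "prob_space N"
proof
  interpret finite_measure \<nu> by (rule fin)
  have "emeasure \<nu> {0<..} = ennreal mass" by (rule emeasure_eq_measure)
  then show "emeasure N (space N) = 1"
    unfolding N_def space_scale_measure space_\<nu> using mass_pos
    by (simp add: ennreal_mult[symmetric])
qed

lemma measurable_test:
  fixes f :: "ennreal \<Rightarrow> real"
  assumes "continuous_on UNIV f" shows "(\<lambda>x. f (ennreal x)) \<in> borel_measurable borel"
  using borel_measurable_continuous_ennreal[OF assms] by measurable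

lemma integrable_test:
  fixes f :: "ennreal \<Rightarrow> real"
  assumes f: "continuous_on UNIV f"
  shows "integrable \<nu> (\<lambda>x. f (ennreal x))" "integrable N (\<lambda>x. f (ennreal x))"
proof -
  obtain B where B: "\<And>x. \<bar>f x\<bar> \<le> B" using continuous_ennreal_bounded[OF f] by blast
  show "integrable \<nu> (\<lambda>x. f (ennreal x))"
    by (rule finite_measure.integrable_const_bound[OF fin, of _ B])
       (use B measurable_pos_borel[OF sets_\<nu> measurable_test[OF f]] in auto)
  interpret prob_space N by (rule prob_N)
  show "integrable N (\<lambda>x. f (ennreal x))"
    by (rule integrable_const_bound[of _ B])
       (use B measurable_pos_borel[OF sets_N measurable_test[OF f]] in auto)
qed

lemma integral_N:
  fixes f :: "ennreal \<Rightarrow> real"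
  assumes f: "continuous_on UNIV f"
  shows "(\<integral>x. f (ennreal x) \<partial>N) = pairing f \<nu> / mass"
proof -
  show ?thesis
    unfolding N_def pairing_def
    using measurable_pos_borel[OF sets_\<nu> measurable_test[OF f]] mass_pos
    by (subst integral_scale_measure) simp_all
qed

lemma pairing_close:
  fixes f g :: "ennreal \<Rightarrow> real"
  assumes f: "continuous_on UNIV f" and g: "continuous_on UNIV g" and e: "\<And>x. \<bar>f x - g x\<bar> \<le> e"
  shows "\<bar>pairing f \<nu> - pairing g \<nu>\<bar> \<le> e * mass"
proof -
  interpret finite_measure \<nu> by (rule fin)
  have "\<bar>pairing f \<nu> - pairing g \<nu>\<bar> = \<bar>\<integral>x. f (ennreal x) - g (ennreal x) \<partial>\<nu>\<bar>"
    unfolding pairing_def Bochner_Integration.integral_diff[OF integrable_test(1)[OF f] integrable_test(1)[OF g]] ..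
  also have "\<dots> \<le> (\<integral>x. \<bar>f (ennreal x) - g (ennreal x)\<bar> \<partial>\<nu>)" by (rule integral_abs_bound)
  also have "\<dots> \<le> (\<integral>x. e \<partial>\<nu>)"
    by (rule integral_mono) (use e integrable_test(1)[OF f] integrable_test(1)[OF g] in auto)
  finally show ?thesis by (simp add: space_\<nu> mult.commute)
qed

definition "P k = (\<Pi>\<^sub>M i\<in>{1..k::nat}. N)"

lemma coag_integral_P:
  "coag_integral k \<nu> f = (\<integral>x. (f (ennreal (\<Sum>i\<in>{1..k}. x i)) - (\<Sum>i\<in>{1..k}. f (ennreal (x i)))) \<partial>P k)"
  by (simp add: coag_integral_def P_def N_def pairing_1)

lemma prob_P: "prob_space (P k)"
  unfolding P_def by (rule prob_space_PiM) (rule prob_N)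

lemma measurable_coordinate: "i \<in> {1..k} \<Longrightarrow> (\<lambda>x. x i) \<in> P k \<rightarrow>\<^sub>M N"
  unfolding P_def by (rule measurable_component_singleton)

lemma measurable_coordinate_borel: "i \<in> {1..k} \<Longrightarrow> (\<lambda>x. x i) \<in> borel_measurable (P k)"
  using measurable_compose[OF measurable_coordinate measurable_pos_borel[OF sets_N measurable_ident]] by simp

lemma integrable_sum_test:
  fixes f :: "ennreal \<Rightarrow> real"
  assumes f: "continuous_on UNIV f"
  shows "integrable (P k) (\<lambda>x. f (ennreal (\<Sum>i\<in>{1..k}. x i)))"
    and "i \<in> {1..k} \<Longrightarrow> integrable (P k) (\<lambda>x. f (ennreal (x i)))"
proof -
  interpret prob_space "P k" by (rule prob_P)
  obtain B where B: "\<And>x. \<bar>f x\<bar> \<le> B" using continuous_ennreal_bounded[OF f] by blast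
  have "(\<lambda>x. \<Sum>i\<in>{1..k}. x i) \<in> borel_measurable (P k)"
    by (intro borel_measurable_sum measurable_coordinate_borel)
  then show "integrable (P k) (\<lambda>x. f (ennreal (\<Sum>i\<in>{1..k}. x i)))"
    by (intro integrable_const_bound[of _ B, OF AE_I2] measurable_compose[OF _ measurable_test[OF f]]) (use B in auto)
  show "integrable (P k) (\<lambda>x. f (ennreal (x i)))" if "i \<in> {1..k}"
    using measurable_coordinate_borel[OF that]
    by (intro integrable_const_bound[of _ B, OF AE_I2] measurable_compose[OF _ measurable_test[OF f]]) (use B in auto)
qed

lemma coag_integral_eq:
  fixes f :: "ennreal \<Rightarrow> real"
  assumes f: "continuous_on UNIV f"
  shows "coag_integral k \<nu> f = (\<integral>x. f (ennreal (\<Sum>i\<in>{1..k}. x i)) \<partial>P k) - real k * (pairing f \<nu> / mass)"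
proof -
  have c: "(\<integral>x. f (ennreal (x i)) \<partial>P k) = pairing f \<nu> / mass" if i: "i \<in> {1..k}" for i
  proof -
    interpret product_prob_space "\<lambda>_. N" "{1..k}"
      by (simp add: product_prob_space_def product_sigma_finite_def product_prob_space_axioms_def prob_N
          prob_space_imp_sigma_finite)
    have "distr (P k) N (\<lambda>x. x i) = N"
      using PiM_component[OF i] by (simp add: P_def)
    then have "(\<integral>x. f (ennreal x) \<partial>N) = (\<integral>x. f (ennreal x) \<partial>distr (P k) N (\<lambda>x. x i))" by simp
    also have "\<dots> = (\<integral>x. f (ennreal (x i)) \<partial>P k)"
      by (rule integral_distr[OF measurable_coordinate[OF i] measurable_pos_borel[OF sets_N measurable_test[OF f]]])
    finally show ?thesis by (simp add: integral_N[OF f])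
  qed
  have "coag_integral k \<nu> f = (\<integral>x. f (ennreal (\<Sum>i\<in>{1..k}. x i)) \<partial>P k) - (\<integral>x. (\<Sum>i\<in>{1..k}. f (ennreal (x i))) \<partial>P k)"
    unfolding coag_integral_P
    by (intro Bochner_Integration.integral_diff Bochner_Integration.integrable_sum integrable_sum_test[OF f])
  also have "(\<integral>x. (\<Sum>i\<in>{1..k}. f (ennreal (x i))) \<partial>P k) = (\<Sum>i\<in>{1..k}. \<integral>x. f (ennreal (x i)) \<partial>P k)"
    by (intro Bochner_Integration.integral_sum integrable_sum_test(2)[OF f])
  also have "\<dots> = (\<Sum>i\<in>{1..k}. pairing f \<nu> / mass)" by (intro sum.cong refl c)
  finally show ?thesis by simp
qed

text \<open>The integrand of \<open>I\<^sub>k\<close> consists of \<open>k + 1\<close> values of the test function.\<close>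

lemma coag_integral_close:
  fixes f g :: "ennreal \<Rightarrow> real"
  assumes f: "continuous_on UNIV f" and g: "continuous_on UNIV g" and e: "\<And>x. \<bar>f x - g x\<bar> \<le> e"
  shows "\<bar>coag_integral k \<nu> f - coag_integral k \<nu> g\<bar> \<le> real (k + 1) * e"
proof -
  interpret prob_space "P k" by (rule prob_P)
  let ?s = "\<lambda>f x. f (ennreal (\<Sum>i\<in>{1..k}. x i)) :: real"
  have "\<bar>(\<integral>x. ?s f x \<partial>P k) - (\<integral>x. ?s g x \<partial>P k)\<bar> = \<bar>\<integral>x. ?s f x - ?s g x \<partial>P k\<bar>"
    unfolding Bochner_Integration.integral_diff[OF integrable_sum_test(1)[OF f] integrable_sum_test(1)[OF g]] ..
  also have "\<dots> \<le> (\<integral>x. \<bar>?s f x - ?s g x\<bar> \<partial>P k)" by (rule integral_abs_bound)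
  also have "\<dots> \<le> (\<integral>x. e \<partial>P k)"
    by (rule integral_mono) (use e integrable_sum_test(1)[OF f] integrable_sum_test(1)[OF g] in auto)
  also have "\<dots> = e" by (simp add: prob_space)
  finally have 1: "\<bar>(\<integral>x. ?s f x \<partial>P k) - (\<integral>x. ?s g x \<partial>P k)\<bar> \<le> e" .
  have "\<bar>real k * (pairing f \<nu> / mass) - real k * (pairing g \<nu> / mass)\<bar> = real k * (\<bar>pairing f \<nu> - pairing g \<nu>\<bar> / mass)"
    using mass_pos by (simp add: right_diff_distrib[symmetric] diff_divide_distrib[symmetric] abs_mult abs_divide)
  also have "\<dots> \<le> real k * e"
    using pairing_close[OF f g e] mass_pos by (intro mult_left_mono) (auto simp: pos_divide_le_eq)
  finally have 2: "\<bar>real k * (pairing f \<nu> / mass) - real k * (pairing g \<nu> / mass)\<bar> \<le> real k * e" .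
  have "real (k + 1) * e = e + real k * e" by (simp add: algebra_simps)
  then show ?thesis unfolding coag_integral_eq[OF f] coag_integral_eq[OF g] using 1 2 by linarith
qed

text \<open>Exponentials are multiplicative, so the gain term factorizes over the independent clusters.\<close>

lemma coag_integral_exp:
  "coag_integral k \<nu> (\<lambda>x. exp_neg x ^ i)
    = (pairing (\<lambda>x. exp_neg x ^ i) \<nu> / mass) ^ k - real k * (pairing (\<lambda>x. exp_neg x ^ i) \<nu> / mass)"
proof -
  let ?f = "\<lambda>x. exp_neg x ^ i"
  have f: "continuous_on UNIV ?f" by (intro continuous_intros continuous_exp_neg)
  interpret product_prob_space "\<lambda>_. N" "{1..k}"
    by (simp add: product_prob_space_def product_sigma_finite_def product_prob_space_axioms_def prob_N
        prob_space_imp_sigma_finite)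
  have "(\<integral>x. ?f (ennreal (\<Sum>i\<in>{1..k}. x i)) \<partial>P k) = (\<integral>x. (\<Prod>j\<in>{1..k}. ?f (ennreal (x j))) \<partial>P k)"
  proof (rule Bochner_Integration.integral_cong[OF refl])
    fix x assume "x \<in> space (P k)"
    then have pos: "0 \<le> x j" if "j \<in> {1..k}" for j
      using that by (auto simp: P_def space_PiM space_N PiE_iff less_imp_le)
    have "?f (ennreal (\<Sum>j\<in>{1..k}. x j)) = exp (- real i * (\<Sum>j\<in>{1..k}. x j))"
      by (rule exp_neg_power) (use pos in \<open>auto intro: sum_nonneg\<close>)
    also have "\<dots> = (\<Prod>j\<in>{1..k}. exp (- real i * x j))"
      unfolding sum_distrib_left by (rule exp_sum) simp
    also have "\<dots> = (\<Prod>j\<in>{1..k}. ?f (ennreal (x j)))"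
      by (rule prod.cong[OF refl]) (simp only: exp_neg_power[OF pos])
    finally show "?f (ennreal (\<Sum>j\<in>{1..k}. x j)) = (\<Prod>j\<in>{1..k}. ?f (ennreal (x j)))" .
  qed
  also have "\<dots> = (\<Prod>j\<in>{1..k}. \<integral>x. ?f (ennreal x) \<partial>N)"
    unfolding P_def by (rule product_integral_prod) (auto intro: integrable_test(2)[OF f])
  also have "\<dots> = (pairing ?f \<nu> / mass) ^ k" by (simp add: integral_N[OF f])
  finally show ?thesis unfolding coag_integral_eq[OF f] by simp
qed

lemma pairing_sum:
  fixes a :: "nat \<Rightarrow> real"
  assumes f: "\<And>i. continuous_on UNIV (f i)"
  shows "pairing (\<lambda>x. \<Sum>i\<in>I. a i * f i x) \<nu> = (\<Sum>i\<in>I. a i * pairing (f i) \<nu>)"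
  unfolding pairing_def
  by (subst Bochner_Integration.integral_sum) (auto intro!: integrable_mult_right integrable_test(1)[OF f])

lemma coag_integral_sum:
  fixes a :: "nat \<Rightarrow> real"
  assumes f: "\<And>i. continuous_on UNIV (f i)"
  shows "coag_integral k \<nu> (\<lambda>x. \<Sum>i\<in>I. a i * f i x) = (\<Sum>i\<in>I. a i * coag_integral k \<nu> (f i))"
proof -
  have s: "continuous_on UNIV (\<lambda>x. \<Sum>i\<in>I. a i * f i x)" by (intro continuous_intros f)
  have "(\<integral>x. (\<Sum>i\<in>I. a i * f i (ennreal (\<Sum>i\<in>{1..k}. x i))) \<partial>P k)
      = (\<Sum>i\<in>I. a i * (\<integral>x. f i (ennreal (\<Sum>i\<in>{1..k}. x i)) \<partial>P k))"
  proof -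
    have "(\<integral>x. (\<Sum>i\<in>I. a i * f i (ennreal (\<Sum>i\<in>{1..k}. x i))) \<partial>P k)
      = (\<Sum>i\<in>I. \<integral>x. a i * f i (ennreal (\<Sum>i\<in>{1..k}. x i)) \<partial>P k)"
      by (rule Bochner_Integration.integral_sum) (intro integrable_mult_right integrable_sum_test(1)[OF f])
    then show ?thesis by (simp only: integral_mult_right_zero)
  qed
  then show ?thesis
    unfolding coag_integral_eq[OF s] coag_integral_eq[OF f] pairing_sum[OF f]
    by (simp add: right_diff_distrib sum_subtractf sum_divide_distrib sum_distrib_left mult_ac)
qed

end

locale grey_flow = branching_flow_setup +
  fixes \<beta> :: "real \<Rightarrow> real" and \<nu> :: "real \<Rightarrow> real measure"
  assumes rep: "\<And>t. 0 \<le> t \<Longrightarrow> bernstein_representation (\<lambda>q. \<phi> q t) (\<beta> t) (\<nu> t)"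
    and grey: "grey_condition \<Psi>"
begin

definition "\<rho> t = measure (\<nu> t) {0<..}"
definition "M i t = pairing (\<lambda>x. exp_neg x ^ i) (\<nu> t)"

lemma flow_bounded: "0 < t \<Longrightarrow> \<exists>B. \<forall>q>0. \<phi> q t \<le> B"
  using flow_bounded_iff_grey grey by simp

lemma drift_0: "0 < t \<Longrightarrow> \<beta> t = 0"
  using bernstein_representation_limit(3)[OF rep flow_bounded] by simp

lemma levy_\<nu>: "0 < t \<Longrightarrow> levy_measure (\<nu> t)"
  using rep[of t] by (simp add: bernstein_representation_def)

lemma finite_\<nu>: assumes t: "0 < t" shows "finite_measure (\<nu> t)"
proof
  have "(\<integral>\<^sup>+x. 1 \<partial>\<nu> t) < \<infinity>"
    using bernstein_representation_limit(2)[OF rep, of t] flow_bounded[OF t] t by auto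
  then show "emeasure (\<nu> t) (space (\<nu> t)) \<noteq> \<infinity>" by auto
qed

lemma flow_eq:
  assumes t: "0 < t" and q: "0 < q"
  shows "\<phi> q t = \<rho> t - (\<integral>x. exp (- q * x) \<partial>\<nu> t)"
proof -
  interpret finite_measure "\<nu> t" by (rule finite_\<nu>[OF t])
  note l = levy_\<nu>[OF t]
  have i: "integrable (\<nu> t) (\<lambda>x. exp (- q * x))"
  proof (rule integrable_const_bound[of _ 1])
    show "AE x in \<nu> t. norm (exp (- q * x)) \<le> 1"
      by (rule AE_I2) (use levy_measure_space[OF l] q in simp)
    show "(\<lambda>x. exp (- q * x)) \<in> borel_measurable (\<nu> t)"
      by (rule measurable_pos_borel[OF levy_measure_sets[OF l]]) measurable
  qed
  have "\<phi> q t = (\<integral>x. (1 - exp (- q * x)) \<partial>\<nu> t)"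
    using rep[of t] drift_0[OF t] t q by (simp add: bernstein_representation_def)
  also have "\<dots> = (\<integral>x. 1 \<partial>\<nu> t) - (\<integral>x. exp (- q * x) \<partial>\<nu> t)"
    by (rule Bochner_Integration.integral_diff[OF _ i]) simp
  finally show "\<phi> q t = \<rho> t - (\<integral>x. exp (- q * x) \<partial>\<nu> t)"
    by (simp add: \<rho>_def levy_measure_space[OF l])
qed

lemma flow_le_mass: "0 < t \<Longrightarrow> 0 < q \<Longrightarrow> \<phi> q t \<le> \<rho> t"
  by (simp add: flow_eq)

lemma rho_pos: "0 < t \<Longrightarrow> 0 < \<rho> t"
  using flow_le_mass[of t 1] flow_pos[of 1 t] by simp

lemma finite_size: "0 < t \<Longrightarrow> finite_size_distribution (\<nu> t)"
  using rho_pos[of t] finite_\<nu>[of t] levy_measure_sets[OF levy_\<nu>[of t]]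
  by (simp add: finite_size_distribution_def \<rho>_def)

lemma pairing_1: "0 < t \<Longrightarrow> pairing (\<lambda>_. 1) (\<nu> t) = \<rho> t"
  using finite_size_distribution.pairing_1[OF finite_size] by (simp add: \<rho>_def)

lemma M_eq:
  assumes t: "0 < t" shows "M i t = \<rho> t - (if i = 0 then 0 else \<phi> (real i) t)"
proof (cases "i = 0")
  case True then show ?thesis by (simp add: M_def pairing_1[OF t])
next
  case False
  have "M i t = (\<integral>x. exp (- real i * x) \<partial>\<nu> t)"
    unfolding M_def pairing_def
    by (rule Bochner_Integration.integral_cong[OF refl])
       (use levy_measure_space[OF levy_\<nu>[OF t]] in \<open>simp only: exp_neg_power greaterThan_iff less_imp_le\<close>)
  then show ?thesis using False flow_eq[OF t, of "real i"] by simp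
qed

lemma flow_tendsto_mass:
  assumes t: "0 < t" shows "(\<lambda>n. \<phi> (real (Suc n)) t) \<longlonglongrightarrow> \<rho> t"
proof -
  interpret finite_measure "\<nu> t" by (rule finite_\<nu>[OF t])
  have \<rho>: "emeasure (\<nu> t) (space (\<nu> t)) = ennreal (\<rho> t)"
    by (simp add: \<rho>_def levy_measure_space[OF levy_\<nu>[OF t]] emeasure_eq_measure)
  have "((\<lambda>q. ennreal (\<phi> q t)) \<longlongrightarrow> ennreal (\<rho> t)) at_top"
    using bernstein_representation_limit(1)[OF rep, of t] t drift_0[OF t] by (simp add: \<rho>)
  then have "(\<lambda>n. ennreal (\<phi> (real (Suc n)) t)) \<longlonglongrightarrow> ennreal (\<rho> t)"
    by (rule filterlim_compose) (intro filterlim_compose[OF filterlim_real_sequentially filterlim_Suc])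
  then have "(\<lambda>n. enn2real (ennreal (\<phi> (real (Suc n)) t))) \<longlonglongrightarrow> \<rho> t"
    by (rule tendsto_enn2real) (use rho_pos[OF t] in simp)
  then show ?thesis using flow_nonneg t by simp
qed

text \<open>The gap between \<open>\<rho>\<^sub>s\<close> and \<open>\<phi>(n,s)\<close> decreases in \<open>s\<close>, because \<open>\<Psi>\<close> is increasing; this makes the
  convergence uniform away from \<open>s = 0\<close>.\<close>

lemma flow_gap_decreasing:
  assumes q: "0 < q" "q \<le> q'" and s: "0 < s" "s \<le> t"
  shows "\<phi> q' t - \<phi> q t \<le> \<phi> q' s - \<phi> q s"
proof (rule DERIV_nonpos_imp_decreasing_open[OF s(2)])
  have q': "0 < q'" using q by simp
  fix x assume x: "s < x" "x < t"
  then have x0: "0 < x" using s by simp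
  have "\<phi> q x \<le> \<phi> q' x" using bernstein_representation_mono[OF rep, of x q q'] x0 q by simp
  then have "\<Psi> (\<phi> q x) \<le> \<Psi> (\<phi> q' x)" using x0 q flow_nonneg by (intro branching_mechanism_mono[OF lt]) auto
  then show "\<exists>y. ((\<lambda>x. \<phi> q' x - \<phi> q x) has_real_derivative y) (at x) \<and> y \<le> 0"
    by (intro exI[of _ "- \<Psi> (\<phi> q' x) - - \<Psi> (\<phi> q x)"] conjI DERIV_diff flow_deriv q q' x0) simp
next
  have q': "0 < q'" using q by simp
  show "continuous_on {s..t} (\<lambda>x. \<phi> q' x - \<phi> q x)"
    by (intro continuous_intros continuous_on_subset[OF flow_continuous] q q') (use s in auto)
qed

lemma mass_gap_decreasing:
  assumes s: "0 < s" "s \<le> t"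
  shows "\<rho> t - \<phi> (real (Suc n)) t \<le> \<rho> s - \<phi> (real (Suc n)) s"
proof (rule LIMSEQ_le)
  have t: "0 < t" using s by simp
  show "(\<lambda>m. \<phi> (real (Suc m)) t - \<phi> (real (Suc n)) t) \<longlonglongrightarrow> \<rho> t - \<phi> (real (Suc n)) t"
    by (intro tendsto_intros flow_tendsto_mass t)
  show "(\<lambda>m. \<phi> (real (Suc m)) s - \<phi> (real (Suc n)) s) \<longlonglongrightarrow> \<rho> s - \<phi> (real (Suc n)) s"
    by (intro tendsto_intros flow_tendsto_mass s)
  show "\<exists>N. \<forall>m\<ge>N. \<phi> (real (Suc m)) t - \<phi> (real (Suc n)) t \<le> \<phi> (real (Suc m)) s - \<phi> (real (Suc n)) s"
    by (intro exI[of _ n] allI impI flow_gap_decreasing s) auto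
qed

lemma mass_decreasing:
  assumes s: "0 < s" "s \<le> t" shows "\<rho> t \<le> \<rho> s"
  using mass_gap_decreasing[OF s, of 0] flow_decreasing[of 1 s t] s by simp

text \<open>The derivatives \<open>- \<Psi>(\<phi>(n,s))\<close> converge uniformly on \<open>s > t / 2\<close>, because \<open>\<Psi>\<close> is Lipschitz on \<open>[0,\<rho>\<^bsub>t/2\<^esub>]\<close>.\<close>

lemma mass_deriv:
  assumes t: "0 < t" shows "(\<rho> has_real_derivative - \<Psi> (\<rho> t)) (at t)"
proof (rule has_real_derivative_sequence[where S = "{t / 2<..}" and f = "\<lambda>n s. \<phi> (real (Suc n)) s"
      and f' = "\<lambda>n s. - \<Psi> (\<phi> (real (Suc n)) s)" and g' = "\<lambda>s. - \<Psi> (\<rho> s)"])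
  show "open {t / 2<..}" "convex {t / 2<..}" "t \<in> {t / 2<..}" using t by auto
  fix s assume "s \<in> {t / 2<..}"
  then have s: "0 < s" using t by simp
  show "(\<phi> (real (Suc n)) has_real_derivative - \<Psi> (\<phi> (real (Suc n)) s)) (at s)" for n
    by (rule flow_deriv[OF _ s]) simp
  show "(\<lambda>n. \<phi> (real (Suc n)) s) \<longlonglongrightarrow> \<rho> s" by (rule flow_tendsto_mass[OF s])
next
  fix e :: real assume e: "0 < e"
  let ?r = "\<rho> (t / 2)"
  have t2: "0 < t / 2" using t by simp
  have r: "0 < ?r" by (rule rho_pos[OF t2])
  have Dr: "0 \<le> D ?r" using r by (intro mechanism_derivative_nonneg[OF lt]) simp
  have "(\<lambda>n. D ?r * (?r - \<phi> (real (Suc n)) (t / 2))) \<longlonglongrightarrow> D ?r * (?r - ?r)"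
    by (intro tendsto_intros flow_tendsto_mass t2)
  then have "(\<lambda>n. D ?r * (?r - \<phi> (real (Suc n)) (t / 2))) \<longlonglongrightarrow> 0" by simp
  then have "\<forall>\<^sub>F n in sequentially. D ?r * (?r - \<phi> (real (Suc n)) (t / 2)) < e"
    using e by (rule order_tendstoD(2))
  then show "\<forall>\<^sub>F n in sequentially. \<forall>s\<in>{t / 2<..}. \<bar>- \<Psi> (\<phi> (real (Suc n)) s) - - \<Psi> (\<rho> s)\<bar> \<le> e"
  proof eventually_elim
    case (elim n)
    show ?case
    proof
      fix s assume "s \<in> {t / 2<..}"
      then have s: "t / 2 \<le> s" "0 < s" using t by auto
      let ?p = "\<phi> (real (Suc n)) s"
      have p: "0 \<le> ?p" "?p \<le> \<rho> s" "\<rho> s \<le> ?r" "0 \<le> \<rho> s"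
        using flow_nonneg[of "real (Suc n)" s] flow_le_mass[OF s(2), of "real (Suc n)"]
          mass_decreasing[OF t2 s(1)] rho_pos[OF s(2)] s by auto
      have "\<bar>\<Psi> (\<rho> s) - \<Psi> ?p\<bar> \<le> D ?r * \<bar>\<rho> s - ?p\<bar>"
        by (rule branching_mechanism_lipschitz[OF lt]) (use p in auto)
      also have "\<dots> \<le> D ?r * (?r - \<phi> (real (Suc n)) (t / 2))"
        using mass_gap_decreasing[OF t2 s(1), of n] p by (intro mult_left_mono Dr) auto
      also have "\<dots> \<le> e" using elim by simp
      finally show "\<bar>- \<Psi> ?p - - \<Psi> (\<rho> s)\<bar> \<le> e" by (simp add: abs_minus_commute)
    qed
  qed
qed

lemma M_deriv:
  assumes t: "0 < t"
  shows "(M i has_real_derivative \<Psi> (\<rho> t - M i t) - \<Psi> (\<rho> t)) (at t)"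
proof -
  have "((\<lambda>s. \<rho> s - (if i = 0 then 0 else \<phi> (real i) s)) has_real_derivative
      - \<Psi> (\<rho> t) - (if i = 0 then 0 else - \<Psi> (\<phi> (real i) t))) (at t)"
  proof (cases "i = 0")
    case True
    then show ?thesis using mass_deriv[OF t] by simp
  next
    case False
    then show ?thesis using DERIV_diff[OF mass_deriv[OF t] flow_deriv[of "real i" t]] t by simp
  qed
  moreover have "- \<Psi> (\<rho> t) - (if i = 0 then 0 else - \<Psi> (\<phi> (real i) t)) = \<Psi> (\<rho> t - M i t) - \<Psi> (\<rho> t)"
    by (simp add: M_eq[OF t])
  ultimately have d: "((\<lambda>s. \<rho> s - (if i = 0 then 0 else \<phi> (real i) s)) has_real_derivative
      \<Psi> (\<rho> t - M i t) - \<Psi> (\<rho> t)) (at t)" by simp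
  show ?thesis
    by (rule has_field_derivative_transform_within_open[OF d, of "{0<..}"]) (use t M_eq in auto)
qed

subsection \<open>The coagulation operator\<close>

definition coag_term :: "real \<Rightarrow> (ennreal \<Rightarrow> real) \<Rightarrow> nat \<Rightarrow> real" where
  "coag_term t f j = coag_rate \<Psi> (j + 2) (\<rho> t) * coag_integral (j + 2) (\<nu> t) f"

text \<open>The right-hand side of the Smoluchowski equation, where \<open>\<alpha>\<^sub>\<infinity> = \<Psi>'(0\<^sup>+)\<close>.\<close>

definition coag_operator :: "real \<Rightarrow> (ennreal \<Rightarrow> real) \<Rightarrow> real" where
  "coag_operator t f = - ainf * pairing f (\<nu> t) + (\<Sum>j. coag_term t f j)"

lemma coag_rate_facts:
  assumes t: "0 < t"
  shows "0 \<le> coag_rate \<Psi> (j + 2) (\<rho> t)"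
    and "(\<lambda>j. real (j + 2) * coag_rate \<Psi> (j + 2) (\<rho> t)) sums (\<rho> t * (D (\<rho> t) - ainf))"
  using mechanism_coeff_nonneg[OF lt rho_pos[OF t], of j] rho_pos[OF t]
    mechanism_weighted_tail_sums[OF lt rho_pos[OF t]]
  by (simp_all only: branching_mechanism_derivs(3)[OF lt rho_pos[OF t]] mult_nonneg_nonneg zero_le_power less_imp_le)

lemma coag_term_bound:
  assumes t: "0 < t" and f: "continuous_on UNIV f" and g: "continuous_on UNIV g" and e: "\<And>x. \<bar>f x - g x\<bar> \<le> e"
  shows "\<bar>coag_term t f j - coag_term t g j\<bar> \<le> 2 * e * (real (j + 2) * coag_rate \<Psi> (j + 2) (\<rho> t))"
proof -
  interpret finite_size_distribution "\<nu> t" by (rule finite_size[OF t])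
  note r = coag_rate_facts(1)[OF t, of j]
  have e0: "0 \<le> e" using e[of 0] abs_ge_zero order_trans by blast
  have "\<bar>coag_term t f j - coag_term t g j\<bar>
      = coag_rate \<Psi> (j + 2) (\<rho> t) * \<bar>coag_integral (j + 2) (\<nu> t) f - coag_integral (j + 2) (\<nu> t) g\<bar>"
    unfolding coag_term_def right_diff_distrib[symmetric] abs_mult using r by (simp only: abs_of_nonneg)
  also have "\<dots> \<le> coag_rate \<Psi> (j + 2) (\<rho> t) * (real (j + 2 + 1) * e)"
    by (rule mult_left_mono[OF coag_integral_close[OF f g e] r])
  also have "\<dots> \<le> coag_rate \<Psi> (j + 2) (\<rho> t) * (2 * real (j + 2) * e)"
    using e0 by (intro mult_left_mono[OF _ r] mult_right_mono) auto
  finally show ?thesis by (simp only: mult_ac)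
qed

lemma summable_coag_term:
  assumes t: "0 < t" and f: "continuous_on UNIV f" shows "summable (coag_term t f)"
proof -
  obtain B where B: "\<And>x. \<bar>f x\<bar> \<le> B" using continuous_ennreal_bounded[OF f] by blast
  have z: "coag_term t (\<lambda>_. 0) j = 0" for j by (simp add: coag_term_def coag_integral_def)
  have "summable (\<lambda>j. 2 * B * (real (j + 2) * coag_rate \<Psi> (j + 2) (\<rho> t)))"
    using sums_summable[OF coag_rate_facts(2)[OF t]] by (rule summable_mult)
  then show ?thesis
  proof (rule summable_comparison_test')
    show "norm (coag_term t f j) \<le> 2 * B * (real (j + 2) * coag_rate \<Psi> (j + 2) (\<rho> t))" for j
      using coag_term_bound[OF t f, of "\<lambda>_. 0" B j] B z by simp
  qed
qed

lemma coag_operator_close: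
  assumes t: "0 < t" and f: "continuous_on UNIV f" and g: "continuous_on UNIV g" and e: "\<And>x. \<bar>f x - g x\<bar> \<le> e"
  shows "\<bar>coag_operator t f - coag_operator t g\<bar> \<le> 2 * e * (\<rho> t * D (\<rho> t))"
proof -
  interpret finite_size_distribution "\<nu> t" by (rule finite_size[OF t])
  have e0: "0 \<le> e" using e[of 0] abs_ge_zero order_trans by blast
  have a: "0 \<le> ainf" using lt by (simp add: levy_triple_def)
  have s: "(\<lambda>j. 2 * e * (real (j + 2) * coag_rate \<Psi> (j + 2) (\<rho> t))) sums (2 * e * (\<rho> t * (D (\<rho> t) - ainf)))"
    by (rule sums_mult[OF coag_rate_facts(2)[OF t]])
  have d: "(\<lambda>j. coag_term t f j - coag_term t g j) sums (suminf (coag_term t f) - suminf (coag_term t g))"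
    by (intro sums_diff summable_sums summable_coag_term t f g)
  have "\<bar>suminf (coag_term t f) - suminf (coag_term t g)\<bar> \<le> 2 * e * (\<rho> t * (D (\<rho> t) - ainf))"
  proof -
    have "norm (\<Sum>j. coag_term t f j - coag_term t g j) \<le> (\<Sum>j. 2 * e * (real (j + 2) * coag_rate \<Psi> (j + 2) (\<rho> t)))"
      by (rule norm_suminf_le[OF _ sums_summable[OF s]]) (use coag_term_bound[OF t f g e] in simp)
    then show ?thesis by (simp only: sums_unique[OF s, symmetric] sums_unique[OF d, symmetric] real_norm_def)
  qed
  moreover have "\<bar>ainf * pairing f (\<nu> t) - ainf * pairing g (\<nu> t)\<bar> \<le> ainf * (e * \<rho> t)"
    using mult_left_mono[OF pairing_close[OF f g e] a] a
    by (simp add: right_diff_distrib[symmetric] abs_mult \<rho>_def)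
  moreover have "ainf * (e * \<rho> t) \<le> 2 * e * (\<rho> t * ainf)"
    using a e0 rho_pos[OF t] by (simp add: mult_ac)
  moreover have "2 * e * (\<rho> t * (D (\<rho> t) - ainf)) = 2 * e * (\<rho> t * D (\<rho> t)) - 2 * e * (\<rho> t * ainf)"
    by (simp add: algebra_simps)
  ultimately show ?thesis unfolding coag_operator_def by linarith
qed

text \<open>On exponentials the coagulation operator is a Taylor expansion of \<open>\<Psi>\<close> about \<open>\<rho>\<^sub>t\<close>.\<close>

lemma coag_term_exp_sums:
  assumes t: "0 < t"
  shows "coag_term t (\<lambda>x. exp_neg x ^ i) sums (\<Psi> (\<rho> t - M i t) - \<Psi> (\<rho> t) + ainf * M i t)"
proof -
  interpret finite_size_distribution "\<nu> t" by (rule finite_size[OF t])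
  note r = rho_pos[OF t]
  let ?\<theta> = "M i t / \<rho> t"
  have M: "0 \<le> M i t" "M i t \<le> \<rho> t"
    using M_eq[OF t, of i] flow_le_mass[OF t, of "real i"] flow_nonneg[of "real i" t] t r by (auto split: if_splits)
  have "(\<lambda>j. mechanism_coeff a0 ainf \<mu> (\<rho> t) (j + 2) * M i t ^ (j + 2))
      sums (\<Psi> (\<rho> t - M i t) - \<Psi> (\<rho> t) + M i t * D (\<rho> t))"
    by (rule mechanism_tail_sums[OF lt r]) (use M in simp)
  moreover have "(\<lambda>j. ?\<theta> * (real (j + 2) * coag_rate \<Psi> (j + 2) (\<rho> t))) sums (?\<theta> * (\<rho> t * (D (\<rho> t) - ainf)))"
    by (rule sums_mult[OF coag_rate_facts(2)[OF t]])
  ultimately have "(\<lambda>j. mechanism_coeff a0 ainf \<mu> (\<rho> t) (j + 2) * M i t ^ (j + 2)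
        - ?\<theta> * (real (j + 2) * coag_rate \<Psi> (j + 2) (\<rho> t)))
      sums (\<Psi> (\<rho> t - M i t) - \<Psi> (\<rho> t) + M i t * D (\<rho> t) - ?\<theta> * (\<rho> t * (D (\<rho> t) - ainf)))"
    by (rule sums_diff)
  moreover have "mechanism_coeff a0 ainf \<mu> (\<rho> t) (j + 2) * M i t ^ (j + 2)
        - ?\<theta> * (real (j + 2) * coag_rate \<Psi> (j + 2) (\<rho> t)) = coag_term t (\<lambda>x. exp_neg x ^ i) j" for j
  proof -
    have "coag_rate \<Psi> (j + 2) (\<rho> t) * ?\<theta> ^ (j + 2) = mechanism_coeff a0 ainf \<mu> (\<rho> t) (j + 2) * M i t ^ (j + 2)"
      unfolding branching_mechanism_derivs(3)[OF lt r] power_divide using r by simp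
    then show ?thesis
      unfolding coag_term_def coag_integral_exp M_def[symmetric] \<rho>_def[symmetric]
      by (simp only: right_diff_distrib mult_ac)
  qed
  moreover have "\<Psi> (\<rho> t - M i t) - \<Psi> (\<rho> t) + M i t * D (\<rho> t) - ?\<theta> * (\<rho> t * (D (\<rho> t) - ainf))
      = \<Psi> (\<rho> t - M i t) - \<Psi> (\<rho> t) + ainf * M i t"
    using r by (simp add: field_simps)
  ultimately show ?thesis by (simp only:)
qed

lemma coag_operator_polynomial:
  assumes t: "0 < t"
  shows "coag_operator t (\<lambda>x. \<Sum>i\<in>I. a i * exp_neg x ^ i) = (\<Sum>i\<in>I. a i * (\<Psi> (\<rho> t - M i t) - \<Psi> (\<rho> t)))"
    and "pairing (\<lambda>x. \<Sum>i\<in>I. a i * exp_neg x ^ i) (\<nu> t) = (\<Sum>i\<in>I. a i * M i t)"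
proof -
  interpret finite_size_distribution "\<nu> t" by (rule finite_size[OF t])
  have c: "continuous_on UNIV (\<lambda>x. exp_neg x ^ i)" for i
    by (intro continuous_intros continuous_exp_neg)
  let ?P = "\<lambda>x. \<Sum>i\<in>I. a i * exp_neg x ^ i"
  show p: "pairing ?P (\<nu> t) = (\<Sum>i\<in>I. a i * M i t)"
    unfolding M_def by (rule pairing_sum[OF c])
  have tm: "coag_term t ?P j = (\<Sum>i\<in>I. a i * coag_term t (\<lambda>x. exp_neg x ^ i) j)" for j
    unfolding coag_term_def coag_integral_sum[OF c] sum_distrib_left by (rule sum.cong[OF refl]) simp
  have "(\<lambda>j. coag_term t ?P j) sums (\<Sum>i\<in>I. a i * (\<Psi> (\<rho> t - M i t) - \<Psi> (\<rho> t) + ainf * M i t))"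
    unfolding tm by (intro sums_sum sums_mult coag_term_exp_sums t)
  then have "suminf (coag_term t ?P) = (\<Sum>i\<in>I. a i * (\<Psi> (\<rho> t - M i t) - \<Psi> (\<rho> t) + ainf * M i t))"
    by (rule sums_unique[symmetric])
  then show "coag_operator t ?P = (\<Sum>i\<in>I. a i * (\<Psi> (\<rho> t - M i t) - \<Psi> (\<rho> t)))"
    unfolding coag_operator_def p
    by (simp add: distrib_left sum.distrib sum_distrib_left sum_negf mult_ac)
qed

text \<open>The equation holds for polynomials in \<open>e\<^sup>-\<^sup>x\<close>, where it reduces to the equation for \<open>\<phi>\<close>.  It extends to all \<open>f\<close>
  since the operator is continuous in \<open>f\<close>, with a bound \<open>2 \<rho>\<^sub>s \<Psi>'(\<rho>\<^sub>s)\<close> that decreases in \<open>s\<close>.\<close>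

lemma pairing_deriv:
  assumes t: "0 < t" and f: "continuous_on UNIV f"
  shows "((\<lambda>s. pairing f (\<nu> s)) has_real_derivative coag_operator t f) (at t)"
proof -
  have "\<exists>a n. \<forall>x. \<bar>f x - (\<Sum>i\<le>n. a i * exp_neg x ^ i)\<bar> < 1 / real (Suc m)" for m
  proof -
    have "0 < 1 / real (Suc m)" by simp
    from polynomial_approximation_exp_neg[OF f this] show ?thesis by metis
  qed
  then obtain a n where an: "\<And>m x. \<bar>f x - (\<Sum>i\<le>n m. a m i * exp_neg x ^ i)\<bar> < 1 / real (Suc m)" by metis
  define Q where "Q m x = (\<Sum>i\<le>n m. a m i * exp_neg x ^ i)" for m x
  have cQ: "continuous_on UNIV (Q m)" for m
    unfolding Q_def by (intro continuous_intros continuous_exp_neg)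
  have close: "\<bar>Q m x - f x\<bar> \<le> 1 / real (Suc m)" for m x
    using an[of x m] by (simp add: Q_def abs_minus_commute less_imp_le del: of_nat_Suc)
  have t2: "0 < t / 2" using t by simp
  show ?thesis
  proof (rule has_real_derivative_sequence[where S = "{t / 2<..}" and f = "\<lambda>m s. pairing (Q m) (\<nu> s)"
        and f' = "\<lambda>m s. coag_operator s (Q m)" and g' = "\<lambda>s. coag_operator s f"])
    show "open {t / 2<..}" "convex {t / 2<..}" "t \<in> {t / 2<..}" using t by auto
    fix s assume "s \<in> {t / 2<..}"
    then have s: "0 < s" using t by simp
    show "((\<lambda>s. pairing (Q m) (\<nu> s)) has_real_derivative coag_operator s (Q m)) (at s)" for m
    proof (rule has_field_derivative_transform_within_open)
      show "((\<lambda>s. \<Sum>i\<le>n m. a m i * M i s) has_real_derivative coag_operator s (Q m)) (at s)"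
        unfolding Q_def coag_operator_polynomial(1)[OF s]
        by (intro DERIV_sum DERIV_cmult M_deriv s)
      show "(\<Sum>i\<le>n m. a m i * M i u) = pairing (Q m) (\<nu> u)" if "u \<in> {0<..}" for u
        unfolding Q_def using coag_operator_polynomial(2)[of u] that by simp
    qed (use s in auto)
    interpret finite_size_distribution "\<nu> s" by (rule finite_size[OF s])
    show "(\<lambda>m. pairing (Q m) (\<nu> s)) \<longlonglongrightarrow> pairing f (\<nu> s)"
    proof (rule Lim_null_comparison[of _ "\<lambda>m. 1 / real (Suc m) * \<rho> s", THEN LIM_zero_cancel])
      show "\<forall>\<^sub>F m in sequentially. norm (pairing (Q m) (\<nu> s) - pairing f (\<nu> s)) \<le> 1 / real (Suc m) * \<rho> s"
        using pairing_close[OF cQ f close] by (simp add: \<rho>_def)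
      have "(\<lambda>m. 1 / real (Suc m) * \<rho> s) \<longlonglongrightarrow> 0 * \<rho> s"
        by (intro tendsto_intros LIMSEQ_Suc[OF lim_1_over_n])
      then show "(\<lambda>m. 1 / real (Suc m) * \<rho> s) \<longlonglongrightarrow> 0" by simp
    qed
  next
    fix e :: real assume e: "0 < e"
    let ?C = "\<rho> (t / 2) * D (\<rho> (t / 2))"
    have "(\<lambda>m. 2 * (1 / real (Suc m)) * ?C) \<longlonglongrightarrow> 2 * 0 * ?C"
      by (intro tendsto_intros LIMSEQ_Suc[OF lim_1_over_n])
    then have "(\<lambda>m. 2 * (1 / real (Suc m)) * ?C) \<longlonglongrightarrow> 0" by simp
    then have "\<forall>\<^sub>F m in sequentially. 2 * (1 / real (Suc m)) * ?C < e"
      using e by (rule order_tendstoD(2))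
    then show "\<forall>\<^sub>F m in sequentially. \<forall>s\<in>{t / 2<..}. \<bar>coag_operator s (Q m) - coag_operator s f\<bar> \<le> e"
    proof eventually_elim
      case (elim m)
      show ?case
      proof
        fix s assume "s \<in> {t / 2<..}"
        then have s: "t / 2 \<le> s" "0 < s" using t by auto
        have "\<bar>coag_operator s (Q m) - coag_operator s f\<bar> \<le> 2 * (1 / real (Suc m)) * (\<rho> s * D (\<rho> s))"
          by (rule coag_operator_close[OF s(2) cQ f close])
        also have "\<dots> \<le> 2 * (1 / real (Suc m)) * ?C"
          using mass_decreasing[OF t2 s(1)] rho_pos[OF s(2)]
          by (intro mult_left_mono mult_mono mechanism_derivative_mono[OF lt] mechanism_derivative_nonneg[OF lt]) auto
        also have "\<dots> \<le> e" using elim by simp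
        finally show "\<bar>coag_operator s (Q m) - coag_operator s f\<bar> \<le> e" .
      qed
    qed
  qed
qed

lemma smoluchowski: "smoluchowski_weak_solution \<Psi> \<nu>"
  unfolding smoluchowski_weak_solution_def
proof (intro exI[of _ ainf] conjI allI impI)
  have "\<forall>\<^sub>F q in at_right 0. D q = deriv \<Psi> q"
    using eventually_at_right_less[of 0]
    by eventually_elim (simp add: branching_mechanism_derivs(2)[OF lt])
  then show "(deriv \<Psi> \<longlongrightarrow> ainf) (at_right 0)"
    using mechanism_derivative_tendsto_at_0[OF lt] by (simp add: tendsto_cong)
  fix f :: "ennreal \<Rightarrow> real" and t :: real assume t: "0 < t" and f: "continuous_on UNIV f"
  show "let \<rho> = pairing (\<lambda>_. 1) (\<nu> t);
          r = \<lambda>j. coag_rate \<Psi> (j + 2) \<rho> * coag_integral (j + 2) (\<nu> t) f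
      in summable r \<and> ((\<lambda>s. pairing f (\<nu> s)) has_real_derivative - ainf * pairing f (\<nu> t) + (\<Sum>j. r j)) (at t)"
    using summable_coag_term[OF t f] pairing_deriv[OF t f]
    unfolding Let_def pairing_1[OF t] coag_term_def[symmetric] coag_operator_def by (simp add: coag_term_def[abs_def])
qed

end

section \<open>Convergence of the discrete flow\<close>

text \<open>Between two points of a fine grid, monotonicity encloses \<open>F\<^sub>k\<close> and the Lipschitz bound encloses \<open>G\<close>.\<close>

lemma mono_pointwise_imp_uniform:
  fixes F :: "nat \<Rightarrow> real \<Rightarrow> real" and G :: "real \<Rightarrow> real"
  assumes S: "0 < S" and lim: "\<And>s. 0 \<le> s \<Longrightarrow> s \<le> S \<Longrightarrow> (\<lambda>k. F k s) \<longlonglongrightarrow> G s"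
    and mono: "\<forall>\<^sub>F k in sequentially. \<forall>a b. 0 \<le> a \<longrightarrow> a \<le> b \<longrightarrow> b \<le> S \<longrightarrow> F k a \<le> F k b"
    and lip: "\<And>a b. 0 \<le> a \<Longrightarrow> a \<le> b \<Longrightarrow> b \<le> S \<Longrightarrow> \<bar>G b - G a\<bar> \<le> \<Lambda> * (b - a)" and e: "0 < e"
  shows "\<forall>\<^sub>F k in sequentially. \<forall>s. 0 \<le> s \<longrightarrow> s \<le> S \<longrightarrow> \<bar>F k s - G s\<bar> \<le> e"
proof -
  have \<Lambda>: "0 \<le> \<Lambda>" using lip[of 0 S] S abs_ge_zero[of "G S - G 0"] by (smt (verit) mult_neg_pos)
  obtain n :: nat where n: "2 * \<Lambda> * S / e < real n" using reals_Archimedean2 by blast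
  define N where "N = Suc n"
  have N: "0 < N" "\<Lambda> * (S / real N) \<le> e / 2"
    using n e by (auto simp: N_def field_simps)
  define g where "g i = real i * (S / real N)" for i
  have g: "0 \<le> g i" "i \<le> N \<Longrightarrow> g i \<le> S" "g (Suc i) - g i = S / real N" for i
    using S N(1) by (auto simp: g_def field_simps)
  have "\<forall>\<^sub>F k in sequentially. \<forall>i\<in>{..N}. \<bar>F k (g i) - G (g i)\<bar> < e / 2"
  proof (intro eventually_ball_finite ballI)
    fix i assume "i \<in> {..N}"
    then have "(\<lambda>k. F k (g i)) \<longlonglongrightarrow> G (g i)" by (intro lim g) auto
    then show "\<forall>\<^sub>F k in sequentially. \<bar>F k (g i) - G (g i)\<bar> < e / 2"
      unfolding tendsto_iff dist_real_def using half_gt_zero[OF e] by blast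
  qed simp
  with mono show ?thesis
  proof eventually_elim
    case (elim k)
    show ?case
    proof (intro allI impI)
      fix s assume s: "0 \<le> s" "s \<le> S"
      obtain i where i: "Suc i \<le> N" "g i \<le> s" "s \<le> g (Suc i)"
      proof (cases "s = S")
        case True
        show thesis
        proof (rule that[of n])
          show "Suc n \<le> N" by (simp add: N_def)
          show "g n \<le> s" using g(2)[of n] True by (simp add: N_def)
          show "s \<le> g (Suc n)" using True by (simp add: g_def N_def)
        qed
      next
        case False
        define i where "i = nat \<lfloor>s * real N / S\<rfloor>"
        have q: "0 \<le> s * real N / S" using s S by simp
        have i1: "real i \<le> s * real N / S" "s * real N / S < real i + 1"
          unfolding i_def using q by linarith+
        have "s * real N / S < real N" using s False S N(1) by (simp add: pos_divide_less_eq)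
        then have "real i < real N" using i1 by linarith
        then have "Suc i \<le> N" by simp
        moreover have "g i \<le> s" using i1(1) S N(1) by (simp add: g_def field_simps)
        moreover have "s \<le> g (Suc i)" using i1(2) S N(1) by (simp add: g_def field_simps)
        ultimately show thesis by (rule that)
      qed
      have gS: "g (Suc i) \<le> S" by (rule g(2)[OF i(1)])
      have F: "F k (g i) \<le> F k s" "F k s \<le> F k (g (Suc i))"
        using elim(1) g(1)[of i] i s gS by auto
      have E: "\<bar>F k (g i) - G (g i)\<bar> < e / 2" "\<bar>F k (g (Suc i)) - G (g (Suc i))\<bar> < e / 2"
        using elim(2) i by auto
      have "\<bar>G (g (Suc i)) - G s\<bar> \<le> \<Lambda> * (g (Suc i) - s)" "\<bar>G s - G (g i)\<bar> \<le> \<Lambda> * (s - g i)"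
        using i s g(1)[of i] gS by (auto intro!: lip)
      moreover have "\<Lambda> * (g (Suc i) - s) \<le> \<Lambda> * (S / real N)" "\<Lambda> * (s - g i) \<le> \<Lambda> * (S / real N)"
      proof -
        have "g (Suc i) - s \<le> S / real N" using i g(3)[of i] by linarith
        then show "\<Lambda> * (g (Suc i) - s) \<le> \<Lambda> * (S / real N)" by (rule mult_left_mono[OF _ \<Lambda>])
        have "s - g i \<le> S / real N" using i g(3)[of i] by linarith
        then show "\<Lambda> * (s - g i) \<le> \<Lambda> * (S / real N)" by (rule mult_left_mono[OF _ \<Lambda>])
      qed
      ultimately show "\<bar>F k s - G s\<bar> \<le> e" using F E N(2) by linarith
    qed
  qed
qed

context branching_flow_setup
begin

text \<open>One Euler step has an error of second order in \<open>\<tau>\<close>, by the mean value theorem applied twice.\<close>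

lemma flow_euler_step:
  assumes q: "0 < q" and s: "0 \<le> s" and \<tau>: "0 < \<tau>"
  shows "\<bar>\<phi> q (s + \<tau>) - (\<phi> q s - \<tau> * \<Psi> (\<phi> q s))\<bar> \<le> \<tau> * (D q * (\<tau> * \<Psi> q))"
proof -
  have f: "0 \<le> \<phi> q u" "\<phi> q u \<le> q" if "0 \<le> u" for u using that flow_nonneg flow_le q by auto
  have cont: "continuous_on {s..u} (\<phi> q)" for u
    by (rule continuous_on_subset[OF flow_continuous[OF q]]) (use s in auto)
  have mv: "\<exists>z. s < z \<and> z < u \<and> \<phi> q u - \<phi> q s = (u - s) * - \<Psi> (\<phi> q z)" if u: "s < u" for u
  proof -
    have "\<exists>l z. s < z \<and> z < u \<and> (\<phi> q has_real_derivative l) (at z) \<and> \<phi> q u - \<phi> q s = (u - s) * l"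
    proof (rule MVT[OF u cont])
      fix x assume "s < x" "x < u"
      then have "(\<phi> q has_real_derivative - \<Psi> (\<phi> q x)) (at x)" using s by (intro flow_deriv q) simp
      then show "\<phi> q differentiable at x" unfolding real_differentiable_def by blast
    qed
    then show ?thesis using flow_deriv[OF q] s DERIV_unique by (smt (verit))
  qed
  obtain z where z: "s < z" "z < s + \<tau>" "\<phi> q (s + \<tau>) - \<phi> q s = \<tau> * - \<Psi> (\<phi> q z)"
    using mv[of "s + \<tau>"] \<tau> by auto
  obtain z' where z': "s < z'" "z' < z" "\<phi> q z - \<phi> q s = (z - s) * - \<Psi> (\<phi> q z')"
    using mv[OF z(1)] by auto
  have \<Psi>b: "0 \<le> \<Psi> (\<phi> q z')" "\<Psi> (\<phi> q z') \<le> \<Psi> q"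
    using f[of z'] s z' by (auto intro!: branching_mechanism_nonneg[OF lt] branching_mechanism_mono[OF lt])
  have "\<bar>\<phi> q s - \<phi> q z\<bar> = (z - s) * \<Psi> (\<phi> q z')"
  proof -
    have "0 \<le> (z - s) * \<Psi> (\<phi> q z')" using z \<Psi>b by simp
    moreover have "\<phi> q s - \<phi> q z = (z - s) * \<Psi> (\<phi> q z')" using z'(3) by linarith
    ultimately show ?thesis by (simp only: abs_of_nonneg)
  qed
  also have "\<dots> \<le> \<tau> * \<Psi> q" using z z' \<Psi>b \<tau> by (intro mult_mono) auto
  finally have d: "\<bar>\<phi> q s - \<phi> q z\<bar> \<le> \<tau> * \<Psi> q" .
  have "\<bar>\<Psi> (\<phi> q s) - \<Psi> (\<phi> q z)\<bar> \<le> D q * \<bar>\<phi> q s - \<phi> q z\<bar>"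
    by (rule branching_mechanism_lipschitz[OF lt]) (use f s z in auto)
  also have "\<dots> \<le> D q * (\<tau> * \<Psi> q)"
    using d q by (intro mult_left_mono mechanism_derivative_nonneg[OF lt]) auto
  finally have "\<tau> * \<bar>\<Psi> (\<phi> q s) - \<Psi> (\<phi> q z)\<bar> \<le> \<tau> * (D q * (\<tau> * \<Psi> q))"
    using \<tau> by (intro mult_left_mono) auto
  moreover have "\<phi> q (s + \<tau>) - (\<phi> q s - \<tau> * \<Psi> (\<phi> q s)) = \<tau> * (\<Psi> (\<phi> q s) - \<Psi> (\<phi> q z))"
    using z(3) by (simp add: algebra_simps)
  ultimately show ?thesis using \<tau> by (simp add: abs_mult)
qed

text \<open>The discrete Gronwall estimate for the explicit Euler scheme.\<close>

lemma euler_scheme_error: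
  assumes q: "0 < q" and \<tau>: "0 < \<tau>" and \<eta>: "0 \<le> \<eta>"
    and x: "\<And>n. 0 \<le> x n" "\<And>n. x n \<le> q" "\<And>n. x (Suc n) = x n - \<tau> * F (x n)"
    and F: "\<And>s. 0 \<le> s \<Longrightarrow> s \<le> q \<Longrightarrow> \<bar>F s - \<Psi> s\<bar> \<le> \<eta>"
  shows "\<bar>x n - \<phi> q (real n * \<tau>)\<bar>
    \<le> exp (D q * (real n * \<tau>)) * (\<bar>x 0 - q\<bar> + real n * \<tau> * (\<eta> + D q * (\<tau> * \<Psi> q)))"
proof (induction n)
  case 0 then show ?case by (simp add: flow_0[OF q])
next
  case (Suc n)
  let ?y = "\<lambda>n. \<phi> q (real n * \<tau>)" and ?c = "\<eta> + D q * (\<tau> * \<Psi> q)"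
  let ?E = "\<lambda>n. exp (D q * (real n * \<tau>))" and ?B = "\<lambda>n. \<bar>x 0 - q\<bar> + real n * \<tau> * ?c"
  have D0: "0 \<le> D q" using q by (intro mechanism_derivative_nonneg[OF lt]) simp
  have \<Psi>0: "0 \<le> \<Psi> q" using q by (intro branching_mechanism_nonneg[OF lt]) simp
  have c0: "0 \<le> ?c" using D0 \<Psi>0 \<tau> \<eta> by simp
  have t: "0 \<le> real n * \<tau>" using \<tau> by simp
  have y: "0 \<le> ?y n" "?y n \<le> q" using flow_nonneg[OF q t] flow_le[OF q t] by auto
  have "real (Suc n) * \<tau> = real n * \<tau> + \<tau>" by (simp add: algebra_simps)
  then have 1: "\<bar>?y (Suc n) - (?y n - \<tau> * \<Psi> (?y n))\<bar> \<le> \<tau> * (D q * (\<tau> * \<Psi> q))"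
    using flow_euler_step[OF q t \<tau>] by simp
  have "\<bar>\<Psi> (x n) - \<Psi> (?y n)\<bar> \<le> D q * \<bar>x n - ?y n\<bar>"
    by (rule branching_mechanism_lipschitz[OF lt]) (use x y in auto)
  then have 2: "\<tau> * \<bar>\<Psi> (x n) - \<Psi> (?y n)\<bar> \<le> \<tau> * (D q * \<bar>x n - ?y n\<bar>)"
    using \<tau> by (intro mult_left_mono) auto
  have 3: "\<tau> * \<bar>F (x n) - \<Psi> (x n)\<bar> \<le> \<tau> * \<eta>" using F[OF x(1,2)] \<tau> by (intro mult_left_mono) auto
  have "x (Suc n) - ?y (Suc n) = (x n - ?y n) - \<tau> * (F (x n) - \<Psi> (x n)) - \<tau> * (\<Psi> (x n) - \<Psi> (?y n))
      - (?y (Suc n) - (?y n - \<tau> * \<Psi> (?y n)))"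
    by (simp add: x(3) algebra_simps)
  then have "\<bar>x (Suc n) - ?y (Suc n)\<bar> \<le> \<bar>x n - ?y n\<bar> + \<bar>\<tau> * (F (x n) - \<Psi> (x n))\<bar> + \<bar>\<tau> * (\<Psi> (x n) - \<Psi> (?y n))\<bar>
      + \<bar>?y (Suc n) - (?y n - \<tau> * \<Psi> (?y n))\<bar>" by linarith
  also have "\<dots> \<le> \<bar>x n - ?y n\<bar> + \<tau> * \<eta> + \<tau> * (D q * \<bar>x n - ?y n\<bar>) + \<tau> * (D q * (\<tau> * \<Psi> q))"
    using 1 2 3 \<tau> by (intro add_mono) (auto simp: abs_mult)
  also have "\<dots> = (1 + D q * \<tau>) * \<bar>x n - ?y n\<bar> + \<tau> * ?c" by (simp add: algebra_simps)
  also have "\<dots> \<le> exp (D q * \<tau>) * (?E n * ?B n) + \<tau> * ?c"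
    by (intro add_mono order_refl mult_mono[OF exp_ge_add_one_self Suc]) simp_all
  also have "\<dots> \<le> ?E (Suc n) * ?B n + ?E (Suc n) * (\<tau> * ?c)"
  proof -
    have e: "exp (D q * \<tau>) * ?E n = ?E (Suc n)" by (simp add: mult_exp_exp algebra_simps)
    have "1 \<le> ?E (Suc n)" using D0 \<tau> by simp
    from mult_right_mono[OF this, of "\<tau> * ?c"] c0 \<tau>
    have "\<tau> * ?c \<le> ?E (Suc n) * (\<tau> * ?c)" by simp
    moreover have "exp (D q * \<tau>) * (?E n * ?B n) = ?E (Suc n) * ?B n" unfolding e[symmetric] by (simp only: mult.assoc)
    ultimately show ?thesis by linarith
  qed
  also have "\<dots> = ?E (Suc n) * (?B n + \<tau> * ?c)" by (simp only: distrib_left)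
  also have "?B n + \<tau> * ?c = ?B (Suc n)" by (simp add: algebra_simps)
  finally show ?case .
qed

end

locale galton_watson_scaling =
  fixes p :: "nat \<Rightarrow> nat pmf" and h \<tau> :: "nat \<Rightarrow> real"
  assumes mean: "\<And>k. (\<lambda>j. real j * pmf (p k) j) sums 1"
    and h: "\<And>k. 0 < h k" "h \<longlonglongrightarrow> 0"
    and \<tau>: "\<And>k. 0 < \<tau> k" "\<tau> \<longlonglongrightarrow> 0"
begin

abbreviation "family k \<equiv> min1_measure (rescaled_family_measure (p k) (h k) (\<tau> k))"
abbreviation "weight k \<equiv> family_integral (p k) (h k) (\<tau> k) (\<lambda>_. 1)"
abbreviation "mechanism k \<equiv> discrete_mechanism (p k) (h k) (\<tau> k)"
abbreviation "dflow k \<equiv> discrete_flow (p k) (h k)"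

lemma finite_family: "finite_measure (family k)"
  by (rule finite_min1_measure[OF levy_measure_rescaled_family[OF mean h(1) \<tau>(1)]])

lemma weight_eq: "weight k = (\<integral>y. 1 \<partial>family k)"
  using integral_rescaled_family[OF h(1) \<tau>(1), of "\<lambda>_. 1" "p k"] by simp

lemma weight_nonneg: "0 \<le> weight k"
  unfolding weight_eq by (rule Bochner_Integration.integral_nonneg) simp

lemma eventually_small:
  assumes "0 \<le> s" shows "\<forall>\<^sub>F k in sequentially. h k * s \<le> 1"
proof -
  have "(\<lambda>k. h k * s) \<longlonglongrightarrow> 0 * s" by (intro tendsto_intros h)
  then have "\<forall>\<^sub>F k in sequentially. h k * s < 1" by (rule order_tendstoD(2)) simp
  then show ?thesis by eventually_elim simp
qed

lemma eventually_h_le: "0 < e \<Longrightarrow> \<forall>\<^sub>F k in sequentially. h k \<le> e"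
  using order_tendstoD(2)[OF h(2), of e] by (auto elim: eventually_mono)

text \<open>The kernel is uniformly close to the branching test function, and the total weights are bounded.\<close>

lemma mechanism_minus_test_tendsto_0:
  assumes C: "\<forall>\<^sub>F k in sequentially. weight k \<le> C" and s: "0 \<le> s"
  shows "(\<lambda>k. mechanism k s - (\<integral>y. branching_test s y \<partial>family k)) \<longlonglongrightarrow> 0"
proof (rule tendstoI)
  fix e :: real assume e: "0 < e"
  define A where "A = (s ^ 3 + 2 * s + s\<^sup>2) * \<bar>C\<bar> + 1"
  have A: "0 < A" using s unfolding A_def by (intro add_nonneg_pos mult_nonneg_nonneg) auto
  define d where "d = min 1 (e / (2 * A))"
  have d: "0 < d" "d \<le> 1" using e A by (auto simp: d_def)
  have dA: "d * A < e"
  proof -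
    have "d * A \<le> e / (2 * A) * A" using A by (intro mult_right_mono) (auto simp: d_def)
    also have "\<dots> < e" using A e by simp
    finally show ?thesis .
  qed
  have d3: "0 < d ^ 3" using d by simp
  show "\<forall>\<^sub>F k in sequentially. dist (mechanism k s - (\<integral>y. branching_test s y \<partial>family k)) 0 < e"
    using C eventually_small[OF s] eventually_h_le[OF d3]
  proof eventually_elim
    case (elim k)
    have "\<bar>mechanism k s - (\<integral>y. branching_test s y \<partial>family k)\<bar> \<le> d * (s ^ 3 + 2 * s + s\<^sup>2) * weight k"
      by (rule discrete_mechanism_close[OF mean h(1) \<tau>(1) elim(3) d s elim(2)])
    also have "\<dots> \<le> d * (s ^ 3 + 2 * s + s\<^sup>2) * \<bar>C\<bar>"
      using elim(1) d s by (intro mult_left_mono) auto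
    also have "\<dots> \<le> d * A" using d by (simp add: A_def mult.assoc)
    also have "\<dots> < e" by (rule dA)
    finally show ?case by simp
  qed
qed

lemma dflow_euler: "dflow k (Suc n) q = dflow k n q - \<tau> k * mechanism k (dflow k n q)"
  by (rule discrete_flow_Suc[OF h(1) \<tau>(1)])

lemma dflow_bounds:
  assumes "0 \<le> q" shows "0 \<le> dflow k n q" "dflow k n q \<le> q" "h k * dflow k n q \<le> 1"
  using discrete_flow_bounds[OF h(1) assms]
    order_trans[OF discrete_flow_decreasing[OF mean h(1) \<tau>(1) assms le0] discrete_flow_0_le[OF h(1) assms]]
  by auto

text \<open>Testing the convergence of the families with \<open>branching_test s\<close> gives \<open>\<Psi>\<^sub>k(s) \<rightarrow> \<Psi>(s)\<close>, uniformly on \<open>[0,q]\<close> by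
  monotonicity; then the Euler scheme for \<open>\<Psi>\<^sub>k\<close> converges to the flow of \<open>\<Psi>\<close>.\<close>

lemma dflow_tendsto:
  assumes lt: "levy_triple a0 ainf \<mu>" and flow: "branching_flow (branching_mechanism a0 ainf \<mu>) \<phi>"
    and conv: "weak_star_conv family (kappa_measure a0 ainf \<mu>)"
    and q: "0 < q" and t: "0 \<le> t" and n: "(\<lambda>k. real (n k) * \<tau> k) \<longlonglongrightarrow> t"
  shows "(\<lambda>k. dflow k (n k) q) \<longlonglongrightarrow> \<phi> q t"
proof -
  interpret branching_flow_setup a0 ainf \<mu> \<phi> using lt flow by unfold_locales
  have "(\<lambda>k. \<integral>y. (1::real) \<partial>family k) \<longlonglongrightarrow> (\<integral>y. 1 \<partial>kappa_measure a0 ainf \<mu>)"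
    by (rule conv[unfolded weak_star_conv_def, rule_format, OF continuous_on_const])
  then have "(\<lambda>k. weight k) \<longlonglongrightarrow> (\<integral>y. 1 \<partial>kappa_measure a0 ainf \<mu>)" by (simp only: weight_eq)
  then have C: "\<forall>\<^sub>F k in sequentially. weight k \<le> (\<integral>y. 1 \<partial>kappa_measure a0 ainf \<mu>) + 1"
    by (auto dest!: order_tendstoD(2)[of _ _ _ "(\<integral>y. 1 \<partial>kappa_measure a0 ainf \<mu>) + 1"] elim: eventually_mono)
  have pt: "(\<lambda>k. mechanism k s) \<longlonglongrightarrow> \<Psi> s" if s: "0 \<le> s" for s
  proof -
    have "(\<lambda>k. \<integral>y. branching_test s y \<partial>family k) \<longlonglongrightarrow> \<Psi> s"
      using conv continuous_branching_test[OF s]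
      unfolding weak_star_conv_def branching_mechanism_eq_integral_test[OF lt s] by blast
    from tendsto_add[OF mechanism_minus_test_tendsto_0[OF C s] this] show ?thesis by simp
  qed
  have unif: "\<forall>\<^sub>F k in sequentially. \<forall>s. 0 \<le> s \<longrightarrow> s \<le> q \<longrightarrow> \<bar>mechanism k s - \<Psi> s\<bar> \<le> e" if e: "0 < e" for e
  proof (rule mono_pointwise_imp_uniform[OF q pt _ _ e])
    show "\<forall>\<^sub>F k in sequentially. \<forall>a b. 0 \<le> a \<longrightarrow> a \<le> b \<longrightarrow> b \<le> q \<longrightarrow> mechanism k a \<le> mechanism k b"
      using eventually_small[OF less_imp_le[OF q]]
    proof eventually_elim
      case (elim k)
      have "h k * b \<le> 1" if "b \<le> q" for b
        using mult_left_mono[OF that less_imp_le[OF h(1)[of k]]] elim by simp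
      then show ?case using discrete_mechanism_increment(1)[OF mean h(1) \<tau>(1)] by blast
    qed
    show "\<bar>\<Psi> b - \<Psi> a\<bar> \<le> D q * (b - a)" if "0 \<le> a" "a \<le> b" "b \<le> q" for a b
      using branching_mechanism_lipschitz[OF lt, of a q b] that by simp
  qed
  have D0: "0 \<le> D q" using q by (intro mechanism_derivative_nonneg[OF lt]) simp
  have n0: "0 \<le> real (n k) * \<tau> k" for k using \<tau>(1)[of k] by simp
  have err: "(\<lambda>k. dflow k (n k) q - \<phi> q (real (n k) * \<tau> k)) \<longlonglongrightarrow> 0"
  proof (rule tendstoI)
    fix e :: real assume e: "0 < e"
    let ?T = "t + 1"
    let ?X = "exp (D q * ?T)"
    define \<eta> where "\<eta> = e / (4 * ?X * ?T)"
    have T: "0 < ?T" using t by simp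
    have \<eta>: "0 < \<eta>" using e T by (simp add: \<eta>_def)
    have "\<forall>\<^sub>F k in sequentially. real (n k) * \<tau> k < ?T" using n by (rule order_tendstoD(2)) simp
    moreover have "\<forall>\<^sub>F k in sequentially. ?X * (\<bar>dflow k 0 q - q\<bar> + ?T * (D q * (\<tau> k * \<Psi> q))) < e / 2"
    proof (rule order_tendstoD(2))
      show "(\<lambda>k. ?X * (\<bar>dflow k 0 q - q\<bar> + ?T * (D q * (\<tau> k * \<Psi> q)))) \<longlonglongrightarrow> ?X * (\<bar>q - q\<bar> + ?T * (D q * (0 * \<Psi> q)))"
        by (intro tendsto_intros discrete_flow_0_tendsto[OF h] \<tau>(2)) (use q in simp)
    qed (use e in simp)
    ultimately show "\<forall>\<^sub>F k in sequentially. dist (dflow k (n k) q - \<phi> q (real (n k) * \<tau> k)) 0 < e"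
      using unif[OF \<eta>]
    proof eventually_elim
      case (elim k)
      let ?c = "\<eta> + D q * (\<tau> k * \<Psi> q)"
      have "0 \<le> \<Psi> q" using q by (intro branching_mechanism_nonneg[OF lt]) simp
      then have c0: "0 \<le> ?c" using \<eta> D0 \<tau>(1)[of k] by simp
      have "\<bar>dflow k (n k) q - \<phi> q (real (n k) * \<tau> k)\<bar>
        \<le> exp (D q * (real (n k) * \<tau> k)) * (\<bar>dflow k 0 q - q\<bar> + real (n k) * \<tau> k * ?c)"
        by (rule euler_scheme_error[where x = "\<lambda>n. dflow k n q" and F = "mechanism k" and \<tau> = "\<tau> k",
              OF q \<tau>(1) _ _ _ dflow_euler]) (use \<eta> elim(3) dflow_bounds q in auto)
      also have "\<dots> \<le> ?X * (\<bar>dflow k 0 q - q\<bar> + ?T * ?c)"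
      proof -
        have 1: "real (n k) * \<tau> k * ?c \<le> ?T * ?c" by (rule mult_right_mono[OF _ c0]) (use elim(1) in simp)
        have 2: "exp (D q * (real (n k) * \<tau> k)) \<le> ?X" using elim(1) D0 by (simp add: mult_left_mono)
        have 3: "0 \<le> \<bar>dflow k 0 q - q\<bar> + real (n k) * \<tau> k * ?c"
          by (intro add_nonneg_nonneg abs_ge_zero mult_nonneg_nonneg[OF n0 c0])
        show ?thesis by (rule mult_mono[OF 2 add_left_mono[OF 1] exp_ge_zero 3])
      qed
      also have "\<dots> = ?X * (\<bar>dflow k 0 q - q\<bar> + ?T * (D q * (\<tau> k * \<Psi> q))) + ?X * ?T * \<eta>"
        by (simp add: algebra_simps)
      also have "?X * ?T * \<eta> = e / 4"
      proof -
        have "x * y * (e / (4 * x * y)) = e / 4" if "0 < x" "0 < y" for x y :: real using that by simp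
        from this[OF exp_gt_zero T] show ?thesis by (simp only: \<eta>_def)
      qed
      finally show ?case using elim(2) e by simp
    qed
  qed
  have "(\<lambda>k. \<phi> q (real (n k) * \<tau> k)) \<longlonglongrightarrow> \<phi> q t"
    by (rule continuous_on_tendsto_compose[OF flow_continuous[OF q] n]) (use t n0 in auto)
  from tendsto_add[OF err this] show ?thesis by simp
qed

end

section \<open>From convergence of the populations to convergence of the families\<close>

subsection \<open>Second differences of branching test functions\<close>

lemma branching_test_second_difference:
  "(branching_test 2 x - 2 * branching_test 1 x) * exp_neg x ^ i
    = branching_test (real (i + 2)) x - 2 * branching_test (real (i + 1)) x + branching_test (real i) x"
proof -
  consider "x = 0" | "x = \<infinity>" | r where "x = ennreal r" "0 < r"
    by (cases x) (auto simp: infinity_ennreal_def less_eq_real_def)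
  then show ?thesis
  proof cases
    case 1 then show ?thesis by (simp add: power2_eq_square field_simps)
  next
    case 2 then show ?thesis by (cases i) auto
  next
    case (3 r)
    let ?m = "r * min r 1" and ?y = "exp (- r)"
    have e: "exp (- real k * r) = ?y ^ k" for k by (simp add: exp_of_nat_mult[symmetric])
    have bt: "branching_test (real k) x = (?y ^ k - 1 + real k * r) / ?m" for k
      using 3 branching_test_pos_real[of r "real k"] unfolding e by simp
    have b12: "branching_test 2 x = (?y ^ 2 - 1 + 2 * r) / ?m" "branching_test 1 x = (?y - 1 + r) / ?m"
      using bt[of 2] bt[of 1] by simp_all
    have "(?y ^ 2 - 1 + 2 * r - 2 * (?y - 1 + r)) * ?y ^ i
      = (?y ^ (i + 2) - 1 + real (i + 2) * r) - 2 * (?y ^ (i + 1) - 1 + real (i + 1) * r) + (?y ^ i - 1 + real i * r)"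
      by (simp add: algebra_simps power2_eq_square)
    moreover have "(a / m - 2 * (b / m)) * y = (a - 2 * b) * y / m" for a b m y :: real
      by (simp add: diff_divide_distrib left_diff_distrib)
    moreover have "a / m - 2 * (b / m) + c / m = (a - 2 * b + c) / m" for a b c m :: real
      by (simp add: diff_divide_distrib add_divide_distrib)
    moreover have "exp_neg x = ?y" using 3 by simp
    ultimately show ?thesis unfolding bt b12 by (simp only:)
  qed
qed

lemma branching_test_weight_pos:
  assumes "x \<noteq> \<infinity>" shows "0 < branching_test 2 x - 2 * branching_test 1 x"
proof -
  consider "x = 0" | r where "x = ennreal r" "0 < r"
    using assms by (cases x) (auto simp: infinity_ennreal_def less_eq_real_def)
  then show ?thesis
  proof cases
    case 1 then show ?thesis by simp
  next
    case (2 r)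
    let ?y = "exp (- r)"
    have "exp (- 2 * r) = ?y * ?y" by (simp add: mult_exp_exp)
    then have "branching_test 2 x - 2 * branching_test 1 x = (1 - ?y)\<^sup>2 / (r * min r 1)"
      using 2 by (simp add: branching_test_pos_real diff_divide_distrib[symmetric] power2_eq_square algebra_simps)
    moreover have "0 < (1 - ?y)\<^sup>2" using 2 by simp
    ultimately show ?thesis using 2 by simp
  qed
qed

text \<open>The weight \<open>w\<close> of the second differences vanishes at \<open>\<infinity>\<close> only.  After subtracting
  \<open>g(\<infinity>)\<close> times the first test function, which is \<open>1\<close> at \<open>\<infinity>\<close>, any \<open>g\<close> becomes uniformly close to
  \<open>w\<close> times a continuous function, and Weierstrass' theorem applies.\<close>

lemma weak_star_conv_by_branching_tests:
  assumes N: "\<And>k. finite_measure (N k)" "\<And>k. sets (N k) = sets borel"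
    and K: "finite_measure K" "sets K = sets borel"
    and lim: "\<And>q. 0 < q \<Longrightarrow> (\<lambda>k. \<integral>y. branching_test q y \<partial>N k) \<longlonglongrightarrow> (\<integral>y. branching_test q y \<partial>K)"
  shows "weak_star_conv N K"
proof (rule weak_star_conv_by_approximation[OF N K])
  let ?b = "\<lambda>i::nat. branching_test (real i)"
  let ?w = "\<lambda>x. branching_test 2 x - 2 * branching_test 1 x"
  have cb: "continuous_on UNIV (?b i)" for i by (rule continuous_branching_test) simp
  have cb1: "continuous_on UNIV (branching_test 1)" and cb2: "continuous_on UNIV (branching_test 2)"
    by (rule continuous_branching_test; simp)+
  show "continuous_on UNIV (branching_test 1)" by (rule cb1)
  show "0 < branching_test 1 x" for x by (rule branching_test_pos) simp
  show "(\<lambda>k. \<integral>y. branching_test 1 y \<partial>N k) \<longlonglongrightarrow> (\<integral>y. branching_test 1 y \<partial>K)" by (rule lim) simp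
  fix g :: "ennreal \<Rightarrow> real" and e :: real assume g: "continuous_on UNIV g" and e: "0 < e"
  have cw: "continuous_on UNIV ?w" by (intro continuous_intros cb1 cb2)
  obtain B where B: "0 < B" "\<And>x. \<bar>?w x\<bar> \<le> B" using continuous_ennreal_bounded[OF cw] by blast
  define g0 where "g0 x = g x - g \<infinity> * branching_test 1 x" for x
  have cg0: "continuous_on UNIV g0" unfolding g0_def by (intro continuous_intros g cb1)
  have g0inf: "g0 \<infinity> = 0" by (simp add: g0_def)
  have wpos: "0 < ?w x" if "e / 2 \<le> \<bar>g0 x\<bar>" for x
    using that e g0inf by (intro branching_test_weight_pos) auto
  have w0: "0 \<le> ?w x" for x
  proof (cases "x = \<infinity>")
    case False
    then show ?thesis by (rule less_imp_le[OF branching_test_weight_pos])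
  qed simp
  obtain \<delta> where \<delta>: "0 < \<delta>" "\<And>x. e / 2 \<le> \<bar>g0 x\<bar> \<Longrightarrow> \<delta> \<le> ?w x"
  proof (cases "{x. e / 2 \<le> \<bar>g0 x\<bar>} = {}")
    case True
    then show thesis by (intro that[of 1]) auto
  next
    case False
    have "closed {x. e / 2 \<le> \<bar>g0 x\<bar>}"
      by (intro closed_Collect_le continuous_intros cg0)
    then have "compact {x. e / 2 \<le> \<bar>g0 x\<bar>}"
      using compact_Int_closed[OF compact_ennreal] by simp
    from continuous_attains_inf[OF this False continuous_on_subset[OF cw subset_UNIV]]
    obtain x0 where "e / 2 \<le> \<bar>g0 x0\<bar>" "\<And>x. e / 2 \<le> \<bar>g0 x\<bar> \<Longrightarrow> ?w x0 \<le> ?w x" by auto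
    then show thesis using wpos by (intro that[of "?w x0"]) auto
  qed
  define c where "c x = g0 x / max (?w x) \<delta>" for x
  have cc: "continuous_on UNIV c"
    unfolding c_def using \<delta> by (intro continuous_intros cg0 cb1 cb2) (auto simp: max_def)
  have near: "\<bar>g0 x - ?w x * c x\<bar> \<le> e / 2" for x
  proof (cases "\<delta> \<le> ?w x")
    case True
    then show ?thesis using \<delta> e by (simp add: c_def)
  next
    case False
    then have "\<not> e / 2 \<le> \<bar>g0 x\<bar>" using \<delta>(2) by blast
    moreover have "g0 x - ?w x * c x = g0 x * (1 - ?w x / \<delta>)"
      using False \<delta> by (simp add: c_def field_simps)
    moreover have "\<bar>1 - ?w x / \<delta>\<bar> \<le> 1" using False w0[of x] \<delta> by (simp add: abs_le_iff)
    ultimately show ?thesis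
      using mult_left_le[of "\<bar>1 - ?w x / \<delta>\<bar>" "\<bar>g0 x\<bar>"] by (simp add: abs_mult)
  qed
  obtain a n where a: "\<And>x. \<bar>c x - (\<Sum>i\<le>n. a i * exp_neg x ^ i)\<bar> < e / (2 * B)"
    using polynomial_approximation_exp_neg[OF cc, of "e / (2 * B)"] e B(1) by auto
  define g' where "g' x = g \<infinity> * branching_test 1 x + (\<Sum>i\<le>n. a i * (?b (i + 2) x - 2 * ?b (i + 1) x + ?b i x))" for x
  have g'_eq: "g' x = g \<infinity> * branching_test 1 x + ?w x * (\<Sum>i\<le>n. a i * exp_neg x ^ i)" for x
    unfolding g'_def sum_distrib_left branching_test_second_difference[symmetric] by (simp add: mult_ac)
  have int: "integrable L (?b i)" "integrable L (branching_test 1)" if "finite_measure L" "sets L = sets borel" for L i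
    by (rule integrable_continuous_finite_measure[OF that] cb cb1)+
  have I: "(\<integral>y. g' y \<partial>L) = g \<infinity> * (\<integral>y. branching_test 1 y \<partial>L)
      + (\<Sum>i\<le>n. a i * ((\<integral>y. ?b (i + 2) y \<partial>L) - 2 * (\<integral>y. ?b (i + 1) y \<partial>L) + (\<integral>y. ?b i y \<partial>L)))"
    if "finite_measure L" "sets L = sets borel" for L
    unfolding g'_def using int[OF that] by (simp del: of_nat_add of_nat_Suc)
  have lim': "(\<lambda>k. \<integral>y. ?b i y \<partial>N k) \<longlonglongrightarrow> (\<integral>y. ?b i y \<partial>K)" for i
    by (cases "i = 0") (auto intro: lim)
  show "\<exists>g'. continuous_on UNIV g' \<and> (\<forall>x. \<bar>g x - g' x\<bar> \<le> e)
         \<and> (\<lambda>k. \<integral>y. g' y \<partial>N k) \<longlonglongrightarrow> (\<integral>y. g' y \<partial>K)"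
  proof (intro exI[of _ g'] conjI allI)
    show "continuous_on UNIV g'" unfolding g'_def by (intro continuous_intros cb cb1)
    fix x
    let ?P = "\<Sum>i\<le>n. a i * exp_neg x ^ i"
    have "g x - g' x = (g0 x - ?w x * c x) + ?w x * (c x - ?P)"
      unfolding g'_eq g0_def by (simp add: right_diff_distrib)
    moreover have "\<bar>?w x * (c x - ?P)\<bar> \<le> B * (e / (2 * B))"
      unfolding abs_mult using a[of x] B(2)[of x] B(1) by (intro mult_mono) auto
    moreover have "B * (e / (2 * B)) = e / 2" using B(1) by simp
    ultimately show "\<bar>g x - g' x\<bar> \<le> e" using near[of x] by linarith
  next
    show "(\<lambda>k. \<integral>y. g' y \<partial>N k) \<longlonglongrightarrow> (\<integral>y. g' y \<partial>K)"
      unfolding I[OF K] I[OF N] by (intro tendsto_intros lim' lim) simp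
  qed
qed

subsection \<open>Weak-star compactness\<close>

text \<open>Helly's selection theorem on the real line, transported by the homeomorphism with \<open>[0,1]\<close>.  Since \<open>neg_ln\<close> is
  continuous on the whole line, it carries the limit law back to \<open>[0,\<infinity>]\<close>.\<close>

lemma weak_star_compactness_normalized:
  fixes N :: "nat \<Rightarrow> ennreal measure"
  assumes N: "\<And>k. prob_space (N k)" "\<And>k. sets (N k) = sets borel"
  obtains r K where "strict_mono r" "prob_space K" "sets K = sets borel" "weak_star_conv (\<lambda>k. N (r k)) K"
proof -
  have me: "exp_neg \<in> N k \<rightarrow>\<^sub>M borel" for k
    using borel_measurable_continuous_ennreal[OF continuous_exp_neg] N(2) by (simp cong: measurable_cong_sets)
  define Q where "Q k = distr (N k) borel exp_neg" for k
  have Q: "real_distribution (Q k)" for k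
    unfolding Q_def by (intro prob_space.real_distribution_distr[OF N(1)] me)
  have "tight Q"
    unfolding tight_def
  proof (intro conjI allI impI)
    fix \<epsilon> :: real assume "0 < \<epsilon>"
    have "measure (Q k) {-1<..1} = 1" for k
    proof -
      interpret prob_space "N k" by (rule N)
      have "measure (Q k) {-1<..1} = prob (exp_neg -` {-1<..1} \<inter> space (N k))"
        unfolding Q_def by (rule measure_distr[OF me]) simp
      also have "exp_neg -` {-1<..1} \<inter> space (N k) = space (N k)"
      proof -
        have "exp_neg x \<in> {-1<..1}" for x using exp_neg_bounds[of x] by simp
        then show ?thesis by blast
      qed
      finally show ?thesis by (simp add: prob_space)
    qed
    then show "\<exists>a b. a < b \<and> (\<forall>n. 1 - \<epsilon> < measure (Q n) {a<..b})"
      using \<open>0 < \<epsilon>\<close> by (intro exI[of _ "-1"] exI[of _ 1]) auto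
  qed (rule Q)
  from tight_imp_convergent_subsubsequence[OF this strict_mono_id]
  obtain r L where r: "strict_mono r" and L: "real_distribution L" and wc: "weak_conv_m (Q \<circ> id \<circ> r) L"
    by blast
  interpret L: real_distribution L by (rule L)
  have cn: "continuous_on UNIV neg_ln" using isCont_neg_ln by (simp add: continuous_at_imp_continuous_on)
  have mn: "neg_ln \<in> L \<rightarrow>\<^sub>M borel"
    using borel_measurable_continuous_onI[OF cn] by simp
  define K where "K = distr L borel neg_ln"
  have "weak_star_conv (\<lambda>k. N (r k)) K"
    unfolding weak_star_conv_def
  proof (intro allI impI)
    fix g :: "ennreal \<Rightarrow> real" assume g: "continuous_on UNIV g"
    note mg = borel_measurable_continuous_ennreal[OF g]
    obtain B where B: "\<And>x. \<bar>g x\<bar> \<le> B" using continuous_ennreal_bounded[OF g] by blast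
    have cg: "isCont (\<lambda>y. g (neg_ln y)) y" for y
      using continuous_on_compose2[OF g cn] by (simp add: continuous_on_eq_continuous_at)
    have "(\<lambda>k. \<integral>y. g (neg_ln y) \<partial>(Q \<circ> id \<circ> r) k) \<longlonglongrightarrow> (\<integral>y. g (neg_ln y) \<partial>L)"
      by (rule weak_conv_imp_integral_bdd_continuous_conv[OF _ L wc cg]) (use B Q in auto)
    moreover have "(\<integral>y. g (neg_ln y) \<partial>(Q \<circ> id \<circ> r) k) = (\<integral>y. g y \<partial>N (r k))" for k
    proof -
      have "(\<integral>y. g (neg_ln y) \<partial>Q (r k)) = (\<integral>y. g (neg_ln (exp_neg y)) \<partial>N (r k))"
        unfolding Q_def
        by (rule integral_distr[OF me measurable_compose[OF borel_measurable_continuous_onI[OF cn] mg]])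
      then show ?thesis by simp
    qed
    moreover have "(\<integral>y. g (neg_ln y) \<partial>L) = (\<integral>y. g y \<partial>K)"
      unfolding K_def by (rule integral_distr[OF mn mg, symmetric])
    ultimately show "(\<lambda>k. \<integral>y. g y \<partial>N (r k)) \<longlonglongrightarrow> (\<integral>y. g y \<partial>K)" by simp
  qed
  moreover have "prob_space K" unfolding K_def by (rule L.prob_space_distr[OF mn])
  ultimately show thesis using r by (intro that) (auto simp: K_def)
qed

text \<open>Along a subsequence the masses converge; if their limit is positive, normalize.\<close>

lemma weak_star_compactness:
  fixes N :: "nat \<Rightarrow> ennreal measure"
  assumes N: "\<And>k. finite_measure (N k)" "\<And>k. sets (N k) = sets borel"
    and C: "\<And>k. measure (N k) UNIV \<le> C"
  obtains r K where "strict_mono r" "finite_measure K" "sets K = sets borel" "weak_star_conv (\<lambda>k. N (r k)) K"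
proof -
  let ?m = "\<lambda>k. measure (N k) UNIV"
  have sp: "space (N k) = UNIV" for k using sets_eq_imp_space_eq[OF N(2)] by simp
  have "bounded (range ?m)" using C by (intro boundedI[of _ C]) auto
  from bounded_imp_convergent_subsequence[OF this]
  obtain l r1 where r1: "strict_mono r1" and l: "(?m \<circ> r1) \<longlonglongrightarrow> l" by blast
  have l0: "0 \<le> l" by (rule LIMSEQ_le_const[OF l]) auto
  have int1: "(\<integral>y. (1::real) \<partial>N k) = ?m k" for k by (simp add: sp)
  show thesis
  proof (cases "l = 0")
    case True
    have "weak_star_conv (\<lambda>k. N (r1 k)) (null_measure borel)"
      unfolding weak_star_conv_def
    proof (intro allI impI)
      fix g :: "ennreal \<Rightarrow> real" assume g: "continuous_on UNIV g"
      obtain B where B: "\<And>x. \<bar>g x\<bar> \<le> B" using continuous_ennreal_bounded[OF g] by blast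
      have le: "\<bar>\<integral>y. g y \<partial>N k\<bar> \<le> B * ?m k" for k
      proof -
        interpret finite_measure "N k" by (rule N)
        have "\<bar>\<integral>y. g y \<partial>N k\<bar> \<le> (\<integral>y. \<bar>g y\<bar> \<partial>N k)" by (rule integral_abs_bound)
        also have "\<dots> \<le> (\<integral>y. B \<partial>N k)"
          by (rule integral_mono) (use integrable_continuous_finite_measure[OF N g] B in auto)
        finally show ?thesis by (simp add: sp mult.commute)
      qed
      have "(\<lambda>k. B * ?m (r1 k)) \<longlonglongrightarrow> B * 0"
        using l True by (intro tendsto_intros) (simp add: o_def)
      then have lim0: "(\<lambda>k. B * ?m (r1 k)) \<longlonglongrightarrow> 0" by simp
      have "(\<lambda>k. \<integral>y. g y \<partial>N (r1 k)) \<longlonglongrightarrow> 0"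
        by (rule Lim_null_comparison[OF always_eventually lim0]) (simp only: real_norm_def le HOL.simp_thms)
      then show "(\<lambda>k. \<integral>y. g y \<partial>N (r1 k)) \<longlonglongrightarrow> (\<integral>y. g y \<partial>null_measure borel)" by simp
    qed
    then show thesis using r1 by (intro that) (auto intro: finite_measureI)
  next
    case False
    then have "0 < l" using l0 by simp
    then have "\<forall>\<^sub>F k in sequentially. 0 < ?m (r1 k)" using order_tendstoD(1)[OF l] by (simp add: o_def)
    then obtain k0 where k0: "\<And>k. k0 \<le> k \<Longrightarrow> 0 < ?m (r1 k)" unfolding eventually_sequentially by blast
    define s where "s k = r1 (k + k0)" for k
    have s: "strict_mono s" using r1 by (auto simp: s_def strict_mono_def)
    have spos: "0 < ?m (s k)" for k using k0[of "k + k0"] by (simp add: s_def)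
    have sl: "(\<lambda>k. ?m (s k)) \<longlonglongrightarrow> l"
      using LIMSEQ_ignore_initial_segment[OF l, of k0] by (simp add: s_def o_def)
    define R where "R k = scale_measure (ennreal (1 / ?m (s k))) (N (s k))" for k
    have R: "prob_space (R k)" "sets (R k) = sets borel" for k
    proof -
      interpret finite_measure "N (s k)" by (rule N)
      show "sets (R k) = sets borel" by (simp add: R_def N(2))
      have "emeasure (N (s k)) UNIV = ennreal (?m (s k))" by (rule emeasure_eq_measure)
      then show "prob_space (R k)"
        using spos[of k] by (intro prob_spaceI) (simp add: R_def space_scale_measure sp ennreal_mult[symmetric])
    qed
    obtain r2 K where r2: "strict_mono r2" and K: "prob_space K" "sets K = sets borel"
      and wc: "weak_star_conv (\<lambda>k. R (r2 k)) K"
      by (rule weak_star_compactness_normalized[OF R])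
    interpret K: prob_space K by (rule K)
    have "weak_star_conv (\<lambda>k. N (s (r2 k))) (scale_measure (ennreal l) K)"
      unfolding weak_star_conv_def
    proof (intro allI impI)
      fix g :: "ennreal \<Rightarrow> real" assume g: "continuous_on UNIV g"
      note mg = borel_measurable_continuous_ennreal[OF g]
      have "(\<integral>y. g y \<partial>N (s k)) = ?m (s k) * (\<integral>y. g y \<partial>R k)" for k
      proof -
        have "g \<in> borel_measurable (N (s k))" unfolding measurable_cong_sets[OF N(2)[of "s k"] refl] by (rule mg)
        from integral_scale_measure[OF _ this, of "1 / ?m (s k)"] spos[of k]
        have "(\<integral>y. g y \<partial>R k) = 1 / ?m (s k) * (\<integral>y. g y \<partial>N (s k))" unfolding R_def by simp
        then show ?thesis using spos[of k] by simp
      qed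
      moreover have "(\<lambda>k. ?m (s (r2 k)) * (\<integral>y. g y \<partial>R (r2 k))) \<longlonglongrightarrow> l * (\<integral>y. g y \<partial>K)"
        using wc g LIMSEQ_subseq_LIMSEQ[OF sl r2] by (intro tendsto_mult) (simp_all add: weak_star_conv_def o_def)
      moreover have "(\<integral>y. g y \<partial>scale_measure (ennreal l) K) = l * (\<integral>y. g y \<partial>K)"
        by (rule integral_scale_measure[OF l0]) (unfold measurable_cong_sets[OF K(2) refl], rule mg)
      ultimately show "(\<lambda>k. \<integral>y. g y \<partial>N (s (r2 k))) \<longlonglongrightarrow> (\<integral>y. g y \<partial>scale_measure (ennreal l) K)" by simp
    qed
    moreover have "finite_measure (scale_measure (ennreal l) K)"
      by (rule finite_measureI) (simp add: space_scale_measure K.emeasure_space_1)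
    moreover have "strict_mono (\<lambda>k. s (r2 k))" using s r2 by (simp add: strict_mono_def)
    ultimately show thesis using K by (intro that[of "\<lambda>k. s (r2 k)"]) auto
  qed
qed

subsection \<open>Recovering the mechanism from the flow\<close>

lemma convergentI_almost:
  fixes f :: "nat \<Rightarrow> real"
  assumes "\<And>e. 0 < e \<Longrightarrow> \<exists>d. \<forall>\<^sub>F k in sequentially. \<bar>f k - d\<bar> \<le> e"
  shows "convergent f"
proof (rule Cauchy_convergent, rule metric_CauchyI)
  fix e :: real assume e: "0 < e"
  then obtain d where "\<forall>\<^sub>F k in sequentially. \<bar>f k - d\<bar> \<le> e / 3" using assms[of "e / 3"] by auto
  then obtain K where K: "\<And>k. K \<le> k \<Longrightarrow> \<bar>f k - d\<bar> \<le> e / 3" unfolding eventually_sequentially by blast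
  have "dist (f m) (f n) < e" if "K \<le> m" "K \<le> n" for m n
    unfolding dist_real_def using K[OF that(1)] K[OF that(2)] e by linarith
  then show "\<exists>K. \<forall>m\<ge>K. \<forall>n\<ge>K. dist (f m) (f n) < e" by blast
qed

context galton_watson_scaling
begin

lemma dflow_drop_ge:
  assumes "\<And>i. i < n \<Longrightarrow> c \<le> mechanism k (dflow k i q)"
  shows "real n * \<tau> k * c \<le> dflow k 0 q - dflow k n q"
  using assms
proof (induction n)
  case (Suc n)
  have "\<tau> k * c \<le> \<tau> k * mechanism k (dflow k n q)"
    using Suc.prems[of n] \<tau>(1)[of k] by (intro mult_left_mono) auto
  moreover have "real n * \<tau> k * c \<le> dflow k 0 q - dflow k n q" using Suc by simp
  ultimately show ?case unfolding dflow_euler by (simp add: algebra_simps)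
qed simp

lemma dflow_drop_le:
  assumes "\<And>i. i < n \<Longrightarrow> mechanism k (dflow k i q) \<le> c"
  shows "dflow k 0 q - dflow k n q \<le> real n * \<tau> k * c"
  using assms
proof (induction n)
  case (Suc n)
  have "\<tau> k * mechanism k (dflow k n q) \<le> \<tau> k * c"
    using Suc.prems[of n] \<tau>(1)[of k] by (intro mult_left_mono) auto
  moreover have "dflow k 0 q - dflow k n q \<le> real n * \<tau> k * c" using Suc by simp
  ultimately show ?case unfolding dflow_euler by (simp add: algebra_simps)
qed simp

lemma mechanism_mono:
  "0 \<le> s \<Longrightarrow> s \<le> s' \<Longrightarrow> h k * s' \<le> 1 \<Longrightarrow> mechanism k s \<le> mechanism k s'"
  by (rule discrete_mechanism_increment(1)[OF mean h(1) \<tau>(1)])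

lemma dflow_anti: "0 \<le> q \<Longrightarrow> m \<le> n \<Longrightarrow> dflow k n q \<le> dflow k m q"
  by (rule discrete_flow_decreasing[OF mean h(1) \<tau>(1)])

text \<open>A number of steps that takes at least the time \<open>T k\<close>, and exceeds it by less than one step.\<close>

lemma steps_tendsto:
  assumes t: "\<And>k. 0 < T k" and lim: "T \<longlonglongrightarrow> t"
  shows "(\<lambda>k. real (nat \<lceil>T k / \<tau> k\<rceil>) * \<tau> k) \<longlonglongrightarrow> t"
    and "T k \<le> real (nat \<lceil>T k / \<tau> k\<rceil>) * \<tau> k"
proof -
  have c: "T k / \<tau> k \<le> real (nat \<lceil>T k / \<tau> k\<rceil>)" "real (nat \<lceil>T k / \<tau> k\<rceil>) \<le> T k / \<tau> k + 1" for k
    using divide_pos_pos[OF t[of k] \<tau>(1)[of k]] by linarith+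
  show l: "T k \<le> real (nat \<lceil>T k / \<tau> k\<rceil>) * \<tau> k" for k
    using c(1)[of k] \<tau>(1)[of k] by (simp add: pos_divide_le_eq)
  have u: "real (nat \<lceil>T k / \<tau> k\<rceil>) * \<tau> k \<le> T k + \<tau> k" for k
    using mult_right_mono[OF c(2)[of k] less_imp_le[OF \<tau>(1)[of k]]] \<tau>(1)[of k]
    by (simp add: distrib_right)
  have "(\<lambda>k. T k + \<tau> k) \<longlonglongrightarrow> t + 0" by (intro tendsto_intros lim \<tau>(2))
  then have u': "(\<lambda>k. T k + \<tau> k) \<longlonglongrightarrow> t" by simp
  show "(\<lambda>k. real (nat \<lceil>T k / \<tau> k\<rceil>) * \<tau> k) \<longlonglongrightarrow> t"
    by (rule tendsto_sandwich[OF _ _ lim u']) (use l u in auto)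
qed

end

locale convergent_populations = galton_watson_scaling +
  fixes \<Phi> :: "real \<Rightarrow> real \<Rightarrow> real"
  assumes conv: "\<And>q t n. 0 < q \<Longrightarrow> 0 \<le> t \<Longrightarrow> (\<lambda>k. real (n k) * \<tau> k) \<longlonglongrightarrow> t \<Longrightarrow>
      (\<lambda>k. dflow k (n k) q) \<longlonglongrightarrow> \<Phi> q t"
begin

lemma limit_at_0: assumes q: "0 < q" shows "\<Phi> q 0 = q"
proof (rule LIMSEQ_unique)
  show "(\<lambda>k. dflow k 0 q) \<longlonglongrightarrow> \<Phi> q 0" using conv[OF q order_refl, of "\<lambda>_. 0"] by simp
  show "(\<lambda>k. dflow k 0 q) \<longlonglongrightarrow> q" using discrete_flow_0_tendsto[OF h, of q p] q by simp
qed

text \<open>If \<open>\<Psi>\<^sub>k(s)\<close> were unbounded in \<open>k\<close>, the flow started at \<open>2 s\<close> would fall below \<open>s\<close> within a number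
  of steps that amounts to a vanishing time, although it converges to \<open>2 s\<close>.  The running maximum
  \<open>A\<close> makes the choice of the number of steps explicit without passing to subsequences.\<close>

lemma mechanism_bounded:
  assumes s: "0 < s"
  obtains C where "\<forall>\<^sub>F k in sequentially. mechanism k s \<le> C"
proof -
  define a where "a k = (if h k * s \<le> 1 then mechanism k s else 0)" for k
  have a0: "0 \<le> a k" for k
    using discrete_mechanism_nonneg[OF mean h(1) \<tau>(1), of s k] s by (simp add: a_def)
  have "\<exists>C. \<forall>k. a k \<le> C"
  proof (rule ccontr)
    assume "\<not> ?thesis"
    then have unb: "\<exists>k. C < a k" for C by (meson not_le)
    define A where "A k = Max (a ` {..k})" for k
    have aA: "a j \<le> A k" if "j \<le> k" for j k unfolding A_def using that by (intro Max_ge) auto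
    have A0: "0 \<le> A k" for k using aA[of k k] a0[of k] by simp
    have Aex: "\<exists>j\<le>k. A k = a j" for k
    proof -
      have "A k \<in> a ` {..k}" unfolding A_def by (rule Max_in) auto
      then show ?thesis by auto
    qed
    have Amono: "A j \<le> A k" if "j \<le> k" for j k
      unfolding A_def using that by (intro Max_mono) auto
    have Alim: "filterlim A at_top sequentially"
      unfolding filterlim_at_top
    proof
      fix Z
      obtain k where k: "Z < a k" using unb by blast
      have "Z \<le> A j" if "k \<le> j" for j using k aA[OF that] by simp
      then show "\<forall>\<^sub>F j in sequentially. Z \<le> A j" unfolding eventually_sequentially by blast
    qed
    \<comment> \<open>this time tends to \<open>0\<close>, but \<open>T k * a k\<close> is unbounded along the records of \<open>a\<close>\<close>
    define T where "T k = 1 / sqrt (1 + A k)" for k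
    have T0: "0 < T k" for k using A0[of k] by (simp add: T_def)
    have "filterlim (\<lambda>k. sqrt (1 + A k)) at_top sequentially"
      by (intro filterlim_compose[OF sqrt_at_top] filterlim_tendsto_add_at_top[OF tendsto_const Alim])
    then have T: "T \<longlonglongrightarrow> 0" unfolding T_def
      by (intro tendsto_divide_0[OF tendsto_const] filterlim_at_top_imp_at_infinity)
    define n where "n k = nat \<lceil>T k / \<tau> k\<rceil>" for k
    note nT = steps_tendsto[OF T0 T, folded n_def]
    have "(\<lambda>k. dflow k (n k) (2 * s)) \<longlonglongrightarrow> 2 * s"
      using conv[OF _ order_refl nT(1), of "2 * s"] limit_at_0[of "2 * s"] s by simp
    then have "\<forall>\<^sub>F k in sequentially. s < dflow k (n k) (2 * s)"
      by (rule order_tendstoD(1)) (use s in simp)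
    then obtain K where K: "\<And>k. K \<le> k \<Longrightarrow> s < dflow k (n k) (2 * s)"
      unfolding eventually_sequentially by blast
    have le: "a k \<le> 2 * s * sqrt (1 + A k)" if k: "K \<le> k" for k
    proof (cases "h k * s \<le> 1")
      case True
      have s2: "0 \<le> 2 * s" using s by simp
      have "real (n k) * \<tau> k * a k \<le> dflow k 0 (2 * s) - dflow k (n k) (2 * s)"
      proof (rule dflow_drop_ge)
        fix i assume "i < n k"
        then have "s \<le> dflow k i (2 * s)" using dflow_anti[OF s2, of i "n k" k] K[OF k] by simp
        then show "a k \<le> mechanism k (dflow k i (2 * s))"
          unfolding a_def using True s dflow_bounds(3)[OF s2] by (auto intro!: mechanism_mono)
      qed
      also have "\<dots> \<le> 2 * s" using dflow_bounds(1)[OF s2, of k "n k"] dflow_bounds(2)[OF s2, of k 0] by simp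
      finally have 1: "real (n k) * \<tau> k * a k \<le> 2 * s" .
      have "T k * a k \<le> real (n k) * \<tau> k * a k" using nT(2)[of k] a0[of k] by (intro mult_right_mono)
      with 1 have "a k / sqrt (1 + A k) \<le> 2 * s" by (simp add: T_def)
      then show ?thesis using A0[of k] by (simp add: pos_divide_le_eq)
    next
      case False
      then show ?thesis using s A0[of k] by (simp add: a_def)
    qed
    have "\<forall>\<^sub>F k in sequentially. A K + (4 * s\<^sup>2 + 1) < A k \<and> K \<le> k"
      using Alim by (intro eventually_conj eventually_ge_at_top) (simp add: filterlim_at_top_dense)
    then obtain k where k: "A K + (4 * s\<^sup>2 + 1) < A k" "K \<le> k"
      using eventually_happens trivial_limit_sequentially by blast
    \<comment> \<open>a record, at which \<open>A j = a j\<close>\<close>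
    obtain j where j: "j \<le> k" "A k = a j" using Aex by blast
    have "K \<le> j"
    proof (rule ccontr)
      assume "\<not> K \<le> j"
      then have "a j \<le> A K" by (intro aA) simp
      moreover have "0 \<le> 4 * s\<^sup>2 + 1" by simp
      ultimately show False using k j by linarith
    qed
    have Aj: "A j = a j" using aA[of j j] Amono[OF j(1)] j(2) by simp
    let ?y = "a j"
    have y: "4 * s\<^sup>2 + 1 < ?y" using k j A0[of K] by linarith
    have "?y \<le> 2 * s * sqrt (1 + ?y)" using le[OF \<open>K \<le> j\<close>] Aj by simp
    then have "?y\<^sup>2 \<le> (2 * s * sqrt (1 + ?y))\<^sup>2" using a0[of j] by (intro power_mono) auto
    also have "\<dots> = 4 * s\<^sup>2 * (1 + ?y)" using a0[of j] by (simp add: power_mult_distrib)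
    also have "\<dots> < (4 * s\<^sup>2 + 1) * ?y"
      using y by (simp add: algebra_simps)
    also have "\<dots> \<le> ?y * ?y" using y a0[of j] by (intro mult_right_mono) auto
    finally show False by (simp add: power2_eq_square)
  qed
  then obtain C where C: "\<And>k. a k \<le> C" by blast
  have "\<forall>\<^sub>F k in sequentially. mechanism k s \<le> C"
    using eventually_small[OF less_imp_le[OF s]] 
  proof eventually_elim
    case (elim k)
    then show ?case using C[of k] by (simp add: a_def)
  qed
  then show thesis by (rule that)
qed

text \<open>The kernel at \<open>s = 1\<close> is bounded below, so \<open>\<Psi>\<^sub>k(1)\<close> controls the total weight.\<close>

lemma weight_bounded:
  obtains C where "0 < C" "\<forall>\<^sub>F k in sequentially. weight k \<le> C"
proof -
  obtain C1 where C1: "\<forall>\<^sub>F k in sequentially. mechanism k 1 \<le> C1" using mechanism_bounded[of 1] by auto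
  obtain c where c: "0 < c" "\<And>x. c \<le> branching_test 1 x"
    using continuous_ennreal_pos_bound[OF continuous_branching_test[of 1] branching_test_pos[of 1]] by auto
  define d where "d = min 1 (c / 8)"
  have d: "0 < d" "d \<le> 1" "d * 4 \<le> c / 2" using c by (auto simp: d_def)
  have d3: "0 < d ^ 3" using d by simp
  have "\<forall>\<^sub>F k in sequentially. weight k \<le> \<bar>C1\<bar> * 2 / c + 1"
    using C1 eventually_h_le[OF d3] eventually_small[OF zero_le_one]
  proof eventually_elim
    case (elim k)
    have ker: "c / 2 \<le> discrete_kernel (h k) 1 j" if "2 \<le> j" for j
    proof -
      have "\<bar>discrete_kernel (h k) 1 j - branching_test 1 (ennreal (real j * h k))\<bar> \<le> d * (1 ^ 3 + 2 * 1 + 1\<^sup>2)"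
        by (rule discrete_kernel_close_to_branching_test[OF h(1) elim(2) d(1,2) zero_le_one elim(3) that])
      then show ?thesis using c(2)[of "ennreal (real j * h k)"] d(3) by simp
    qed
    have "c / 2 * weight k = family_integral (p k) (h k) (\<tau> k) (\<lambda>_. c / 2)"
      by (rule family_integral_const[symmetric])
    also have "\<dots> \<le> family_integral (p k) (h k) (\<tau> k) (discrete_kernel (h k) 1)"
      by (rule family_integral_mono[where B = "\<bar>c / 2\<bar>", OF mean h(1) \<tau>(1) _ discrete_kernel_bounds[OF h(1) zero_le_one elim(3)] ker])
         auto
    also have "\<dots> = mechanism k 1"
      by (rule discrete_mechanism_eq_family_integral[OF mean h(1) \<tau>(1) zero_le_one elim(3), symmetric])
    finally have "c / 2 * weight k \<le> \<bar>C1\<bar>" using elim(1) by simp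
    then show ?case using c(1) by (simp add: field_simps)
  qed
  then show thesis using c(1) by (intro that[of "\<bar>C1\<bar> * 2 / c + 1"]) (auto intro: add_nonneg_pos)
qed

text \<open>Over a short time \<open>t\<close> the flow drops by about \<open>t \<Psi>\<^sub>k(q)\<close>, with an error of order \<open>t\<^sup>2\<close> that is
  uniform in \<open>k\<close>.  So \<open>(q - \<Phi>(q,t)) / t\<close> locates the limit points of \<open>\<Psi>\<^sub>k(q)\<close> up to \<open>O(t)\<close>.\<close>

lemma mechanism_convergent:
  assumes q: "0 < q" shows "convergent (\<lambda>k. mechanism k q)"
proof -
  have q0: "0 \<le> q" using q by simp
  obtain W where W: "0 < W" "\<forall>\<^sub>F k in sequentially. weight k \<le> W" by (rule weight_bounded)
  obtain C0 where C0: "\<forall>\<^sub>F k in sequentially. mechanism k q \<le> C0" by (rule mechanism_bounded[OF q])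
  define C where "C = \<bar>C0\<bar>"
  define L where "L = (2 + q) * W"
  have L: "0 < L" and C: "0 \<le> C" using q W by (auto simp: L_def C_def)
  have main: "\<exists>d. \<forall>\<^sub>F k in sequentially. \<bar>mechanism k q - d\<bar> \<le> (L * C + 1) * t" if t: "0 < t" for t
  proof -
    define n where "n k = nat \<lceil>t / \<tau> k\<rceil>" for k
    note nt = steps_tendsto[of "\<lambda>_. t", OF t tendsto_const, folded n_def]
    let ?N = "\<lambda>k. real (n k) * \<tau> k"
    let ?g = "\<lambda>k. (dflow k 0 q - dflow k (n k) q) / ?N k"
    let ?d = "(q - \<Phi> q t) / t"
    have x0: "(\<lambda>k. dflow k 0 q) \<longlonglongrightarrow> q" by (rule discrete_flow_0_tendsto[OF h q0])
    have g: "?g \<longlonglongrightarrow> ?d"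
      using t by (intro tendsto_divide tendsto_diff x0 conv[OF q _ nt(1)] nt(1)) auto
    have "(\<lambda>k. \<bar>?g k - ?d\<bar> + L * C * (?N k - t) + L * (q - dflow k 0 q)) \<longlonglongrightarrow> \<bar>?d - ?d\<bar> + L * C * (t - t) + L * (q - q)"
      by (intro tendsto_intros g nt(1) x0)
    then have "\<forall>\<^sub>F k in sequentially. \<bar>?g k - ?d\<bar> + L * C * (?N k - t) + L * (q - dflow k 0 q) < t"
      by (rule order_tendstoD(2)) (use t in simp)
    with W(2) C0 eventually_small[OF q0]
    have "\<forall>\<^sub>F k in sequentially. \<bar>mechanism k q - ?d\<bar> \<le> (L * C + 1) * t"
    proof eventually_elim
      case (elim k)
      have N: "0 < ?N k" using nt(2)[of k] t by simp
      let ?x = "\<lambda>i. dflow k i q"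
      have xq: "0 \<le> ?x i" "?x i \<le> q" "h k * ?x i \<le> 1" for i using dflow_bounds[OF q0] by auto
      have lip: "mechanism k b - mechanism k a \<le> L * (b - a)" if ab: "0 \<le> a" "a \<le> b" "b \<le> q" for a b
      proof -
        have hb: "h k * b \<le> 1" using mult_left_mono[OF ab(3) less_imp_le[OF h(1)[of k]]] elim(3) by simp
        have "mechanism k b - mechanism k a \<le> (2 + b) * (b - a) * weight k"
          by (rule discrete_mechanism_increment(2)[OF mean h(1) \<tau>(1) ab(1,2) hb])
        also have "\<dots> \<le> (2 + q) * (b - a) * W"
          using ab elim(1) weight_nonneg[of k] q by (intro mult_mono) auto
        also have "\<dots> = L * (b - a)" by (simp add: L_def)
        finally show ?thesis .
      qed
      have m0: "mechanism k (?x 0) \<le> mechanism k q" by (rule mechanism_mono[OF xq(1,2) elim(3)])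
      then have m0C: "mechanism k (?x 0) \<le> C" using elim(2) by (simp add: C_def)
      have mi: "mechanism k (?x i) \<le> mechanism k (?x 0)" for i
        by (rule mechanism_mono[OF xq(1) dflow_anti[OF q0 le0] xq(3)])
      have drop: "?x 0 - ?x (n k) \<le> ?N k * mechanism k (?x 0)" by (rule dflow_drop_le[OF mi])
      have dropC: "?x 0 - ?x (n k) \<le> ?N k * C"
        by (rule order_trans[OF drop mult_left_mono[OF m0C less_imp_le[OF N]]])
      have "?N k * (mechanism k (?x 0) - L * (?N k * C)) \<le> ?x 0 - ?x (n k)"
      proof (rule dflow_drop_ge)
        fix i assume i: "i < n k"
        have "mechanism k (?x 0) - mechanism k (?x i) \<le> L * (?x 0 - ?x i)"
          by (rule lip[OF xq(1) dflow_anti[OF q0 le0] xq(2)])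
        also have "\<dots> \<le> L * (?N k * C)"
          using dropC dflow_anti[OF q0, of i "n k" k] i L by (intro mult_left_mono) auto
        finally show "mechanism k (?x 0) - L * (?N k * C) \<le> mechanism k (?x i)" by linarith
      qed
      then have g1: "mechanism k (?x 0) - L * (?N k * C) \<le> ?g k"
        using N by (simp add: pos_le_divide_eq mult.commute)
      have g2: "?g k \<le> mechanism k (?x 0)" using drop N by (simp add: pos_divide_le_eq mult.commute)
      have g3: "mechanism k q \<le> mechanism k (?x 0) + L * (q - ?x 0)"
        using lip[OF xq(1,2) order_refl, of 0] by linarith
      have e1: "L * (?N k * C) = L * C * (?N k - t) + L * C * t" by (simp add: algebra_simps)
      have e2: "(L * C + 1) * t = L * C * t + t" by (simp add: algebra_simps)
      have p1: "0 \<le> L * C * (?N k - t)" using L C nt(2)[of k] by (intro mult_nonneg_nonneg) auto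
      have p2: "0 \<le> L * (q - ?x 0)" using L xq(2)[of 0] by simp
      have p3: "0 \<le> L * C * t" using L C t by simp
      show ?case unfolding e2 using g1 g2 g3 m0 e1 p1 p2 p3 elim(4) by linarith
    qed
    then show ?thesis by blast
  qed
  show ?thesis
  proof (rule convergentI_almost)
    fix e :: real assume e: "0 < e"
    have LC: "0 < L * C + 1" using L C by (intro add_nonneg_pos) auto
    from main[of "e / (L * C + 1)"] e LC show "\<exists>d. \<forall>\<^sub>F k in sequentially. \<bar>mechanism k q - d\<bar> \<le> e"
      by simp
  qed
qed

text \<open>By compactness there is a limit \<open>\<kappa>\<close> along a subsequence.  As \<open>\<Psi>\<^sub>k(q)\<close> converges along the full sequence, the
  integrals of the branching test functions converge to those against \<open>\<kappa>\<close>, and these determine the limit.\<close>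

lemma families_converge: "\<exists>\<kappa>. finite_measure \<kappa> \<and> sets \<kappa> = sets borel \<and> weak_star_conv family \<kappa>"
proof -
  obtain W where W: "0 < W" "\<forall>\<^sub>F k in sequentially. weight k \<le> W" by (rule weight_bounded)
  then obtain K where K: "\<And>k. K \<le> k \<Longrightarrow> weight k \<le> W" unfolding eventually_sequentially by blast
  have "measure (family k) UNIV = weight k" for k unfolding weight_eq by simp
  then have bound: "measure (family (k + K)) UNIV \<le> W" for k using K by simp
  obtain r \<kappa> where r: "strict_mono r" and \<kappa>: "finite_measure \<kappa>" "sets \<kappa> = sets borel"
    and wc: "weak_star_conv (\<lambda>k. family (r k + K)) \<kappa>"
    by (rule weak_star_compactness[of "\<lambda>k. family (k + K)", OF finite_family sets_min1_measure bound])
  have "weak_star_conv family \<kappa>"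
  proof (rule weak_star_conv_by_branching_tests[OF finite_family sets_min1_measure \<kappa>])
    fix q :: real assume q: "0 < q"
    then have q0: "0 \<le> q" by simp
    obtain l where l: "(\<lambda>k. mechanism k q) \<longlonglongrightarrow> l" using mechanism_convergent[OF q] by (auto simp: convergent_def)
    from tendsto_diff[OF this mechanism_minus_test_tendsto_0[OF W(2) q0]]
    have full: "(\<lambda>k. \<integral>y. branching_test q y \<partial>family k) \<longlonglongrightarrow> l" by simp
    have "strict_mono (\<lambda>k. r k + K)" using r by (simp add: strict_mono_def)
    from LIMSEQ_subseq_LIMSEQ[OF full this]
    have "(\<lambda>k. \<integral>y. branching_test q y \<partial>family (r k + K)) \<longlonglongrightarrow> l" by (simp add: o_def)
    moreover have "(\<lambda>k. \<integral>y. branching_test q y \<partial>family (r k + K)) \<longlonglongrightarrow> (\<integral>y. branching_test q y \<partial>\<kappa>)"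
      using wc continuous_branching_test[OF q0] by (simp add: weak_star_conv_def)
    ultimately have "l = (\<integral>y. branching_test q y \<partial>\<kappa>)" by (rule LIMSEQ_unique)
    with full show "(\<lambda>k. \<integral>y. branching_test q y \<partial>family k) \<longlonglongrightarrow> (\<integral>y. branching_test q y \<partial>\<kappa>)" by simp
  qed
  with \<kappa> show ?thesis by blast
qed

end

section \<open>Scaling limits of critical Galton-Watson processes\<close>

lemma integral_bernstein_test_kappa:
  assumes "levy_measure \<nu>" "0 \<le> b" "0 < q"
  shows "(\<integral>y. bernstein_test q y \<partial>kappa_measure b 0 \<nu>) = b * q + (\<integral>x. (1 - exp (- q * x)) \<partial>\<nu>)"
proof -
  have "(\<integral>x. min x 1 * bernstein_test q (ennreal x) \<partial>\<nu>) = (\<integral>x. (1 - exp (- q * x)) \<partial>\<nu>)"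
    by (rule Bochner_Integration.integral_cong[OF refl])
       (use levy_measure_space[OF assms(1)] in \<open>simp only: min1_bernstein_test greaterThan_iff\<close>)
  then show ?thesis
    using assms by (subst integral_kappa_measure) (auto simp: continuous_bernstein_test)
qed

theorem corollary6p5:
  fixes p :: "nat \<Rightarrow> nat pmf"
    and h \<tau> :: "nat \<Rightarrow> real"
    and M :: "nat \<Rightarrow> 'w measure"
    and \<xi> :: "nat \<Rightarrow> nat \<Rightarrow> nat \<Rightarrow> 'w \<Rightarrow> nat"
  assumes mean: "\<And>k. (\<lambda>j. real j * pmf (p k) j) sums 1"
    and h: "\<And>k. 0 < h k" "h \<longlonglongrightarrow> 0"
    and \<tau>: "\<And>k. 0 < \<tau> k" "\<tau> \<longlonglongrightarrow> 0"
    and gw: "\<And>k. iid_family_sizes (M k) (p k) (\<xi> k)"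
  defines "\<mu>b \<equiv> \<lambda>k. rescaled_family_measure (p k) (h k) (\<tau> k)"
    and "\<nu>h \<equiv> \<lambda>k n. rescaled_population_measure (M k) (\<xi> k) (h k) n"
  defines "conv \<equiv> \<lambda>(\<beta>0 :: real \<Rightarrow> real) (\<nu> :: real \<Rightarrow> real measure).
      \<forall>t\<ge>0. \<forall>n :: nat \<Rightarrow> nat. (\<lambda>k. real (n k) * \<tau> k) \<longlonglongrightarrow> t \<longrightarrow>
        weak_star_conv (\<lambda>k. min1_measure (\<nu>h k (n k))) (kappa_measure (\<beta>0 t) 0 (\<nu> t))"
  shows
    "(\<forall>\<kappa> \<alpha>0 \<alpha>inf \<mu> \<Psi> \<phi> \<beta>0 \<nu>.
        levy_converges \<mu>b \<kappa> \<and>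
        levy_triple \<alpha>0 \<alpha>inf \<mu> \<and> \<kappa> = kappa_measure \<alpha>0 \<alpha>inf \<mu> \<and>
        \<Psi> = branching_mechanism \<alpha>0 \<alpha>inf \<mu> \<and>
        branching_flow \<Psi> \<phi> \<and>
        (\<forall>t\<ge>0. bernstein_representation (\<lambda>q. \<phi> q t) (\<beta>0 t) (\<nu> t))
        \<longrightarrow>
        conv \<beta>0 \<nu>
        \<and>
        (\<exists>L :: ereal. ((\<lambda>q. ereal (deriv \<Psi> q)) \<longlongrightarrow> L) at_top \<and>
           ((\<forall>t>0. \<beta>0 t = 0) \<longleftrightarrow> L = \<infinity>) \<and>
           (L = \<infinity> \<longleftrightarrow> \<alpha>0 > 0 \<or> (\<integral>\<^sup>+x. 1 \<partial>\<mu>) = \<infinity>) \<and>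
           (L < \<infinity> \<longrightarrow> (\<forall>t\<ge>0. \<beta>0 t = exp (- real_of_ereal L * t))))
        \<and>
        (\<forall>t>0. \<exists>\<phi>inf :: ennreal. ((\<lambda>q. ennreal (\<phi> q t)) \<longlongrightarrow> \<phi>inf) at_top \<and>
           (\<phi>inf = (\<integral>\<^sup>+x. 1 \<partial>\<nu> t) \<and> (\<integral>\<^sup>+x. 1 \<partial>\<nu> t) < \<infinity> \<longleftrightarrow> grey_condition \<Psi>))
        \<and>
        (grey_condition \<Psi> \<longrightarrow>
           (\<forall>t>0. finite_measure (\<nu> t)) \<and> smoluchowski_weak_solution \<Psi> \<nu>))
     \<and>
     (\<forall>\<beta>0 \<nu>.
        (\<forall>t\<ge>0. 0 \<le> \<beta>0 t \<and> levy_measure (\<nu> t)) \<and> conv \<beta>0 \<nu>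
        \<longrightarrow> (\<exists>\<kappa>. levy_converges \<mu>b \<kappa>))"
proof (intro conjI allI impI)
  interpret galton_watson_scaling p h \<tau>
    using mean h \<tau> by unfold_locales
  {
    fix \<kappa> \<alpha>0 \<alpha>inf \<mu> \<Psi> \<phi> and \<beta>0 :: "real \<Rightarrow> real" and \<nu> :: "real \<Rightarrow> real measure"
    assume A: "levy_converges \<mu>b \<kappa> \<and>
        levy_triple \<alpha>0 \<alpha>inf \<mu> \<and> \<kappa> = kappa_measure \<alpha>0 \<alpha>inf \<mu> \<and>
        \<Psi> = branching_mechanism \<alpha>0 \<alpha>inf \<mu> \<and>
        branching_flow \<Psi> \<phi> \<and>
        (\<forall>t\<ge>0. bernstein_representation (\<lambda>q. \<phi> q t) (\<beta>0 t) (\<nu> t))"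
    then have lt: "levy_triple \<alpha>0 \<alpha>inf \<mu>" and \<Psi>: "\<Psi> = branching_mechanism \<alpha>0 \<alpha>inf \<mu>"
      and flow: "branching_flow (branching_mechanism \<alpha>0 \<alpha>inf \<mu>) \<phi>"
      and wc: "weak_star_conv family (kappa_measure \<alpha>0 \<alpha>inf \<mu>)"
      and rep: "\<And>t. 0 \<le> t \<Longrightarrow> bernstein_representation (\<lambda>q. \<phi> q t) (\<beta>0 t) (\<nu> t)"
      by (auto simp: levy_converges_def \<mu>b_def)
    interpret B: branching_flow_setup \<alpha>0 \<alpha>inf \<mu> \<phi> using lt flow by unfold_locales
    show "conv \<beta>0 \<nu>"
      unfolding conv_def
    proof (intro allI impI)
      fix t and n :: "nat \<Rightarrow> nat" assume t: "0 \<le> t" and n: "(\<lambda>k. real (n k) * \<tau> k) \<longlonglongrightarrow> t"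
      have l: "levy_measure (\<nu> t)" and b: "0 \<le> \<beta>0 t"
        and \<phi>: "\<And>q. 0 < q \<Longrightarrow> \<phi> q t = \<beta>0 t * q + (\<integral>x. (1 - exp (- q * x)) \<partial>\<nu> t)"
        using rep[OF t] by (auto simp: bernstein_representation_def)
      show "weak_star_conv (\<lambda>k. min1_measure (\<nu>h k (n k))) (kappa_measure (\<beta>0 t) 0 (\<nu> t))"
        unfolding \<nu>h_def
      proof (rule weak_star_conv_by_bernstein_tests)
        show "finite_measure (min1_measure (rescaled_population_measure (M k) (\<xi> k) (h k) (n k)))" for k
          by (rule finite_min1_measure[OF levy_measure_rescaled_population[OF gw h(1)]])
        show "finite_measure (kappa_measure (\<beta>0 t) 0 (\<nu> t))" by (rule finite_kappa_measure[OF l])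
        fix q :: real assume q: "0 < q"
        show "(\<lambda>k. \<integral>y. bernstein_test q y \<partial>min1_measure (rescaled_population_measure (M k) (\<xi> k) (h k) (n k)))
            \<longlonglongrightarrow> (\<integral>y. bernstein_test q y \<partial>kappa_measure (\<beta>0 t) 0 (\<nu> t))"
          unfolding integral_bernstein_test_population[OF gw h(1) q] integral_bernstein_test_kappa[OF l b q]
            \<phi>[OF q, symmetric]
          by (rule dflow_tendsto[OF lt flow wc q t n])
      qed simp_all
    qed
    obtain L :: ereal where L: "((\<lambda>q. ereal (mechanism_derivative \<alpha>0 \<alpha>inf \<mu> q)) \<longlongrightarrow> L) at_top"
      "L = \<infinity> \<longleftrightarrow> \<alpha>0 > 0 \<or> (\<integral>\<^sup>+x. 1 \<partial>\<mu>) = \<infinity>" "0 \<le> L"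
      by (rule mechanism_derivative_limit[OF lt])
    have "\<forall>\<^sub>F q in at_top. ereal (mechanism_derivative \<alpha>0 \<alpha>inf \<mu> q) = ereal (deriv \<Psi> q)"
      using eventually_gt_at_top[of "0::real"]
      by eventually_elim (simp add: \<Psi> branching_mechanism_derivs(2)[OF lt])
    with L(1) have lim: "((\<lambda>q. ereal (deriv \<Psi> q)) \<longlongrightarrow> L) at_top" by (rule Lim_transform_eventually)
    have fin: "\<beta>0 t = exp (- real_of_ereal L * t)" if "L < \<infinity>" "0 \<le> t" for t
    proof -
      have "L = ereal (real_of_ereal L)" using that L(3) by (cases L) auto
      with L(1) have "((\<lambda>q. ereal (mechanism_derivative \<alpha>0 \<alpha>inf \<mu> q)) \<longlongrightarrow> ereal (real_of_ereal L)) at_top"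
        by metis
      then show ?thesis by (rule B.drift_eq_exp[OF rep[OF that(2)] that(2)])
    qed
    have inf: "(\<forall>t>0. \<beta>0 t = 0) \<longleftrightarrow> L = \<infinity>"
    proof
      assume z: "\<forall>t>0. \<beta>0 t = 0"
      show "L = \<infinity>"
      proof (rule ccontr)
        assume "L \<noteq> \<infinity>"
        then have "\<beta>0 1 = exp (- real_of_ereal L * 1)" by (intro fin) (auto simp: less_top)
        then show False using z by simp
      qed
    next
      assume "L = \<infinity>"
      then have "((\<lambda>q. ereal (mechanism_derivative \<alpha>0 \<alpha>inf \<mu> q)) \<longlongrightarrow> \<infinity>) at_top" using L(1) by simp
      then show "\<forall>t>0. \<beta>0 t = 0" using B.drift_eq_0[OF rep[OF less_imp_le]] by blast
    qed
    show "\<exists>L :: ereal. ((\<lambda>q. ereal (deriv \<Psi> q)) \<longlongrightarrow> L) at_top \<and>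
           ((\<forall>t>0. \<beta>0 t = 0) \<longleftrightarrow> L = \<infinity>) \<and>
           (L = \<infinity> \<longleftrightarrow> \<alpha>0 > 0 \<or> (\<integral>\<^sup>+x. 1 \<partial>\<mu>) = \<infinity>) \<and>
           (L < \<infinity> \<longrightarrow> (\<forall>t\<ge>0. \<beta>0 t = exp (- real_of_ereal L * t)))"
      using lim inf L(2) fin by blast
    fix t :: real
    {
      assume t: "0 < t"
      have r: "bernstein_representation (\<lambda>q. \<phi> q t) (\<beta>0 t) (\<nu> t)" using rep t by simp
      show "\<exists>\<phi>inf :: ennreal. ((\<lambda>q. ennreal (\<phi> q t)) \<longlongrightarrow> \<phi>inf) at_top \<and>
           (\<phi>inf = (\<integral>\<^sup>+x. 1 \<partial>\<nu> t) \<and> (\<integral>\<^sup>+x. 1 \<partial>\<nu> t) < \<infinity> \<longleftrightarrow> grey_condition \<Psi>)"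
        using bernstein_representation_limit(1,2)[OF r] B.flow_bounded_iff_grey[OF t] unfolding \<Psi> by blast
    }
    assume grey: "grey_condition \<Psi>"
    interpret G: grey_flow \<alpha>0 \<alpha>inf \<mu> \<phi> \<beta>0 \<nu> using rep grey by unfold_locales (auto simp: \<Psi>)
    show "0 < t \<Longrightarrow> finite_measure (\<nu> t)" by (rule G.finite_\<nu>)
    show "smoluchowski_weak_solution \<Psi> \<nu>" unfolding \<Psi> by (rule G.smoluchowski)
  next
    fix \<beta>0 :: "real \<Rightarrow> real" and \<nu> :: "real \<Rightarrow> real measure"
    assume A: "(\<forall>t\<ge>0. 0 \<le> \<beta>0 t \<and> levy_measure (\<nu> t)) \<and> conv \<beta>0 \<nu>"
    have "convergent_populations p h \<tau> (\<lambda>q t. \<beta>0 t * q + (\<integral>x. (1 - exp (- q * x)) \<partial>\<nu> t))"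
    proof unfold_locales
      fix q t :: real and n :: "nat \<Rightarrow> nat"
      assume q: "0 < q" and t: "0 \<le> t" and n: "(\<lambda>k. real (n k) * \<tau> k) \<longlonglongrightarrow> t"
      have l: "levy_measure (\<nu> t)" and b: "0 \<le> \<beta>0 t" using A t by auto
      have "weak_star_conv (\<lambda>k. min1_measure (\<nu>h k (n k))) (kappa_measure (\<beta>0 t) 0 (\<nu> t))"
        using A t n unfolding conv_def by blast
      then have "(\<lambda>k. \<integral>y. bernstein_test q y \<partial>min1_measure (\<nu>h k (n k)))
          \<longlonglongrightarrow> (\<integral>y. bernstein_test q y \<partial>kappa_measure (\<beta>0 t) 0 (\<nu> t))"
        using continuous_bernstein_test[OF less_imp_le[OF q]] unfolding weak_star_conv_def by blast
      then show "(\<lambda>k. dflow k (n k) q) \<longlonglongrightarrow> \<beta>0 t * q + (\<integral>x. (1 - exp (- q * x)) \<partial>\<nu> t)"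
        unfolding \<nu>h_def integral_bernstein_test_population[OF gw h(1) q] integral_bernstein_test_kappa[OF l b q] .
    qed
    from convergent_populations.families_converge[OF this]
    show "\<exists>\<kappa>. levy_converges \<mu>b \<kappa>" unfolding levy_converges_def \<mu>b_def by blast
  }
qed

end
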